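(* Let $G$ be a finite group, $H \leq G$ a subgroup, and $N$ a normal subgroup of $G$ with $N \subseteq H$. Then $$ d_0(H/N, G/N)\ \leq\ d_0(H,G)\ \leq\ d_0(H/N, G/N) +1 .$$
   Context: Modules $M, N$ over a ring are called similar if $M$ is isomorphic to a direct summand of $q\cdot N = N\oplus\cdots\oplus N$ ($q$ times) and $N$ is isomorphic to a direct summand of $r\cdot M$, for some positive integers $q,r$. For a unital subalgebra $B\subseteq A$ of finite-dimensional algebras over a field, let $A^{\otimes_B n}$ be the $n$-fold tensor product of $A$ over $B$, with $A^{\otimes_B 0}=B$ (only a $B$-$B$-bimodule). The extension $B\subseteq A$ has depth $2n+1$ ($n\ge 0$) if $A^{\otimes_B(n+1)}$ and $A^{\otimes_B n}$ are similar as $B$-$B$-bimodules; it has left (resp. right) depth $2n$ ($n\geq 1$) if they are similar as $B$-$A$-bimodules (resp. $A$-$B$-bimodules); it has depth $2n$ if it has left or right depth $2n$. If it has depth $m$ then it has depth $m+1$. The minimum depth $d(B,A)$ is the least $m\geq 1$ such that $B\subseteq A$ has depth $m$. For a subgroup $H$ of a finite group $G$, $d_0(H,G) := d(kH,kG)$, where $k$ is a field of characteristic zero; this number is finite and does not depend on the choice of the field $k$ of characteristic zero. *)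

theory Defs
  imports "HOL-Algebra.Ring" "HOL-Algebra.Free_Abelian_Groups" "HOL-Library.Extended_Nat"
begin

section \<open>Bimodules\<close>

text \<open>
  The additive group of a bimodule is written multiplicatively, as a \<^typ>\<open>'m monoid\<close>, so that
  products, quotients and isomorphisms of groups can be taken from the library. The scalars on
  either side are drawn from subrings \<open>L\<close> and \<open>R\<close> of one ambient ring; \<open>L\<close> and \<open>R\<close>
  are arguments of the notions below, so restriction of scalars leaves the record unchanged.

  There is no separate action of a ground field \<open>k\<close>. For unital subalgebras \<open>L\<close>, \<open>R\<close> of a
  \<open>k\<close>-algebra, the field acts through \<open>k 1 \<subseteq> L\<close> and \<open>k 1 \<subseteq> R\<close>, so sub-bimodules and
  bimodule homomorphisms are automatically \<open>k\<close>-linear.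
\<close>

record ('a, 'm) bimod = "'m monoid" +
  lact :: "'a \<Rightarrow> 'm \<Rightarrow> 'm"
  ract :: "'m \<Rightarrow> 'a \<Rightarrow> 'm"

definition bimod_iso ::
    "'a set \<Rightarrow> 'a set \<Rightarrow> ('a, 'm) bimod \<Rightarrow> ('a, 'n) bimod \<Rightarrow> bool" where
  "bimod_iso L R M N \<longleftrightarrow>
     (\<exists>f \<in> iso M N. \<forall>x \<in> carrier M.
        (\<forall>a \<in> L. f (lact M a x) = lact N a (f x)) \<and>
        (\<forall>a \<in> R. f (ract M x a) = ract N (f x) a))"

definition sub_bimod :: "'a set \<Rightarrow> 'a set \<Rightarrow> 'm set \<Rightarrow> ('a, 'm) bimod \<Rightarrow> bool" where
  "sub_bimod L R S M \<longleftrightarrow> subgroup S M \<and>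
     (\<forall>x \<in> S. (\<forall>a \<in> L. lact M a x \<in> S) \<and> (\<forall>a \<in> R. ract M x a \<in> S))"

definition direct_summand :: "'a set \<Rightarrow> 'a set \<Rightarrow> 'm set \<Rightarrow> ('a, 'm) bimod \<Rightarrow> bool" where
  "direct_summand L R S M \<longleftrightarrow> sub_bimod L R S M \<and>
     (\<exists>T. sub_bimod L R T M \<and> S \<inter> T = {\<one>\<^bsub>M\<^esub>} \<and> S <#>\<^bsub>M\<^esub> T = carrier M)"

definition bimod_multiple :: "nat \<Rightarrow> ('a, 'm) bimod \<Rightarrow> ('a, nat \<Rightarrow> 'm) bimod" where
  "bimod_multiple q M = monoid.extend (product_group {..<q} (\<lambda>_. M))
     \<lparr>lact = (\<lambda>a x. \<lambda>i\<in>{..<q}. lact M a (x i)),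
      ract = (\<lambda>x a. \<lambda>i\<in>{..<q}. ract M (x i) a)\<rparr>"

definition divides_multiple ::
    "'a set \<Rightarrow> 'a set \<Rightarrow> ('a, 'm) bimod \<Rightarrow> ('a, 'n) bimod \<Rightarrow> bool" where
  "divides_multiple L R M N \<longleftrightarrow>
     (\<exists>q \<ge> 1. \<exists>S. direct_summand L R S (bimod_multiple q N) \<and>
        bimod_iso L R M (bimod_multiple q N\<lparr>carrier := S\<rparr>))"

definition similar_bimod ::
    "'a set \<Rightarrow> 'a set \<Rightarrow> ('a, 'm) bimod \<Rightarrow> ('a, 'n) bimod \<Rightarrow> bool" where
  "similar_bimod L R M N \<longleftrightarrow> divides_multiple L R M N \<and> divides_multiple L R N M"


section \<open>Tensor powers of a ring over a subring\<close>

text \<open>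
  For \<open>n \<ge> 1\<close> the power \<open>A \<otimes>\<^sub>B \<dots> \<otimes>\<^sub>B A\<close> with \<open>n\<close> factors is the free abelian group on the
  lists \<open>[x\<^sub>1, \<dots>, x\<^sub>n]\<close> with entries in \<open>A\<close>, modulo additivity in each entry and
  \<open>[\<dots>, x b, y, \<dots>] = [\<dots>, x, b y, \<dots>]\<close> for \<open>b \<in> B\<close>. If \<open>B\<close> is a unital subalgebra of
  a \<open>k\<close>-algebra \<open>A\<close>, the scalars \<open>k 1 \<subseteq> B\<close> make these relations \<open>k\<close>-multilinear.
\<close>

definition tensor_words :: "('a, 'z) ring_scheme \<Rightarrow> nat \<Rightarrow> 'a list set" where
  "tensor_words A n = {xs. set xs \<subseteq> carrier A \<and> length xs = n}"

definition tensor_relators ::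
    "('a, 'z) ring_scheme \<Rightarrow> 'a set \<Rightarrow> nat \<Rightarrow> ('a list \<Rightarrow>\<^sub>0 int) set" where
  "tensor_relators A B n =
     {frag_of (xs @ [x \<oplus>\<^bsub>A\<^esub> y] @ ys) - frag_of (xs @ [x] @ ys) - frag_of (xs @ [y] @ ys)
       | xs ys x y. x \<in> carrier A \<and> y \<in> carrier A \<and>
           set xs \<subseteq> carrier A \<and> set ys \<subseteq> carrier A \<and> length xs + 1 + length ys = n} \<union>
     {frag_of (xs @ [x \<otimes>\<^bsub>A\<^esub> b, y] @ ys) - frag_of (xs @ [x, b \<otimes>\<^bsub>A\<^esub> y] @ ys)
       | xs ys x y b. x \<in> carrier A \<and> y \<in> carrier A \<and> b \<in> B \<and>
           set xs \<subseteq> carrier A \<and> set ys \<subseteq> carrier A \<and> length xs + 2 + length ys = n}"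

definition tensor_kernel ::
    "('a, 'z) ring_scheme \<Rightarrow> 'a set \<Rightarrow> nat \<Rightarrow> ('a list \<Rightarrow>\<^sub>0 int) set" where
  "tensor_kernel A B n =
     generate (free_Abelian_group (tensor_words A n)) (tensor_relators A B n)"

text \<open>
  The map induced on the quotient by the additive extension of a map \<open>f\<close> on words; for the
  actions below, the set under \<^const>\<open>the_elem\<close> is a singleton because \<open>f\<close> respects the relators.
\<close>

definition tensor_map ::
    "('a, 'z) ring_scheme \<Rightarrow> 'a set \<Rightarrow> nat \<Rightarrow> ('a list \<Rightarrow> 'a list) \<Rightarrow>
     ('a list \<Rightarrow>\<^sub>0 int) set \<Rightarrow> ('a list \<Rightarrow>\<^sub>0 int) set" where
  "tensor_map A B n f X =
     the_elem ((\<lambda>c. tensor_kernel A B n #>\<^bsub>free_Abelian_group (tensor_words A n)\<^esub>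
                      frag_extend (\<lambda>xs. frag_of (f xs)) c) ` X)"

text \<open>
  The definition is meant for \<open>n \<ge> 1\<close>. The zeroth power is \<open>B\<close> with its regular
  bimodule structure, which lives on a different type and is given separately.
\<close>

definition tensor_power ::
    "('a, 'z) ring_scheme \<Rightarrow> 'a set \<Rightarrow> nat \<Rightarrow> ('a, ('a list \<Rightarrow>\<^sub>0 int) set) bimod" where
  "tensor_power A B n =
     monoid.extend (free_Abelian_group (tensor_words A n) Mod tensor_kernel A B n)
       \<lparr>lact = (\<lambda>a. tensor_map A B n (\<lambda>xs. (a \<otimes>\<^bsub>A\<^esub> hd xs) # tl xs)),
        ract = (\<lambda>X a. tensor_map A B n (\<lambda>xs. butlast xs @ [last xs \<otimes>\<^bsub>A\<^esub> a]) X)\<rparr>"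

definition regular_bimod :: "('a, 'z) ring_scheme \<Rightarrow> 'a set \<Rightarrow> ('a, 'a) bimod" where
  "regular_bimod A B =
     \<lparr>carrier = B, monoid.mult = ring.add A, one = ring.zero A,
      lact = monoid.mult A, ract = monoid.mult A\<rparr>"


section \<open>Depth\<close>

definition depth_odd :: "('a, 'z) ring_scheme \<Rightarrow> 'a set \<Rightarrow> nat \<Rightarrow> bool" where
  "depth_odd A B n \<longleftrightarrow>
     (if n = 0 then similar_bimod B B (tensor_power A B 1) (regular_bimod A B)
      else similar_bimod B B (tensor_power A B (n + 1)) (tensor_power A B n))"

definition left_depth_even :: "('a, 'z) ring_scheme \<Rightarrow> 'a set \<Rightarrow> nat \<Rightarrow> bool" where
  "left_depth_even A B n \<longleftrightarrow>
     similar_bimod B (carrier A) (tensor_power A B (n + 1)) (tensor_power A B n)"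

definition right_depth_even :: "('a, 'z) ring_scheme \<Rightarrow> 'a set \<Rightarrow> nat \<Rightarrow> bool" where
  "right_depth_even A B n \<longleftrightarrow>
     similar_bimod (carrier A) B (tensor_power A B (n + 1)) (tensor_power A B n)"

definition has_depth :: "'a set \<Rightarrow> ('a, 'z) ring_scheme \<Rightarrow> nat \<Rightarrow> bool" where
  "has_depth B A m \<longleftrightarrow>
     (\<exists>n. m = 2 * n + 1 \<and> depth_odd A B n) \<or>
     (\<exists>n \<ge> 1. m = 2 * n \<and> (left_depth_even A B n \<or> right_depth_even A B n))"

text \<open>The value is \<open>\<infinity>\<close> exactly when the extension has no finite depth.\<close>

definition min_depth :: "'a set \<Rightarrow> ('a, 'z) ring_scheme \<Rightarrow> enat" where
  "min_depth B A = Inf (enat ` {m. 1 \<le> m \<and> has_depth B A m})"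


section \<open>Group algebras and the depth of a subgroup\<close>

definition group_algebra :: "('g, 'z) monoid_scheme \<Rightarrow> ('g \<Rightarrow>\<^sub>0 'k::field) ring" where
  "group_algebra G =
     \<lparr>carrier = {f. Poly_Mapping.keys f \<subseteq> carrier G},
      monoid.mult = (\<lambda>f g. \<Sum>x\<in>Poly_Mapping.keys f. \<Sum>y\<in>Poly_Mapping.keys g.
         Poly_Mapping.single (x \<otimes>\<^bsub>G\<^esub> y) (Poly_Mapping.lookup f x * Poly_Mapping.lookup g y)),
      one = Poly_Mapping.single \<one>\<^bsub>G\<^esub> 1,
      ring.zero = 0,
      ring.add = (+)\<rparr>"

text \<open>
  The type argument is the coefficient field \<open>k\<close>. Since \<open>k H\<close> consists of the elements of
  \<open>k G\<close> supported in \<open>H\<close>, it is literally a subset of the carrier of \<open>k G\<close>.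
\<close>

definition d0 ::
    "'k::field_char_0 itself \<Rightarrow> 'g set \<Rightarrow> ('g, 'z) monoid_scheme \<Rightarrow> enat" where
  "d0 _ H G =
     min_depth (carrier (group_algebra (G\<lparr>carrier := H\<rparr>) :: ('g \<Rightarrow>\<^sub>0 'k) ring)) (group_algebra G)"

end

theory Submission
  imports Defs
begin

text \<open>
  For \<open>n \<ge> 1\<close> the tensor power of \<open>k G\<close> over \<open>k H\<close> with \<open>n\<close> factors is the permutation
  bimodule on \<open>(G/H)\<^sup>n\<^sup>-\<^sup>1 \<times> G\<close>, with \<open>G\<close> acting diagonally from the left and on the last
  component from the right. A module is a direct summand of a multiple of another one iff its identity
  is a finite sum of endomorphisms factoring through the latter; for permutation modules this is a
  condition on invariant matrices, which passes to quotients of the underlying sets by normal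
  subgroups and one-sided actions. Factoring out \<open>N\<close> shows that \<open>H/N \<subseteq> G/N\<close> has every depth that
  \<open>H \<subseteq> G\<close> has. Factoring out the right action turns depth \<open>2n\<close> of \<open>H/N \<subseteq> G/N\<close> (depth
  \<open>2n - 1\<close> likewise) into similarity of the left \<open>H/N\<close>-modules on the \<open>n\<close>th and the
  \<open>n - 1\<close>st power of \<open>(G/N)/(H/N)\<close>. As this coset space is \<open>G/H\<close>, multiplying by the factor
  \<open>G\<close> gives depth \<open>2n\<close> of \<open>H \<subseteq> G\<close>.
\<close>


section \<open>Bilinear extensions of maps of bases\<close>


text \<open>Similarity asks only for summands of multiples, so no module has to be decomposed:
  everything becomes a search for invariant matrices whose products sum to the identity. The tensor
  powers are presented by integer combinations of words, with the scalars of \<open>k\<close> hidden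
  in the balancing relations; most of the work before the matrices goes into showing that these
  relations identify exactly the combinations with equal expansion. Both bounds rest on one fact:
  \<open>N\<close> is normal and contained in \<open>H\<close>, so it fixes every coset in
  \<open>G/H\<close>. Hence \<open>G\<close> and \<open>G/N\<close> have the same tuples of cosets,
  and points over the two groups differ only in the last component. For the lower bound, right
  multiplication by \<open>N\<close> is transitive on the fibres. For the upper bound, the last
  component is discarded and put back as a free factor. What is put back carries a right action of
  all of \<open>G\<close>, that is, an even depth: odd depth \<open>2n + 1\<close> returns as
  \<open>2n + 2\<close>, while even depth returns unchanged. This is the source of the
  \<open>+ 1\<close>. Right even depth is reduced to left even depth by inverting group
  elements.\<close>

abbreviation "supp \<equiv> Poly_Mapping.keys"
abbreviation "coeff \<equiv> Poly_Mapping.lookup"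
abbreviation "monom \<equiv> Poly_Mapping.single"

text \<open>One construction covers the product of \<open>k G\<close>, both actions on permutation
  modules and the expansion of words. The values \<open>f x y\<close> may coincide, and then
  coefficients add up.\<close>

definition bilinear_ext :: "('a \<Rightarrow> 'b \<Rightarrow> 'c) \<Rightarrow> ('a \<Rightarrow>\<^sub>0 'k) \<Rightarrow> ('b \<Rightarrow>\<^sub>0 'k) \<Rightarrow> ('c \<Rightarrow>\<^sub>0 'k::field)" where
  "bilinear_ext f a v = (\<Sum>x\<in>supp a. \<Sum>y\<in>supp v. monom (f x y) (coeff a x * coeff v y))"

lemma bilinear_ext_superset:
  assumes "finite A" "supp a \<subseteq> A" "finite B" "supp v \<subseteq> B"
  shows "bilinear_ext f a v = (\<Sum>x\<in>A. \<Sum>y\<in>B. monom (f x y) (coeff a x * coeff v y))"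
proof -
  have "bilinear_ext f a v = (\<Sum>x\<in>supp a. \<Sum>y\<in>B. monom (f x y) (coeff a x * coeff v y))"
    unfolding bilinear_ext_def
    by (intro sum.cong sum.mono_neutral_left) (use assms in \<open>auto simp: in_keys_iff\<close>)
  also have "\<dots> = (\<Sum>x\<in>A. \<Sum>y\<in>B. monom (f x y) (coeff a x * coeff v y))"
    by (intro sum.mono_neutral_left) (use assms in \<open>auto simp: in_keys_iff\<close>)
  finally show ?thesis .
qed

lemma bilinear_ext_add_left: "bilinear_ext f (a + b) v = bilinear_ext f a v + bilinear_ext f b v"
proof -
  have "finite (supp a \<union> supp b)" "supp (a + b) \<subseteq> supp a \<union> supp b"
    by (simp_all add: Poly_Mapping.keys_add)
  then show ?thesis
    by (subst (1 2 3) bilinear_ext_superset[of "supp a \<union> supp b" _ "supp v"])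
      (auto simp: lookup_add algebra_simps single_add sum.distrib)
qed

lemma bilinear_ext_add_right: "bilinear_ext f a (v + w) = bilinear_ext f a v + bilinear_ext f a w"
proof -
  have "finite (supp v \<union> supp w)" "supp (v + w) \<subseteq> supp v \<union> supp w"
    by (simp_all add: Poly_Mapping.keys_add)
  then show ?thesis
    by (subst (1 2 3) bilinear_ext_superset[of "supp a" _ "supp v \<union> supp w"])
      (auto simp: lookup_add algebra_simps single_add sum.distrib)
qed

lemma bilinear_ext_zero [simp]: "bilinear_ext f 0 v = 0" "bilinear_ext f a 0 = 0"
  by (simp_all add: bilinear_ext_def)

lemma bilinear_ext_monom [simp]: "bilinear_ext f (monom x c) (monom y d) = monom (f x y) (c * d)"
  by (subst bilinear_ext_superset[of "{x}" _ "{y}"]) auto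

lemma bilinear_ext_sum_left: "bilinear_ext f (\<Sum>i\<in>I. a i) v = (\<Sum>i\<in>I. bilinear_ext f (a i) v)"
  by (induction I rule: infinite_finite_induct) (auto simp: bilinear_ext_add_left)

lemma bilinear_ext_sum_right: "bilinear_ext f a (\<Sum>i\<in>I. v i) = (\<Sum>i\<in>I. bilinear_ext f a (v i))"
  by (induction I rule: infinite_finite_induct) (auto simp: bilinear_ext_add_right)

lemma supp_bilinear_ext:
  assumes "\<And>x y. x \<in> supp a \<Longrightarrow> y \<in> supp v \<Longrightarrow> f x y \<in> Z"
  shows "supp (bilinear_ext f a v) \<subseteq> Z"
proof -
  have "supp (monom (f x y) c) \<subseteq> Z" if "x \<in> supp a" "y \<in> supp v" for x y c
    using assms[OF that] by auto
  then have *: "supp (\<Sum>y\<in>supp v. monom (f x y) (coeff a x * coeff v y)) \<subseteq> Z" if "x \<in> supp a" for x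
    using that by (intro order.trans[OF keys_sum] UN_least)
  then show ?thesis
    unfolding bilinear_ext_def by (intro order.trans[OF keys_sum] UN_least *)
qed

lemma poly_mapping_expand:
  assumes "finite S" "supp f \<subseteq> S"
  shows "f = (\<Sum>x\<in>S. monom x (coeff f x))"
proof (rule poly_mapping_eqI)
  fix y
  have "coeff f y = 0" if "y \<notin> S" using assms that by (auto simp: in_keys_iff)
  then show "coeff f y = coeff (\<Sum>x\<in>S. monom x (coeff f x)) y"
    using assms by (simp add: lookup_sum lookup_single when_def)
qed

text \<open>The monomial case allows any coefficient, because some of the maps it is applied to are
  additive without being linear.\<close>

lemma poly_mapping_supp_induct [consumes 1, case_names zero monom add]:
  fixes f :: "'a \<Rightarrow>\<^sub>0 'k::comm_monoid_add"
  assumes "supp f \<subseteq> S"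
    and "P 0"
    and "\<And>x c. x \<in> S \<Longrightarrow> P (monom x c)"
    and add: "\<And>f g. supp f \<subseteq> S \<Longrightarrow> supp g \<subseteq> S \<Longrightarrow> P f \<Longrightarrow> P g \<Longrightarrow> P (f + g)"
  shows "P f"
proof -
  have "supp (\<Sum>x\<in>I. monom x (coeff f x)) \<subseteq> S \<and> P (\<Sum>x\<in>I. monom x (coeff f x))" if "finite I" "I \<subseteq> S" for I
    using that
  proof (induction I)
    case (insert x I)
    have "supp (monom x (coeff f x)) \<subseteq> S" using insert by auto
    moreover have "supp (monom x (coeff f x) + (\<Sum>x\<in>I. monom x (coeff f x))) \<subseteq> S"
      using insert calculation Poly_Mapping.keys_add[of "monom x (coeff f x)" "\<Sum>x\<in>I. monom x (coeff f x)"] by blast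
    ultimately show ?case using insert assms by auto
  qed (use assms in auto)
  from this[of "supp f"] show ?thesis
    using assms(1) poly_mapping_expand[of "supp f" f] by simp
qed

text \<open>Action and compatibility laws are identities between basis elements; the sets
  \<open>A\<close>, \<open>B\<close>, \<open>C\<close> restrict them to the group elements and
  points for which they hold.\<close>

lemma bilinear_ext_assoc:
  assumes "\<And>x y z. x \<in> A \<Longrightarrow> y \<in> B \<Longrightarrow> z \<in> C \<Longrightarrow> f x (g y z) = f' (g' x y) z"
    and "supp a \<subseteq> A" "supp b \<subseteq> B" "supp c \<subseteq> C"
  shows "bilinear_ext f a (bilinear_ext g b c) = bilinear_ext f' (bilinear_ext g' a b) c"
  using assms(2)
proof (induction rule: poly_mapping_supp_induct)
  case (monom x s)
  note x = this
  show ?case using assms(3)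
  proof (induction rule: poly_mapping_supp_induct)
    case (monom y t)
    show ?case using assms(4)
      by (induction rule: poly_mapping_supp_induct)
        (use x monom assms(1) in \<open>auto simp: bilinear_ext_add_right mult.assoc\<close>)
  qed (auto simp: bilinear_ext_add_left bilinear_ext_add_right)
qed (auto simp: bilinear_ext_add_left)


section \<open>Retracts of multiples of a bimodule\<close>


text \<open>Additivity of the actions makes multiples, kernels and images stable under them, and it
  lets finite sums pass through the actions.\<close>

locale additive_bimod = comm_group M
  for L R :: "'a set" and M :: "('a, 'm) bimod" +
  assumes lact_hom: "a \<in> L \<Longrightarrow> lact M a \<in> hom M M"
    and ract_hom: "a \<in> R \<Longrightarrow> (\<lambda>x. ract M x a) \<in> hom M M"
begin

lemma lact_closed [simp]: "a \<in> L \<Longrightarrow> x \<in> carrier M \<Longrightarrow> lact M a x \<in> carrier M"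
  and ract_closed [simp]: "b \<in> R \<Longrightarrow> x \<in> carrier M \<Longrightarrow> ract M x b \<in> carrier M"
  using lact_hom ract_hom by (fastforce simp: hom_def Pi_iff)+

lemma lact_mult: "a \<in> L \<Longrightarrow> x \<in> carrier M \<Longrightarrow> y \<in> carrier M \<Longrightarrow>
    lact M a (x \<otimes>\<^bsub>M\<^esub> y) = lact M a x \<otimes>\<^bsub>M\<^esub> lact M a y"
  and ract_mult: "b \<in> R \<Longrightarrow> x \<in> carrier M \<Longrightarrow> y \<in> carrier M \<Longrightarrow>
    ract M (x \<otimes>\<^bsub>M\<^esub> y) b = ract M x b \<otimes>\<^bsub>M\<^esub> ract M y b"
  using lact_hom ract_hom by (auto simp: hom_def)

lemma lact_one [simp]: "a \<in> L \<Longrightarrow> lact M a \<one>\<^bsub>M\<^esub> = \<one>\<^bsub>M\<^esub>"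
  and ract_one [simp]: "b \<in> R \<Longrightarrow> ract M \<one>\<^bsub>M\<^esub> b = \<one>\<^bsub>M\<^esub>"
  using hom_one[OF lact_hom] hom_one[OF ract_hom] is_group by auto

end

definition bimod_hom ::
    "'a set \<Rightarrow> 'a set \<Rightarrow> ('a, 'm) bimod \<Rightarrow> ('a, 'n) bimod \<Rightarrow> ('m \<Rightarrow> 'n) set" where
  "bimod_hom L R M N = {f \<in> hom M N. \<forall>x\<in>carrier M.
     (\<forall>a\<in>L. f (lact M a x) = lact N a (f x)) \<and> (\<forall>a\<in>R. f (ract M x a) = ract N (f x) a)}"

lemma bimod_homI:
  assumes "\<And>x. x \<in> carrier M \<Longrightarrow> f x \<in> carrier N"
    "\<And>x y. x \<in> carrier M \<Longrightarrow> y \<in> carrier M \<Longrightarrow> f (x \<otimes>\<^bsub>M\<^esub> y) = f x \<otimes>\<^bsub>N\<^esub> f y"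
    "\<And>x a. x \<in> carrier M \<Longrightarrow> a \<in> L \<Longrightarrow> f (lact M a x) = lact N a (f x)"
    "\<And>x a. x \<in> carrier M \<Longrightarrow> a \<in> R \<Longrightarrow> f (ract M x a) = ract N (f x) a"
  shows "f \<in> bimod_hom L R M N"
  using assms by (auto simp: bimod_hom_def hom_def)

lemma bimod_homD:
  assumes "f \<in> bimod_hom L R M N" "x \<in> carrier M"
  shows "f x \<in> carrier N"
    "y \<in> carrier M \<Longrightarrow> f (x \<otimes>\<^bsub>M\<^esub> y) = f x \<otimes>\<^bsub>N\<^esub> f y"
    "a \<in> L \<Longrightarrow> f (lact M a x) = lact N a (f x)"
    "b \<in> R \<Longrightarrow> f (ract M x b) = ract N (f x) b"
  using assms by (auto simp: bimod_hom_def hom_def)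

lemma bimod_hom_comp:
  assumes "f \<in> bimod_hom L R M N" "g \<in> bimod_hom L R N K"
  shows "(\<lambda>x. g (f x)) \<in> bimod_hom L R M K"
  by (rule bimod_homI) (use assms in \<open>auto simp: bimod_homD\<close>)

lemma direct_summand_imp_retract:
  assumes M: "additive_bimod L R M" and Q: "additive_bimod L R Q"
    and S: "direct_summand L R S Q" and iso: "bimod_iso L R M (Q\<lparr>carrier := S\<rparr>)"
  obtains f g where "f \<in> bimod_hom L R M Q" "g \<in> bimod_hom L R Q M"
    "\<And>x. x \<in> carrier M \<Longrightarrow> g (f x) = x"
proof -
  interpret M: additive_bimod L R M by fact
  interpret Q: additive_bimod L R Q by fact
  from S obtain T where T: "sub_bimod L R S Q" "sub_bimod L R T Q" "S \<inter> T = {\<one>\<^bsub>Q\<^esub>}" "S <#>\<^bsub>Q\<^esub> T = carrier Q"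
    unfolding direct_summand_def by blast
  interpret S: subgroup S Q using T by (simp add: sub_bimod_def)
  interpret T: subgroup T Q using T by (simp add: sub_bimod_def)
  from iso obtain f where f: "f \<in> iso M (Q\<lparr>carrier := S\<rparr>)"
    and fl: "\<And>x a. x \<in> carrier M \<Longrightarrow> a \<in> L \<Longrightarrow> f (lact M a x) = lact Q a (f x)"
    and fr: "\<And>x a. x \<in> carrier M \<Longrightarrow> a \<in> R \<Longrightarrow> f (ract M x a) = ract Q (f x) a"
    unfolding bimod_iso_def by auto
  have bij: "bij_betw f (carrier M) S" using f by (auto simp: iso_def)
  have fS: "f x \<in> S" if "x \<in> carrier M" for x using bij that by (auto simp: bij_betw_def)
  have fm: "f (x \<otimes>\<^bsub>M\<^esub> y) = f x \<otimes>\<^bsub>Q\<^esub> f y" if "x \<in> carrier M" "y \<in> carrier M" for x y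
    using f that by (auto simp: iso_def hom_def)
  \<comment> \<open>Two decompositions of the same element give \<open>s'^-1 s = t' t^-1\<close>, an
    element of \<open>S \<inter> T\<close>.\<close>
  have uniq: "s = s'" if "s \<in> S" "s' \<in> S" "t \<in> T" "t' \<in> T" "s \<otimes>\<^bsub>Q\<^esub> t = s' \<otimes>\<^bsub>Q\<^esub> t'" for s s' t t'
  proof -
    have c: "s \<in> carrier Q" "s' \<in> carrier Q" "t \<in> carrier Q" "t' \<in> carrier Q"
      using that by auto
    have "inv\<^bsub>Q\<^esub> s' \<otimes>\<^bsub>Q\<^esub> s = inv\<^bsub>Q\<^esub> s' \<otimes>\<^bsub>Q\<^esub> (s \<otimes>\<^bsub>Q\<^esub> t) \<otimes>\<^bsub>Q\<^esub> inv\<^bsub>Q\<^esub> t"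
      using c by (simp add: Q.m_assoc)
    also have "\<dots> = inv\<^bsub>Q\<^esub> s' \<otimes>\<^bsub>Q\<^esub> (s' \<otimes>\<^bsub>Q\<^esub> t') \<otimes>\<^bsub>Q\<^esub> inv\<^bsub>Q\<^esub> t" by (simp add: that)
    also have "\<dots> = t' \<otimes>\<^bsub>Q\<^esub> inv\<^bsub>Q\<^esub> t"
      using c by (simp flip: Q.m_assoc)
    finally have "inv\<^bsub>Q\<^esub> s' \<otimes>\<^bsub>Q\<^esub> s \<in> S \<inter> T"
      by (metis IntI S.m_closed S.m_inv_closed T.m_closed T.m_inv_closed that(1-4))
    then have "inv\<^bsub>Q\<^esub> s' \<otimes>\<^bsub>Q\<^esub> s = \<one>\<^bsub>Q\<^esub>" using T(3) by auto
    then show ?thesis using c by (metis Q.inv_closed Q.inv_equality Q.inv_inv Q.inv_solve_left Q.r_one)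
  qed
  \<comment> \<open>The projection onto \<open>S\<close> along \<open>T\<close>. Followed by
    \<open>h\<close>, the inverse of \<open>f\<close>, it is the required left inverse of the
    embedding \<open>f\<close>.\<close>
  define p where "p y = (THE s. s \<in> S \<and> (\<exists>t\<in>T. y = s \<otimes>\<^bsub>Q\<^esub> t))" for y
  have p: "p (s \<otimes>\<^bsub>Q\<^esub> t) = s" if "s \<in> S" "t \<in> T" for s t
    unfolding p_def using that uniq by (intro the_equality) blast+
  have dec: "\<exists>s\<in>S. \<exists>t\<in>T. y = s \<otimes>\<^bsub>Q\<^esub> t" if "y \<in> carrier Q" for y
    using that unfolding T(4)[symmetric] set_mult_def by auto
  define h where "h = the_inv_into (carrier M) f"
  have hf: "h (f x) = x" if "x \<in> carrier M" for x
    unfolding h_def using bij that by (intro the_inv_into_f_f) (auto simp: bij_betw_def)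
  have sx: "\<exists>x\<in>carrier M. s = f x" if "s \<in> S" for s
    using bij that by (auto simp: bij_betw_def)
  have Sl: "lact Q a s \<in> S" if "a \<in> L" "s \<in> S" for a s using T(1) that by (auto simp: sub_bimod_def)
  have Sr: "ract Q s a \<in> S" if "a \<in> R" "s \<in> S" for a s using T(1) that by (auto simp: sub_bimod_def)
  have Tl: "lact Q a s \<in> T" if "a \<in> L" "s \<in> T" for a s using T(2) that by (auto simp: sub_bimod_def)
  have Tr: "ract Q s a \<in> T" if "a \<in> R" "s \<in> T" for a s using T(2) that by (auto simp: sub_bimod_def)
  have dec': "\<exists>x\<in>carrier M. \<exists>t\<in>T. y = f x \<otimes>\<^bsub>Q\<^esub> t" if "y \<in> carrier Q" for y
    using dec[OF that] sx by blast
  have g: "h (p (f x \<otimes>\<^bsub>Q\<^esub> t)) = x" if "x \<in> carrier M" "t \<in> T" for x t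
    using that by (simp add: p fS hf)
  have "(\<lambda>y. h (p y)) \<in> bimod_hom L R Q M"
  proof (rule bimod_homI)
    fix y assume "y \<in> carrier Q"
    from dec'[OF this] obtain x t where xt: "x \<in> carrier M" "t \<in> T" "y = f x \<otimes>\<^bsub>Q\<^esub> t" by blast
    then show "h (p y) \<in> carrier M" by (simp add: g)
    show "h (p (lact Q a y)) = lact M a (h (p y))" if "a \<in> L" for a
      using xt that fS by (simp add: g Q.lact_mult Tl flip: fl)
    show "h (p (ract Q y a)) = ract M (h (p y)) a" if "a \<in> R" for a
      using xt that fS by (simp add: g Q.ract_mult Tr flip: fr)
    fix y' assume "y' \<in> carrier Q"
    from dec'[OF this] obtain x' t' where xt': "x' \<in> carrier M" "t' \<in> T" "y' = f x' \<otimes>\<^bsub>Q\<^esub> t'" by blast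
    have "y \<otimes>\<^bsub>Q\<^esub> y' = f (x \<otimes>\<^bsub>M\<^esub> x') \<otimes>\<^bsub>Q\<^esub> (t \<otimes>\<^bsub>Q\<^esub> t')"
      using xt xt' fS by (simp add: fm Q.m_ac)
    then show "h (p (y \<otimes>\<^bsub>Q\<^esub> y')) = h (p y) \<otimes>\<^bsub>M\<^esub> h (p y')"
      using xt xt' by (simp add: g)
  qed
  moreover have "f \<in> bimod_hom L R M Q"
    by (rule bimod_homI) (use fS fm fl fr in auto)
  moreover have "h (p (f x)) = x" if "x \<in> carrier M" for x
    using g[OF that T.one_closed] fS that by simp
  ultimately show ?thesis using that by blast
qed

text \<open>The kernel of \<open>g\<close> is a complement of the image of \<open>f\<close>: every
  \<open>y\<close> splits into \<open>f (g y)\<close> and a factor killed by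
  \<open>g\<close>.\<close>

lemma retract_imp_direct_summand:
  assumes M: "additive_bimod L R M" and Q: "additive_bimod L R Q"
    and f: "f \<in> bimod_hom L R M Q" and g: "g \<in> bimod_hom L R Q M"
    and gf: "\<And>x. x \<in> carrier M \<Longrightarrow> g (f x) = x"
  shows "direct_summand L R (f ` carrier M) Q \<and> bimod_iso L R M (Q\<lparr>carrier := f ` carrier M\<rparr>)"
proof -
  interpret M: additive_bimod L R M by fact
  interpret Q: additive_bimod L R Q by fact
  note fD = bimod_homD[OF f] and gD = bimod_homD[OF g]
  interpret f: group_hom M Q f
    by unfold_locales (use f in \<open>auto simp: bimod_hom_def\<close>)
  interpret g: group_hom Q M g
    by unfold_locales (use g in \<open>auto simp: bimod_hom_def\<close>)
  let ?S = "f ` carrier M" and ?T = "kernel Q M g"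
  have S: "sub_bimod L R ?S Q"
    unfolding sub_bimod_def
  proof (intro conjI ballI)
    show "subgroup ?S Q" by (rule f.img_is_subgroup)
    fix y assume "y \<in> ?S"
    then obtain x where x: "x \<in> carrier M" "y = f x" by blast
    show "lact Q a y \<in> ?S" if "a \<in> L" for a
      using fD(3)[OF x(1) that] M.lact_closed[OF that x(1)] x(2) by (intro image_eqI) simp_all
    show "ract Q y a \<in> ?S" if "a \<in> R" for a
      using fD(4)[OF x(1) that] M.ract_closed[OF that x(1)] x(2) by (intro image_eqI) simp_all
  qed
  have T: "sub_bimod L R ?T Q"
    unfolding sub_bimod_def using g.subgroup_kernel by (auto simp: kernel_def gD(3,4))
  have int: "?S \<inter> ?T = {\<one>\<^bsub>Q\<^esub>}"
  proof (intro equalityI subsetI)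
    fix y assume "y \<in> ?S \<inter> ?T"
    then show "y \<in> {\<one>\<^bsub>Q\<^esub>}" using gf by (auto simp: kernel_def)
  next
    fix y assume "y \<in> {\<one>\<^bsub>Q\<^esub>}"
    then show "y \<in> ?S \<inter> ?T"
      using f.hom_one by (auto simp: kernel_def image_iff intro!: bexI[of _ "\<one>\<^bsub>M\<^esub>"])
  qed
  have "y \<in> ?S <#>\<^bsub>Q\<^esub> ?T" if "y \<in> carrier Q" for y
  proof -
    let ?s = "f (g y)"
    have "inv\<^bsub>Q\<^esub> ?s \<otimes>\<^bsub>Q\<^esub> y \<in> ?T"
      using that gf[of "g y"] by (simp add: kernel_def)
    moreover have "?s \<otimes>\<^bsub>Q\<^esub> (inv\<^bsub>Q\<^esub> ?s \<otimes>\<^bsub>Q\<^esub> y) = y"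
      using that by (simp flip: Q.m_assoc)
    ultimately show ?thesis using that unfolding set_mult_def
      by (intro UN_I[of ?s] UN_I[of "inv\<^bsub>Q\<^esub> ?s \<otimes>\<^bsub>Q\<^esub> y"]) auto
  qed
  moreover have "?S <#>\<^bsub>Q\<^esub> ?T \<subseteq> carrier Q"
    by (rule Q.set_mult_closed) (auto simp: kernel_def)
  ultimately have "?S <#>\<^bsub>Q\<^esub> ?T = carrier Q" by blast
  then have "direct_summand L R ?S Q"
    unfolding direct_summand_def by (intro conjI exI[of _ ?T] S T int)
  moreover have "inj_on f (carrier M)" by (rule inj_on_inverseI[of _ g]) (rule gf)
  then have "f \<in> iso M (Q\<lparr>carrier := ?S\<rparr>)"
    by (auto simp: iso_def hom_def bij_betw_def)
  then have "bimod_iso L R M (Q\<lparr>carrier := ?S\<rparr>)"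
    unfolding bimod_iso_def by (intro bexI[of _ f]) (simp_all add: fD)
  ultimately show ?thesis by blast
qed

lemma bimod_multiple_simps [simp]:
  "carrier (bimod_multiple q N) = (\<Pi>\<^sub>E i\<in>{..<q}. carrier N)"
  "x \<otimes>\<^bsub>bimod_multiple q N\<^esub> y = (\<lambda>i\<in>{..<q}. x i \<otimes>\<^bsub>N\<^esub> y i)"
  "\<one>\<^bsub>bimod_multiple q N\<^esub> = (\<lambda>i\<in>{..<q}. \<one>\<^bsub>N\<^esub>)"
  "lact (bimod_multiple q N) a x = (\<lambda>i\<in>{..<q}. lact N a (x i))"
  "ract (bimod_multiple q N) x a = (\<lambda>i\<in>{..<q}. ract N (x i) a)"
  by (simp_all add: bimod_multiple_def monoid.defs product_group_def)

lemma additive_bimod_multiple: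
  assumes "additive_bimod L R N"
  shows "additive_bimod L R (bimod_multiple q N)"
proof -
  interpret additive_bimod L R N by fact
  let ?Q = "bimod_multiple q N"
  have "comm_group ?Q"
  proof (rule comm_groupI)
    fix x assume "x \<in> carrier ?Q"
    then show "\<exists>y\<in>carrier ?Q. y \<otimes>\<^bsub>?Q\<^esub> x = \<one>\<^bsub>?Q\<^esub>"
      by (intro bexI[of _ "\<lambda>i\<in>{..<q}. inv\<^bsub>N\<^esub> (x i)"])
        (auto simp: PiE_iff intro!: restrict_ext l_inv)
  qed (auto simp: PiE_iff m_ac extensional_def intro!: ext)
  moreover have "additive_bimod_axioms L R ?Q"
  proof
    show "lact ?Q a \<in> hom ?Q ?Q" if "a \<in> L" for a
    proof (rule homI)
      fix x y assume "x \<in> carrier ?Q" "y \<in> carrier ?Q"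
      then have "x i \<in> carrier N" "y i \<in> carrier N" if "i < q" for i using that by auto
      then show "lact ?Q a x \<in> carrier ?Q"
        "lact ?Q a (x \<otimes>\<^bsub>?Q\<^esub> y) = lact ?Q a x \<otimes>\<^bsub>?Q\<^esub> lact ?Q a y"
        using that by (auto simp: lact_mult intro!: restrict_ext)
    qed
    show "(\<lambda>x. ract ?Q x a) \<in> hom ?Q ?Q" if "a \<in> R" for a
    proof (rule homI)
      fix x y assume "x \<in> carrier ?Q" "y \<in> carrier ?Q"
      then have "x i \<in> carrier N" "y i \<in> carrier N" if "i < q" for i using that by auto
      then show "ract ?Q x a \<in> carrier ?Q"
        "ract ?Q (x \<otimes>\<^bsub>?Q\<^esub> y) a = ract ?Q x a \<otimes>\<^bsub>?Q\<^esub> ract ?Q y a"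
        using that by (auto simp: ract_mult intro!: restrict_ext)
    qed
  qed
  ultimately show ?thesis by (simp add: additive_bimod_def)
qed

text \<open>\<open>f i\<close> and \<open>g i\<close> are the coordinates of maps
  \<open>M -> N^q -> M\<close>. Since the additive group is written multiplicatively,
  \<open>finprod\<close> is the sum of the composites.\<close>

definition retract_of_multiple ::
    "'a set \<Rightarrow> 'a set \<Rightarrow> ('a, 'm) bimod \<Rightarrow> ('a, 'n) bimod \<Rightarrow> bool" where
  "retract_of_multiple L R M N \<longleftrightarrow> (\<exists>q\<ge>1. \<exists>f g.
     (\<forall>i<q. f i \<in> bimod_hom L R M N \<and> g i \<in> bimod_hom L R N M) \<and>
     (\<forall>x\<in>carrier M. finprod M (\<lambda>i. g i (f i x)) {..<q::nat} = x))"

lemma finprod_hom: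
  assumes "comm_group M" "comm_group N" "h \<in> hom M N" "finite I" "f \<in> I \<rightarrow> carrier M"
  shows "h (finprod M f I) = finprod N (\<lambda>i. h (f i)) I"
proof -
  interpret M: comm_group M by fact
  interpret N: comm_group N by fact
  interpret group_hom M N h by unfold_locales fact
  show ?thesis using assms(4,5)
  proof (induction I)
    case (insert i I)
    have "f \<in> I \<rightarrow> carrier M" "f i \<in> carrier M" "(\<lambda>i. h (f i)) \<in> I \<rightarrow> carrier N" "h (f i) \<in> carrier N"
      using insert(4) by (auto simp: Pi_iff)
    then show ?case using insert
      by (subst M.finprod_insert; simp)
  qed simp
qed

lemma divides_multiple_iff_retract:
  assumes M: "additive_bimod L R M" and N: "additive_bimod L R N"
  shows "divides_multiple L R M N \<longleftrightarrow> retract_of_multiple L R M N"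
proof
  interpret M: additive_bimod L R M by fact
  interpret N: additive_bimod L R N by fact
  {
    assume "divides_multiple L R M N"
    then obtain q S where q: "q \<ge> 1" and S: "direct_summand L R S (bimod_multiple q N)"
      "bimod_iso L R M (bimod_multiple q N\<lparr>carrier := S\<rparr>)"
      unfolding divides_multiple_def by blast
    let ?Q = "bimod_multiple q N"
    interpret Q: additive_bimod L R ?Q by (rule additive_bimod_multiple) fact
    from direct_summand_imp_retract[OF M Q.additive_bimod_axioms S]
    obtain f g where f: "f \<in> bimod_hom L R M ?Q" and g: "g \<in> bimod_hom L R ?Q M"
      and gf: "\<And>x. x \<in> carrier M \<Longrightarrow> g (f x) = x" by metis
    note fD = bimod_homD[OF f] and gD = bimod_homD[OF g]
    \<comment> \<open>The inclusion of the \<open>i\<close>-th coordinate. Decomposing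
      \<open>f x\<close> into its coordinates between \<open>f\<close> and \<open>g\<close> splits
      the identity \<open>g (f x) = x\<close> into \<open>q\<close> summands.\<close>
    define e where "e i y = (\<lambda>j\<in>{..<q}. if i = j then y else \<one>\<^bsub>N\<^esub>)" for i y
    have e: "e i \<in> bimod_hom L R N ?Q" for i
      by (rule bimod_homI) (auto simp: e_def intro!: restrict_ext)
    note eD = bimod_homD[OF e]
    have pr: "(\<lambda>x. x i) \<in> bimod_hom L R ?Q N" if "i < q" for i
      by (rule bimod_homI) (use that in auto)
    have sum_e: "finprod ?Q (\<lambda>i. e i (z i)) {..<q} = z" if z: "z \<in> carrier ?Q" for z
    proof (rule PiE_ext)
      have zc: "z i \<in> carrier N" if "i < q" for i using z that by auto
      have c: "(\<lambda>i. e i (z i)) \<in> {..<q} \<rightarrow> carrier ?Q"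
        using eD(1) zc by (auto simp del: bimod_multiple_simps)
      show "finprod ?Q (\<lambda>i. e i (z i)) {..<q} \<in> (\<Pi>\<^sub>E i\<in>{..<q}. carrier N)"
        using Q.finprod_closed[OF c] by simp
      show "z \<in> (\<Pi>\<^sub>E i\<in>{..<q}. carrier N)" using z by simp
      fix j assume j: "j \<in> {..<q}"
      have "finprod ?Q (\<lambda>i. e i (z i)) {..<q} j = finprod N (\<lambda>i. e i (z i) j) {..<q}"
        using pr[of j] j c by (intro finprod_hom[OF Q.comm_group_axioms N.comm_group_axioms, of "\<lambda>x. x j"])
          (auto simp: bimod_hom_def)
      also have "\<dots> = finprod N (\<lambda>i. if j = i then z i else \<one>\<^bsub>N\<^esub>) {..<q}"
        using j z by (intro N.finprod_cong') (auto simp: e_def PiE_iff)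
      also have "\<dots> = z j"
        using j z by (intro N.finprod_singleton) auto
      finally show "finprod ?Q (\<lambda>i. e i (z i)) {..<q} j = z j" .
    qed
    have "finprod M (\<lambda>i. g (e i (f x i))) {..<q} = x" if "x \<in> carrier M" for x
    proof -
      have fx: "f x \<in> carrier ?Q" using fD(1) that by blast
      then have fxc: "f x i \<in> carrier N" if "i < q" for i using that by auto
      have "finprod M (\<lambda>i. g (e i (f x i))) {..<q} = g (finprod ?Q (\<lambda>i. e i (f x i)) {..<q})"
        using g eD(1) fx by (intro finprod_hom[OF Q.comm_group_axioms M.comm_group_axioms, symmetric])
          (auto simp: bimod_hom_def fxc simp del: bimod_multiple_simps)+
      also have "\<dots> = x" using sum_e[OF fx] gf that by simp
      finally show ?thesis .
    qed
    moreover have "(\<lambda>x. f x i) \<in> bimod_hom L R M N" "(\<lambda>y. g (e i y)) \<in> bimod_hom L R N M" if "i < q" for i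
      using bimod_hom_comp[OF f pr[OF that]] bimod_hom_comp[OF e g] by auto
    ultimately show "retract_of_multiple L R M N"
      unfolding retract_of_multiple_def using q
      by (intro exI[of _ q] conjI exI[of _ "\<lambda>i x. f x i"] exI[of _ "\<lambda>i y. g (e i y)"]) auto
  next
    assume "retract_of_multiple L R M N"
    then obtain q f g where q: "q \<ge> 1"
      and fg: "\<And>i. i < q \<Longrightarrow> f i \<in> bimod_hom L R M N" "\<And>i. i < q \<Longrightarrow> g i \<in> bimod_hom L R N M"
      and id: "\<And>x. x \<in> carrier M \<Longrightarrow> finprod M (\<lambda>i. g i (f i x)) {..<q::nat} = x"
      unfolding retract_of_multiple_def by blast
    let ?Q = "bimod_multiple q N"
    interpret Q: additive_bimod L R ?Q by (rule additive_bimod_multiple) fact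
    note fD = bimod_homD[OF fg(1)] and gD = bimod_homD[OF fg(2)]
    \<comment> \<open>\<open>F\<close> collects the \<open>f i\<close> into one map to
      \<open>q\<close> copies of \<open>N\<close>, and \<open>K\<close> adds up the
      \<open>g i\<close>; the retract condition becomes \<open>K (F x) = x\<close>.\<close>
    define F where "F x = (\<lambda>i\<in>{..<q}. f i x)" for x
    define K where "K y = finprod M (\<lambda>i. g i (y i)) {..<q}" for y
    have F: "F \<in> bimod_hom L R M ?Q"
      by (rule bimod_homI) (auto simp: F_def fD intro!: restrict_ext)
    have yc: "y i \<in> carrier N" if "y \<in> carrier ?Q" "i < q" for y i
      using that by auto
    have gc: "(\<lambda>i. g i (y i)) \<in> {..<q} \<rightarrow> carrier M" if "y \<in> carrier ?Q" for y
      using that gD(1) by auto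
    have K: "K \<in> bimod_hom L R ?Q M"
    proof (rule bimod_homI)
      fix y assume y: "y \<in> carrier ?Q"
      show "K y \<in> carrier M" unfolding K_def by (rule M.finprod_closed[OF gc[OF y]])
      show "K (y \<otimes>\<^bsub>?Q\<^esub> y') = K y \<otimes>\<^bsub>M\<^esub> K y'" if y': "y' \<in> carrier ?Q" for y'
        unfolding K_def M.finprod_multf[OF gc[OF y] gc[OF y'], symmetric]
        by (rule M.finprod_cong') (use yc[OF y] yc[OF y'] gD in auto)
      show "K (lact ?Q a y) = lact M a (K y)" if a: "a \<in> L" for a
        unfolding K_def finprod_hom[OF M.comm_group_axioms M.comm_group_axioms M.lact_hom[OF a] finite_lessThan gc[OF y]]
        by (rule M.finprod_cong') (use yc[OF y] a gD in auto)
      show "K (ract ?Q y a) = ract M (K y) a" if a: "a \<in> R" for a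
        unfolding K_def finprod_hom[OF M.comm_group_axioms M.comm_group_axioms M.ract_hom[OF a] finite_lessThan gc[OF y]]
        by (rule M.finprod_cong') (use yc[OF y] a gD in auto)
    qed
    have "K (F x) = x" if "x \<in> carrier M" for x
    proof -
      have "K (F x) = finprod M (\<lambda>i. g i (f i x)) {..<q}"
        unfolding K_def F_def by (rule M.finprod_cong') (use that fD gD in auto)
      then show ?thesis using id that by simp
    qed
    then have "direct_summand L R (F ` carrier M) ?Q \<and> bimod_iso L R M (?Q\<lparr>carrier := F ` carrier M\<rparr>)"
      by (intro retract_imp_direct_summand[OF M Q.additive_bimod_axioms F K])
    then show "divides_multiple L R M N" unfolding divides_multiple_def using q by blast
  }
qed


section \<open>Cosets as a basis of the tensor powers\<close>


text \<open>
  The pair \<open>([x\<^sub>1 H, x\<^sub>1 x\<^sub>2 H, \<dots>], x\<^sub>1 \<cdots> x\<^sub>n)\<close>, with \<open>n - 1\<close> cosets, stands for the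
  class of the word \<open>[x\<^sub>1, \<dots>, x\<^sub>n]\<close> modulo moving elements of \<open>H\<close> across the tensor signs.
\<close>

definition lmul :: "('g, 'z) monoid_scheme \<Rightarrow> 'g \<Rightarrow> 'g set list \<times> 'g \<Rightarrow> 'g set list \<times> 'g" where
  "lmul G g x = (map (\<lambda>c. g <#\<^bsub>G\<^esub> c) (fst x), g \<otimes>\<^bsub>G\<^esub> snd x)"

definition rmul :: "('g, 'z) monoid_scheme \<Rightarrow> 'g set list \<times> 'g \<Rightarrow> 'g \<Rightarrow> 'g set list \<times> 'g" where
  "rmul G x g = (fst x, snd x \<otimes>\<^bsub>G\<^esub> g)"

text \<open>Prepending the letter \<open>g\<close> to a word: the first partial product now gives
  the coset of \<open>g\<close>, and all later partial products are multiplied by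
  \<open>g\<close>.\<close>

definition extend_point :: "('g, 'z) monoid_scheme \<Rightarrow> 'g set \<Rightarrow> 'g \<Rightarrow> 'g set list \<times> 'g \<Rightarrow> 'g set list \<times> 'g" where
  "extend_point G H g x = lmul G g (H # fst x, snd x)"

definition left_cosets :: "('g, 'z) monoid_scheme \<Rightarrow> 'g set \<Rightarrow> 'g set set" where
  "left_cosets G H = (\<lambda>g. g <#\<^bsub>G\<^esub> H) ` carrier G"

text \<open>For \<open>n = 0\<close> these are the basis elements of the regular bimodule \<open>k H\<close>.\<close>

definition points :: "('g, 'z) monoid_scheme \<Rightarrow> 'g set \<Rightarrow> nat \<Rightarrow> ('g set list \<times> 'g) set" where
  "points G H n = {cs. set cs \<subseteq> left_cosets G H \<and> length cs = n - 1} \<times> (if n = 0 then H else carrier G)"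

fun point_of :: "('g, 'z) monoid_scheme \<Rightarrow> 'g set \<Rightarrow> 'g list \<Rightarrow> 'g set list \<times> 'g" where
  "point_of G H [] = undefined"
| "point_of G H [x] = ([], x)"
| "point_of G H (x # y # xs) = extend_point G H x (point_of G H (y # xs))"

text \<open>A linear map written as a bilinear one with a one-point second argument, so that the
  lemmas on \<open>bilinear_ext\<close> apply to it.\<close>

definition to_points :: "('g \<Rightarrow>\<^sub>0 'k::field) \<Rightarrow> ('g set list \<times> 'g \<Rightarrow>\<^sub>0 'k)" where
  "to_points a = bilinear_ext (\<lambda>x _. ([], x)) a (monom () 1)"

text \<open>The multilinear extension of \<open>point_of\<close> to words in \<open>k G\<close>. The
  value at the empty word is a filler.\<close>

fun expand_word :: "('g, 'z) monoid_scheme \<Rightarrow> 'g set \<Rightarrow> ('g \<Rightarrow>\<^sub>0 'k::field) list \<Rightarrow> ('g set list \<times> 'g \<Rightarrow>\<^sub>0 'k)" where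
  "expand_word G H [] = 0"
| "expand_word G H [a] = to_points a"
| "expand_word G H (a # b # w) = bilinear_ext (extend_point G H) a (expand_word G H (b # w))"

definition perm_bimod :: "('g \<Rightarrow> 'x \<Rightarrow> 'x) \<Rightarrow> ('x \<Rightarrow> 'g \<Rightarrow> 'x) \<Rightarrow> 'x set \<Rightarrow> ('g \<Rightarrow>\<^sub>0 'k::field, 'x \<Rightarrow>\<^sub>0 'k) bimod" where
  "perm_bimod l r X = \<lparr>carrier = {v. supp v \<subseteq> X}, monoid.mult = (+), one = 0, lact = bilinear_ext l, ract = bilinear_ext r\<rparr>"

lemma perm_bimod_simps [simp]:
  "v \<in> carrier (perm_bimod l r X) \<longleftrightarrow> supp v \<subseteq> X"
  "v \<otimes>\<^bsub>perm_bimod l r X\<^esub> w = v + w"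
  "\<one>\<^bsub>perm_bimod l r X\<^esub> = 0"
  "lact (perm_bimod l r X) = bilinear_ext l"
  "ract (perm_bimod l r X) = bilinear_ext r"
  by (simp_all add: perm_bimod_def)

lemma supp_add_subset: "supp v \<subseteq> X \<Longrightarrow> supp w \<subseteq> X \<Longrightarrow> supp (v + w) \<subseteq> X"
  using Poly_Mapping.keys_add[of v w] by blast

lemma additive_perm_bimod:
  assumes "\<And>a g x. a \<in> L \<Longrightarrow> g \<in> supp a \<Longrightarrow> x \<in> X \<Longrightarrow> l g x \<in> X"
    and "\<And>a g x. a \<in> R \<Longrightarrow> g \<in> supp a \<Longrightarrow> x \<in> X \<Longrightarrow> r x g \<in> X"
  shows "additive_bimod L R (perm_bimod l r X :: ('g \<Rightarrow>\<^sub>0 'k::field, 'x \<Rightarrow>\<^sub>0 'k) bimod)"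
proof -
  let ?M = "perm_bimod l r X :: ('g \<Rightarrow>\<^sub>0 'k, 'x \<Rightarrow>\<^sub>0 'k) bimod"
  have "comm_group ?M"
  proof (rule comm_groupI)
    fix v assume "v \<in> carrier ?M"
    then show "\<exists>w\<in>carrier ?M. w \<otimes>\<^bsub>?M\<^esub> v = \<one>\<^bsub>?M\<^esub>"
      by (intro bexI[of _ "- v"]) (auto simp: in_keys_iff)
  qed (auto simp: supp_add_subset add_ac)
  moreover have "additive_bimod_axioms L R ?M"
  proof
    show "lact ?M a \<in> hom ?M ?M" if "a \<in> L" for a
    proof (rule homI)
      fix v assume "v \<in> carrier ?M"
      then have "supp (bilinear_ext l a v) \<subseteq> X" using assms(1)[OF that] by (intro supp_bilinear_ext) auto
      then show "lact ?M a v \<in> carrier ?M" by simp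
    qed (simp add: bilinear_ext_add_right)
    show "(\<lambda>v. ract ?M v a) \<in> hom ?M ?M" if "a \<in> R" for a
    proof (rule homI)
      fix v assume "v \<in> carrier ?M"
      then have "supp (bilinear_ext r v a) \<subseteq> X" using assms(2)[OF that] by (intro supp_bilinear_ext) auto
      then show "ract ?M v a \<in> carrier ?M" by simp
    qed (simp add: bilinear_ext_add_left)
  qed
  ultimately show ?thesis by (simp add: additive_bimod_def)
qed

section \<open>Points, their two actions, and the words that represent them\<close>

locale finite_pair = group G for G :: "('g, 'z) monoid_scheme" (structure) +
  fixes H :: "'g set"
  assumes sub: "subgroup H G" and fin: "finite (carrier G)"
begin

sublocale H: subgroup H G by (rule sub)

lemma H_sub [simp]: "h \<in> H \<Longrightarrow> h \<in> carrier G" by (rule H.mem_carrier)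

lemma coset_closed: "c \<in> left_cosets G H \<Longrightarrow> g \<in> carrier G \<Longrightarrow> g <# c \<in> left_cosets G H"
  using H.subset by (auto simp: left_cosets_def lcos_m_assoc)

lemma coset_sub: "c \<in> left_cosets G H \<Longrightarrow> c \<subseteq> carrier G"
  using l_coset_subset_G[OF H.subset] by (auto simp: left_cosets_def)

lemma H_coset: "H \<in> left_cosets G H"
  using lcos_mult_one[OF H.subset] by (force simp: left_cosets_def)

lemma lmul_points: "x \<in> points G H n \<Longrightarrow> g \<in> carrier G \<Longrightarrow> n > 0 \<or> g \<in> H \<Longrightarrow> lmul G g x \<in> points G H n"
  by (auto simp: points_def lmul_def coset_closed subset_iff split: if_splits)

lemma rmul_points: "x \<in> points G H n \<Longrightarrow> g \<in> carrier G \<Longrightarrow> n > 0 \<or> g \<in> H \<Longrightarrow> rmul G x g \<in> points G H n"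
  by (auto simp: points_def rmul_def split: if_splits)

lemma points_carrier: "x \<in> points G H n \<Longrightarrow> snd x \<in> carrier G \<and> set (fst x) \<subseteq> left_cosets G H"
  by (auto simp: points_def split: if_splits)

lemma extend_points: "x \<in> points G H n \<Longrightarrow> n > 0 \<Longrightarrow> g \<in> carrier G \<Longrightarrow> extend_point G H g x \<in> points G H (Suc n)"
  unfolding extend_point_def by (rule lmul_points) (auto simp: points_def H_coset)

lemma lmul_lmul: "x \<in> points G H n \<Longrightarrow> g \<in> carrier G \<Longrightarrow> h \<in> carrier G \<Longrightarrow>
    lmul G g (lmul G h x) = lmul G (g \<otimes> h) x"
  using points_carrier[of x n] coset_sub
  by (auto simp: lmul_def m_assoc lcos_m_assoc dest!: subsetD)

lemma lmul_one: "x \<in> points G H n \<Longrightarrow> lmul G \<one> x = x"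
  using points_carrier[of x n]
  by (auto simp: lmul_def prod_eq_iff intro!: map_idI lcos_mult_one coset_sub)

lemma rmul_rmul: "x \<in> points G H n \<Longrightarrow> g \<in> carrier G \<Longrightarrow> h \<in> carrier G \<Longrightarrow>
    rmul G (rmul G x g) h = rmul G x (g \<otimes> h)"
  using points_carrier[of x n] by (auto simp: rmul_def m_assoc)

lemma rmul_one: "x \<in> points G H n \<Longrightarrow> rmul G x \<one> = x"
  using points_carrier[of x n] by (auto simp: rmul_def)

text \<open>The balancing relation on points: \<open>h <# H = H\<close>, so the new coset is the
  same for \<open>g\<close> and \<open>g \<otimes> h\<close>, and \<open>h\<close> may cross the
  tensor sign.\<close>

lemma extend_lmul:
  assumes x: "x \<in> points G H n" and g: "g \<in> carrier G" and h: "h \<in> H"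
  shows "extend_point G H g (lmul G h x) = extend_point G H (g \<otimes> h) x"
proof -
  have "h <# H = H" using h by (simp add: coset_join3 sub)
  then have "g <# H = (g \<otimes> h) <# H"
    using g h lcos_m_assoc[OF H.subset, of g h] by simp
  then show ?thesis
    using lmul_lmul[OF x g H_sub[OF h]] by (simp add: extend_point_def lmul_def)
qed

lemma lmul_extend: "x \<in> points G H n \<Longrightarrow> n > 0 \<Longrightarrow> g \<in> carrier G \<Longrightarrow> h \<in> carrier G \<Longrightarrow>
    lmul G g (extend_point G H h x) = extend_point G H (g \<otimes> h) x"
  unfolding extend_point_def
  by (rule lmul_lmul[of _ "Suc n"]) (auto simp: points_def H_coset)

lemma rmul_extend: "x \<in> points G H n \<Longrightarrow> n > 0 \<Longrightarrow> g \<in> carrier G \<Longrightarrow> h \<in> carrier G \<Longrightarrow>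
    rmul G (extend_point G H g x) h = extend_point G H g (rmul G x h)"
  using points_carrier[of x n]
  by (auto simp: extend_point_def lmul_def rmul_def m_assoc)

lemma finite_points: "finite (points G H n)"
proof -
  have "finite {cs. set cs \<subseteq> left_cosets G H \<and> length cs = n - 1}"
    by (intro finite_lists_length_eq) (simp add: left_cosets_def fin)
  moreover have "finite H" using fin H.subset finite_subset by blast
  ultimately show ?thesis by (simp add: points_def fin)
qed

lemma point_of_Cons: "xs \<noteq> [] \<Longrightarrow> point_of G H (x # xs) = extend_point G H x (point_of G H xs)"
  by (cases xs) auto

lemma point_of_closed: "set xs \<subseteq> carrier G \<Longrightarrow> xs \<noteq> [] \<Longrightarrow> point_of G H xs \<in> points G H (length xs)"
proof (induction xs)
  case (Cons x xs)
  then show ?case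
    by (cases "xs = []") (auto simp: points_def[of _ _ "Suc 0"] point_of_Cons extend_points)
qed simp

lemma point_of_mult_hd:
  assumes "set (x # xs) \<subseteq> carrier G" "g \<in> carrier G"
  shows "point_of G H ((g \<otimes> x) # xs) = lmul G g (point_of G H (x # xs))"
proof (cases "xs = []")
  case True
  then show ?thesis by (simp add: lmul_def)
next
  case False
  then show ?thesis
    using assms lmul_extend[OF point_of_closed[of xs], of g x] by (simp add: point_of_Cons)
qed

text \<open>A representative \<open>g\<close> of the first coset becomes the first letter;
  translating the remaining data by \<open>inv g\<close> gives the point that the rest of the word
  has to represent.\<close>

lemma point_of_surj: "x \<in> points G H n \<Longrightarrow> n > 0 \<Longrightarrow>
    \<exists>xs. set xs \<subseteq> carrier G \<and> length xs = n \<and> point_of G H xs = x"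
proof (induction n arbitrary: x)
  case (Suc n)
  show ?case
  proof (cases "n = 0")
    case True
    then show ?thesis using Suc.prems by (intro exI[of _ "[snd x]"]) (auto simp: points_def)
  next
    case False
    obtain c cs y where x: "x = (c # cs, y)" and c: "c \<in> left_cosets G H" "set cs \<subseteq> left_cosets G H"
      "length cs = n - 1" "y \<in> carrier G"
      using Suc.prems False by (cases x; cases "fst x") (auto simp: points_def)
    obtain g where g: "g \<in> carrier G" "c = g <# H" using c by (auto simp: left_cosets_def)
    have p: "(cs, y) \<in> points G H n" using c False by (auto simp: points_def)
    then have p': "lmul G (inv g) (cs, y) \<in> points G H n"
      using g False by (intro lmul_points) auto
    then obtain xs where xs: "set xs \<subseteq> carrier G" "length xs = n" "point_of G H xs = lmul G (inv g) (cs, y)"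
      using Suc.IH False by blast
    have "extend_point G H g (lmul G (inv g) (cs, y)) = ((g <# H) # fst (lmul G g (lmul G (inv g) (cs, y))), snd (lmul G g (lmul G (inv g) (cs, y))))"
      by (simp add: extend_point_def lmul_def)
    also have "\<dots> = x"
      using lmul_lmul[OF p, of g "inv g"] lmul_one[OF p] g x by simp
    finally have "point_of G H (g # xs) = x"
      using xs False by (subst point_of_Cons) auto
    then show ?thesis using g xs by (intro exI[of _ "g # xs"]) auto
  qed
qed simp

section \<open>Expansion of words over \<open>k G\<close> into combinations of points\<close>

lemma group_algebra_simps [simp]:
  "a \<in> carrier (group_algebra G) \<longleftrightarrow> supp a \<subseteq> carrier G"
  "a \<otimes>\<^bsub>group_algebra G\<^esub> b = bilinear_ext (\<otimes>) a b"
  "a \<oplus>\<^bsub>group_algebra G\<^esub> b = a + b"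
  "\<zero>\<^bsub>group_algebra G\<^esub> = 0"
  by (simp_all add: group_algebra_def bilinear_ext_def)

lemma supp_bilinear_ext_mult: "supp a \<subseteq> carrier G \<Longrightarrow> supp b \<subseteq> carrier G \<Longrightarrow> supp (bilinear_ext (\<otimes>) a b) \<subseteq> carrier G"
  by (rule supp_bilinear_ext) auto

lemma expand_word_Cons: "w \<noteq> [] \<Longrightarrow> expand_word G H (a # w) = bilinear_ext (extend_point G H) a (expand_word G H w)"
  by (cases w) auto

lemma to_points_monom [simp]: "to_points (monom x c) = monom ([], x) c"
  by (simp add: to_points_def)

lemma to_points_add: "to_points (a + b) = to_points a + to_points b"
  by (simp add: to_points_def bilinear_ext_add_left)

lemma supp_to_points: "supp a \<subseteq> S \<Longrightarrow> supp (to_points a) \<subseteq> {[]} \<times> S"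
  unfolding to_points_def by (rule supp_bilinear_ext) auto

lemma supp_expand_word:
  "(\<And>a. a \<in> set w \<Longrightarrow> supp a \<subseteq> carrier G) \<Longrightarrow> w \<noteq> [] \<Longrightarrow> supp (expand_word G H w) \<subseteq> points G H (length w)"
proof (induction w)
  case (Cons a w)
  show ?case
  proof (cases "w = []")
    case True
    then show ?thesis using supp_to_points[of a "carrier G"] Cons.prems by (auto simp: points_def)
  next
    case False
    have IH: "supp (expand_word G H w) \<subseteq> points G H (length w)"
      using Cons False by simp
    have "supp (bilinear_ext (extend_point G H) a (expand_word G H w)) \<subseteq> points G H (Suc (length w))"
    proof (rule supp_bilinear_ext)
      fix x y assume "x \<in> supp a" "y \<in> supp (expand_word G H w)"
      then show "extend_point G H x y \<in> points G H (Suc (length w))"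
        using Cons.prems IH False by (intro extend_points) auto
    qed
    then show ?thesis using False by (simp add: expand_word_Cons)
  qed
qed simp

lemma expand_word_add:
  "expand_word G H (xs @ [x + y] @ ys) = expand_word G H (xs @ [x] @ ys) + expand_word G H (xs @ [y] @ ys)"
proof (induction xs)
  case Nil
  then show ?case by (cases ys) (auto simp: to_points_add bilinear_ext_add_left)
next
  case (Cons a xs)
  then show ?case by (simp add: expand_word_Cons bilinear_ext_add_right)
qed

lemma to_points_mult:
  assumes "supp a \<subseteq> carrier G" "supp b \<subseteq> carrier G"
  shows "to_points (bilinear_ext (\<otimes>) a b) = bilinear_ext (lmul G) a (to_points b)"
    and "to_points (bilinear_ext (\<otimes>) a b) = bilinear_ext (rmul G) (to_points a) b"
proof -
  have "to_points (bilinear_ext (\<otimes>) a b) = bilinear_ext (\<lambda>x _. ([], x)) (bilinear_ext (\<otimes>) a b) (monom () 1)"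
    by (simp add: to_points_def)
  also have "\<dots> = bilinear_ext (lmul G) a (bilinear_ext (\<lambda>x _. ([], x)) b (monom () 1))"
    using assms by (intro bilinear_ext_assoc[symmetric, of _ _ UNIV]) (auto simp: lmul_def)
  finally show "to_points (bilinear_ext (\<otimes>) a b) = bilinear_ext (lmul G) a (to_points b)"
    by (simp add: to_points_def)
  show "to_points (bilinear_ext (\<otimes>) a b) = bilinear_ext (rmul G) (to_points a) b"
    using assms(1)
  proof (induction rule: poly_mapping_supp_induct)
    case (monom x c)
    show ?case using assms(2)
      by (induction rule: poly_mapping_supp_induct)
        (auto simp: to_points_add bilinear_ext_add_right rmul_def, simp add: to_points_def)
  qed (auto simp: to_points_add bilinear_ext_add_left, simp add: to_points_def)
qed

lemma expand_word_mult_hd: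
  assumes "supp a \<subseteq> carrier G" "\<And>c. c \<in> set (b # w) \<Longrightarrow> supp c \<subseteq> carrier G"
  shows "expand_word G H (bilinear_ext (\<otimes>) a b # w) = bilinear_ext (lmul G) a (expand_word G H (b # w))"
proof (cases "w = []")
  case True
  then show ?thesis using assms by (simp add: to_points_mult(1))
next
  case False
  have "supp (expand_word G H w) \<subseteq> points G H (length w)"
    using assms(2) False by (intro supp_expand_word) auto
  then show ?thesis
    using False assms lmul_extend[of _ "length w"]
    by (auto simp: expand_word_Cons intro!: bilinear_ext_assoc[symmetric, of "carrier G" "carrier G" "points G H (length w)"])
qed

lemma expand_word_mult_last:
  assumes "supp a \<subseteq> carrier G" "\<And>b. b \<in> set w \<Longrightarrow> supp b \<subseteq> carrier G" "w \<noteq> []"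
  shows "expand_word G H (butlast w @ [bilinear_ext (\<otimes>) (last w) a]) = bilinear_ext (rmul G) (expand_word G H w) a"
  using assms(2,3)
proof (induction w)
  case (Cons b w)
  show ?case
  proof (cases "w = []")
    case True
    then show ?thesis using Cons.prems assms(1) by (simp add: to_points_mult(2))
  next
    case False
    have s: "supp (expand_word G H w) \<subseteq> points G H (length w)"
      using Cons.prems False by (intro supp_expand_word) auto
    have "bilinear_ext (extend_point G H) b (bilinear_ext (rmul G) (expand_word G H w) a)
        = bilinear_ext (rmul G) (bilinear_ext (extend_point G H) b (expand_word G H w)) a"
      by (rule bilinear_ext_assoc[of "carrier G" "points G H (length w)" "carrier G"])
        (use False s assms(1) Cons.prems rmul_extend in auto)
    then show ?thesis using False Cons by (simp add: expand_word_Cons)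
  qed
qed simp

text \<open>At the tensor sign itself this is the bilinear extension of \<open>extend_lmul\<close>;
  the letters in front of it are added by the induction.\<close>

lemma expand_word_balanced:
  assumes "supp b \<subseteq> H" "\<And>c. c \<in> set (xs @ [x, y] @ ys) \<Longrightarrow> supp c \<subseteq> carrier G"
  shows "expand_word G H (xs @ [bilinear_ext (\<otimes>) x b, y] @ ys) = expand_word G H (xs @ [x, bilinear_ext (\<otimes>) b y] @ ys)"
  using assms(2)
proof (induction xs)
  case Nil
  let ?v = "expand_word G H (y # ys)"
  have s: "supp ?v \<subseteq> points G H (length (y # ys))"
    using Nil by (intro supp_expand_word) auto
  have "supp b \<subseteq> carrier G" using assms(1) H.subset by blast
  then have "expand_word G H (bilinear_ext (\<otimes>) b y # ys) = bilinear_ext (lmul G) b ?v"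
    using Nil by (intro expand_word_mult_hd) auto
  moreover have "bilinear_ext (extend_point G H) x (bilinear_ext (lmul G) b ?v) = bilinear_ext (extend_point G H) (bilinear_ext (\<otimes>) x b) ?v"
    by (rule bilinear_ext_assoc[of "carrier G" H "points G H (length (y # ys))"])
      (use s assms(1) Nil extend_lmul in auto)
  ultimately show ?case by simp
next
  case (Cons a xs)
  then show ?case by (simp add: expand_word_Cons)
qed

end


section \<open>Words modulo the tensor relators\<close>

abbreviation supported :: "'g set \<Rightarrow> ('g \<Rightarrow>\<^sub>0 'k::field) set" where
  "supported S \<equiv> {a. supp a \<subseteq> S}"

text \<open>A basis word with its scalar collected in the first letter. The position is a
  convention, as scalars move across tensor signs modulo the relators.\<close>

fun pure_word :: "'k::field \<Rightarrow> 'g list \<Rightarrow> ('g \<Rightarrow>\<^sub>0 'k) list" where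
  "pure_word c [] = []"
| "pure_word c (x # xs) = monom x c # map (\<lambda>y. monom y 1) xs"

context finite_pair
begin

definition words :: "nat \<Rightarrow> ('g \<Rightarrow>\<^sub>0 'k::field) list set" where
  "words n = tensor_words (group_algebra G) n"

definition relators :: "nat \<Rightarrow> (('g \<Rightarrow>\<^sub>0 'k::field) list \<Rightarrow>\<^sub>0 int) set" where
  "relators n = tensor_relators (group_algebra G) (supported H) n"

definition word_ker :: "nat \<Rightarrow> (('g \<Rightarrow>\<^sub>0 'k::field) list \<Rightarrow>\<^sub>0 int) set" where
  "word_ker n = tensor_kernel (group_algebra G) (supported H) n"

lemma word_ker_generate: "word_ker n = generate (free_Abelian_group (words n)) (relators n)"
  by (simp add: word_ker_def tensor_kernel_def words_def relators_def)

lemma set_sub_group_algebra: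
  "set xs \<subseteq> carrier (group_algebra G) \<longleftrightarrow> (\<forall>a\<in>set xs. supp a \<subseteq> carrier G)"
  using group_algebra_simps(1) by blast

lemma words_iff: "w \<in> words n \<longleftrightarrow> (\<forall>a\<in>set w. supp a \<subseteq> carrier G) \<and> length w = n"
  by (auto simp: words_def tensor_words_def subset_iff)

lemma pure_word_words: "set xs \<subseteq> carrier G \<Longrightarrow> pure_word c xs \<in> words (length xs)"
  by (cases xs) (auto simp: words_iff)

lemma relators_cases:
  fixes r :: "('g \<Rightarrow>\<^sub>0 'k::field) list \<Rightarrow>\<^sub>0 int"
  assumes "r \<in> relators n"
  obtains (add) xs ys x y where "r = frag_of (xs @ [x + y] @ ys) - frag_of (xs @ [x] @ ys) - frag_of (xs @ [y] @ ys)"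
      "xs @ [x] @ ys \<in> words n" "xs @ [y] @ ys \<in> words n"
  | (bal) xs ys x y b where "r = frag_of (xs @ [bilinear_ext (\<otimes>) x b, y] @ ys) - frag_of (xs @ [x, bilinear_ext (\<otimes>) b y] @ ys)"
      "xs @ [x, y] @ ys \<in> words n" "supp b \<subseteq> H"
  using assms[unfolded relators_def tensor_relators_def]
proof (elim UnE CollectE exE conjE)
  fix xs ys :: "('g \<Rightarrow>\<^sub>0 'k) list" and x y
  assume "r = frag_of (xs @ [x \<oplus>\<^bsub>group_algebra G\<^esub> y] @ ys) - frag_of (xs @ [x] @ ys) - frag_of (xs @ [y] @ ys)"
    "x \<in> carrier (group_algebra G)" "y \<in> carrier (group_algebra G)"
    "set xs \<subseteq> carrier (group_algebra G)" "set ys \<subseteq> carrier (group_algebra G)" "length xs + 1 + length ys = n"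
  then show thesis by (intro add[of xs x y ys]) (simp_all add: words_iff set_sub_group_algebra ball_Un)
next
  fix xs ys :: "('g \<Rightarrow>\<^sub>0 'k) list" and x y b
  assume "r = frag_of (xs @ [x \<otimes>\<^bsub>group_algebra G\<^esub> b, y] @ ys) - frag_of (xs @ [x, b \<otimes>\<^bsub>group_algebra G\<^esub> y] @ ys)"
    "x \<in> carrier (group_algebra G)" "y \<in> carrier (group_algebra G)" "supp b \<subseteq> H"
    "set xs \<subseteq> carrier (group_algebra G)" "set ys \<subseteq> carrier (group_algebra G)" "length xs + 2 + length ys = n"
  then show thesis by (intro bal[of xs x b y ys]) (simp_all add: words_iff set_sub_group_algebra ball_Un)
qed

lemma relator_addI:
  assumes "xs @ [x] @ ys \<in> words n" "xs @ [y] @ ys \<in> words n"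
  shows "frag_of (xs @ [x + y] @ ys) - frag_of (xs @ [x] @ ys) - frag_of (xs @ [y] @ ys) \<in> relators n"
proof -
  have "x \<in> carrier (group_algebra G) \<and> y \<in> carrier (group_algebra G) \<and> set xs \<subseteq> carrier (group_algebra G)
      \<and> set ys \<subseteq> carrier (group_algebra G) \<and> length xs + 1 + length ys = n"
    using assms by (auto simp: words_iff)
  moreover have "x + y = x \<oplus>\<^bsub>group_algebra G\<^esub> y" by simp
  ultimately show ?thesis
    unfolding relators_def tensor_relators_def
    by (intro UnI1 CollectI exI[of _ xs] exI[of _ ys] exI[of _ x] exI[of _ y]) simp
qed

lemma relator_balI:
  assumes "xs @ [x, y] @ ys \<in> words n" "supp b \<subseteq> H"
  shows "frag_of (xs @ [bilinear_ext (\<otimes>) x b, y] @ ys) - frag_of (xs @ [x, bilinear_ext (\<otimes>) b y] @ ys) \<in> relators n"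
proof -
  have "x \<in> carrier (group_algebra G) \<and> y \<in> carrier (group_algebra G) \<and> b \<in> supported H
      \<and> set xs \<subseteq> carrier (group_algebra G)
      \<and> set ys \<subseteq> carrier (group_algebra G) \<and> length xs + 2 + length ys = n"
    using assms by (auto simp: words_iff)
  moreover have "bilinear_ext (\<otimes>) x b = x \<otimes>\<^bsub>group_algebra G\<^esub> b" "bilinear_ext (\<otimes>) b y = b \<otimes>\<^bsub>group_algebra G\<^esub> y" by simp_all
  ultimately show ?thesis
    unfolding relators_def tensor_relators_def
    by (intro UnI2 CollectI exI[of _ xs] exI[of _ ys] exI[of _ x] exI[of _ y] exI[of _ b]) simp
qed

lemma supp_frag_diff: "supp c \<subseteq> W \<Longrightarrow> supp d \<subseteq> W \<Longrightarrow> supp (c - d) \<subseteq> W"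
  for c d :: "'w \<Rightarrow>\<^sub>0 int"
  using keys_diff[of c d] by blast

lemma relators_carrier: "relators n \<subseteq> carrier (free_Abelian_group (words n))"
proof
  fix r assume "r \<in> relators n"
  then show "r \<in> carrier (free_Abelian_group (words n))"
  proof (cases rule: relators_cases)
    case (add xs ys x y)
    then have "xs @ [x + y] @ ys \<in> words n"
      using supp_add_subset[of x "carrier G" y] by (auto simp: words_iff)
    then show ?thesis using add by (simp add: supp_frag_diff keys_frag_of)
  next
    case (bal xs ys x y b)
    have "supp b \<subseteq> carrier G" using bal H.subset by blast
    then have "xs @ [bilinear_ext (\<otimes>) x b, y] @ ys \<in> words n" "xs @ [x, bilinear_ext (\<otimes>) b y] @ ys \<in> words n"
      using bal(2) supp_bilinear_ext_mult[of x b] supp_bilinear_ext_mult[of b y] by (auto simp: words_iff)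
    then show ?thesis using bal by (simp add: supp_frag_diff keys_frag_of)
  qed
qed

lemma word_ker_subgroup: "subgroup (word_ker n) (free_Abelian_group (words n))"
  unfolding word_ker_generate
  by (rule group.generate_is_subgroup[OF group_free_Abelian_group relators_carrier])

lemma word_ker_supp: "c \<in> word_ker n \<Longrightarrow> supp c \<subseteq> words n"
  using subsetD[OF subgroup.subset[OF word_ker_subgroup], of c n] by simp

lemma word_ker_zero [simp]: "0 \<in> word_ker n"
  using subgroup.one_closed[OF word_ker_subgroup] by simp

lemma word_ker_add: "c \<in> word_ker n \<Longrightarrow> d \<in> word_ker n \<Longrightarrow> c + d \<in> word_ker n"
  using subgroup.m_closed[OF word_ker_subgroup] by simp

lemma word_ker_uminus: "c \<in> word_ker n \<Longrightarrow> - c \<in> word_ker n"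
  using subgroup.m_inv_closed[OF word_ker_subgroup, of c n] word_ker_supp[of c n] by simp

lemma word_ker_diff: "c \<in> word_ker n \<Longrightarrow> d \<in> word_ker n \<Longrightarrow> c - d \<in> word_ker n"
  using word_ker_add[OF _ word_ker_uminus] by fastforce

lemma word_ker_sym: "c - d \<in> word_ker n \<Longrightarrow> d - c \<in> word_ker n"
  using word_ker_uminus by fastforce

lemma word_ker_trans: "c - d \<in> word_ker n \<Longrightarrow> d - e \<in> word_ker n \<Longrightarrow> c - e \<in> word_ker n"
  using word_ker_add by fastforce

lemma word_ker_sum: "(\<And>i. i \<in> I \<Longrightarrow> c i \<in> word_ker n) \<Longrightarrow> (\<Sum>i\<in>I. c i) \<in> word_ker n"
  by (induction I rule: infinite_finite_induct) (auto intro: word_ker_add)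

lemma relators_word_ker: "r \<in> relators n \<Longrightarrow> r \<in> word_ker n"
  unfolding word_ker_generate by (rule generate.incl)

text \<open>Prepending a letter turns relators into relators of the same kind, hence respects the
  subgroup they generate. This is what allows induction on the length of words.\<close>

lemma prefix_word_ker:
  assumes a: "supp a \<subseteq> carrier G" and c: "c \<in> word_ker n"
  shows "frag_extend (\<lambda>w. frag_of (a # w)) c \<in> word_ker (Suc n)"
proof -
  have rel: "frag_extend (\<lambda>w. frag_of (a # w)) r \<in> word_ker (Suc n)" if "r \<in> relators n" for r
    using that
  proof (cases rule: relators_cases)
    case (add xs ys x y)
    then show ?thesis
      using a relator_addI[of "a # xs" x ys "Suc n" y, THEN relators_word_ker]
      by (simp add: frag_extend_diff words_iff)
  next
    case (bal xs ys x y b)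
    then show ?thesis
      using a relator_balI[of "a # xs" x y ys "Suc n" b, THEN relators_word_ker]
      by (simp add: frag_extend_diff words_iff)
  qed
  show ?thesis
    using c unfolding word_ker_generate[of n]
  proof (induction rule: generate.induct)
    case (inv r)
    then have "inv\<^bsub>free_Abelian_group (words n)\<^esub> r = - r"
      using subsetD[OF relators_carrier inv] by (intro inv_free_Abelian_group) simp
    then show ?case using rel[OF inv] by (simp add: frag_extend_minus word_ker_uminus)
  qed (auto simp: rel frag_extend_add word_ker_add)
qed

text \<open>The maps to be compared send vectors to formal combinations of words and are additive
  only up to relators, so agreement on monomials spreads to sums only modulo
  \<open>word_ker n\<close>.\<close>

lemma additive_cong:
  fixes a :: "'x \<Rightarrow>\<^sub>0 'l::comm_monoid_add"
  assumes f: "\<And>u v. supp u \<subseteq> S \<Longrightarrow> supp v \<subseteq> S \<Longrightarrow> f (u + v) - f u - f v \<in> word_ker n"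
    and g: "\<And>u v. supp u \<subseteq> S \<Longrightarrow> supp v \<subseteq> S \<Longrightarrow> g (u + v) - g u - g v \<in> word_ker n"
    and fg: "\<And>x c. x \<in> S \<Longrightarrow> f (monom x c) - g (monom x c) \<in> word_ker n"
    and "supp a \<subseteq> S"
  shows "f a - g a \<in> word_ker n"
  using assms(4)
proof (induction rule: poly_mapping_supp_induct)
  case zero
  \<comment> \<open>The additivity defect at \<open>0 + 0\<close> is \<open>- f 0\<close>.\<close>
  have "f 0 \<in> word_ker n" "g 0 \<in> word_ker n"
    using word_ker_uminus[OF f[of 0 0]] word_ker_uminus[OF g[of 0 0]] by simp_all
  then show ?case by (rule word_ker_diff)
next
  case (add u v)
  have "(f (u + v) - f u - f v) - (g (u + v) - g u - g v) + (f u - g u) + (f v - g v) \<in> word_ker n"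
    by (rule word_ker_add[OF word_ker_add[OF word_ker_diff[OF f g]]]) (fact add)+
  then show ?case by (simp add: algebra_simps)
qed (rule fg)

lemma frag_pure_add:
  assumes "set xs \<subseteq> carrier G" "xs \<noteq> []"
  shows "frag_of (pure_word (c + d) xs) - frag_of (pure_word c xs) - frag_of (pure_word d xs) \<in> word_ker (length xs)"
proof -
  obtain x ys where xs: "xs = x # ys" using assms by (cases xs) auto
  show ?thesis
    using pure_word_words[OF assms(1), of c] pure_word_words[OF assms(1), of d]
      relator_addI[of "[]" "monom x c" "map (\<lambda>y. monom y 1) ys" "length xs" "monom x d", THEN relators_word_ker]
    by (simp add: xs single_add)
qed

lemma frag_pure_zero: "set xs \<subseteq> carrier G \<Longrightarrow> xs \<noteq> [] \<Longrightarrow> frag_of (pure_word 0 xs) \<in> word_ker (length xs)"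
  using word_ker_uminus[OF frag_pure_add[of xs 0 0]] by simp

text \<open>The scalar \<open>d\<close> crosses the tensor sign as \<open>monom \<one> d\<close>, a
  multiple of the unit and thus an element of \<open>k H\<close>.\<close>

lemma frag_pure_move:
  assumes "set (x # xs) \<subseteq> carrier G" "xs \<noteq> []"
  shows "frag_of (monom x c # pure_word d xs) - frag_of (pure_word (c * d) (x # xs)) \<in> word_ker (Suc (length xs))"
proof -
  obtain y ys where xs: "xs = y # ys" using assms by (cases xs) auto
  have "[] @ [monom x c, monom y 1] @ map (\<lambda>y. monom y 1) ys \<in> words (Suc (length xs))"
    using assms by (auto simp: words_iff xs)
  from relator_balI[OF this, of "monom \<one> d", THEN relators_word_ker]
  show ?thesis using assms by (simp add: xs word_ker_sym)
qed

text \<open>Equal points force equal first cosets, so the first letters satisfy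
  \<open>y = x \<otimes> h\<close> with \<open>h \<in> H\<close>. Balancing moves \<open>h\<close>
  from the first letter of \<open>ys\<close> to its second, and cancelling \<open>x\<close> shows
  that the two tails then have equal points. For words of one letter the point determines the
  letter.\<close>

lemma frag_pure_cong:
  fixes c :: "'k::field"
  assumes "set xs \<subseteq> carrier G" "set ys \<subseteq> carrier G" "length xs = n" "length ys = n" "n > 0"
    "point_of G H xs = point_of G H ys"
  shows "frag_of (pure_word c xs) - frag_of (pure_word c ys) \<in> word_ker n"
  using assms
proof (induction n arbitrary: xs ys c)
  case (Suc n)
  obtain x u where xs: "xs = x # u" using Suc.prems by (cases xs) auto
  obtain y v where ys: "ys = y # v" using Suc.prems by (cases ys) auto
  show ?case
  proof (cases "n = 0")
    case True
    then show ?thesis using Suc.prems xs ys by simp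
  next
    case False
    then have ne: "u \<noteq> []" "v \<noteq> []" using Suc.prems xs ys by auto
    obtain z v' where v: "v = z # v'" using ne by (cases v) auto
    have c: "x \<in> carrier G" "y \<in> carrier G" "set u \<subseteq> carrier G" "set v \<subseteq> carrier G" "z \<in> carrier G" "set v' \<subseteq> carrier G"
      using Suc.prems xs ys v by auto
    have len: "length u = n" "length v = n" using Suc.prems xs ys by auto
    have pu: "point_of G H u \<in> points G H n" and pv: "point_of G H v \<in> points G H n"
      using point_of_closed[of u] point_of_closed[of v] c ne len by auto
    define h where "h = inv x \<otimes> y"
    have eq: "extend_point G H x (point_of G H u) = extend_point G H y (point_of G H v)"
      using Suc.prems(6) ne by (simp add: xs ys point_of_Cons)
    have "x <# H = y <# H" using eq by (simp add: extend_point_def lmul_def)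
    then have "y \<in> x <# H" using c(2) sub H.one_closed by (force simp: l_coset_def)
    then obtain k where "k \<in> H" "y = x \<otimes> k" by (auto simp: l_coset_def)
    then have h: "h \<in> H" and y: "y = x \<otimes> h"
      using c by (simp_all add: h_def flip: m_assoc)
    have "lmul G x (point_of G H u) = lmul G y (point_of G H v)"
      using eq by (simp add: extend_point_def lmul_def)
    then have "lmul G (inv x) (lmul G x (point_of G H u)) = lmul G (inv x) (lmul G y (point_of G H v))"
      by simp
    then have "point_of G H u = lmul G h (point_of G H v)"
      using c by (simp add: lmul_lmul[OF pu] lmul_lmul[OF pv] lmul_one[OF pu] h_def)
    then have "point_of G H u = point_of G H ((h \<otimes> z) # v')"
      using c h by (simp add: v point_of_mult_hd)
    \<comment> \<open>The scalar \<open>c\<close> stays with the common first letter, so the tails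
      are compared with coefficient \<open>1\<close>.\<close>
    then have IH: "frag_of (pure_word (1 :: 'k) u) - frag_of (pure_word 1 ((h \<otimes> z) # v')) \<in> word_ker n"
      using c h len False v by (intro Suc.IH) auto
    have p1: "pure_word c (x # w) = monom x c # pure_word 1 w" for w
      by (cases w) auto
    have "supp (monom x c) \<subseteq> carrier G" using c by simp
    from prefix_word_ker[OF this IH] have 1: "frag_of (pure_word c xs) - frag_of (monom x c # pure_word 1 ((h \<otimes> z) # v')) \<in> word_ker (Suc n)"
      unfolding xs p1 by (simp add: frag_extend_diff)
    have "[] @ [monom x c, monom z 1] @ map (\<lambda>y. monom y 1) v' \<in> words (Suc n)"
      using c len v by (auto simp: words_iff)
    from relator_balI[OF this, of "monom h 1", THEN relators_word_ker]
    have "frag_of (pure_word c ys) - frag_of (monom x c # pure_word 1 ((h \<otimes> z) # v')) \<in> word_ker (Suc n)"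
      using h y by (simp add: ys v)
    then show ?thesis using word_ker_trans[OF 1 word_ker_sym] by blast
  qed
qed simp

definition rep :: "nat \<Rightarrow> 'g set list \<times> 'g \<Rightarrow> 'g list" where
  "rep n x = (SOME xs. set xs \<subseteq> carrier G \<and> length xs = n \<and> point_of G H xs = x)"

lemma rep:
  assumes "x \<in> points G H n" "n > 0"
  shows "set (rep n x) \<subseteq> carrier G" "length (rep n x) = n" "rep n x \<noteq> []" "point_of G H (rep n x) = x"
  using someI_ex[OF point_of_surj[OF assms]] assms(2) unfolding rep_def[symmetric] by auto

text \<open>Modulo the relators this is additive and inverse to \<^const>\<open>expand_word\<close>.\<close>

definition lift_points :: "nat \<Rightarrow> ('g set list \<times> 'g \<Rightarrow>\<^sub>0 'k::field) \<Rightarrow> (('g \<Rightarrow>\<^sub>0 'k) list \<Rightarrow>\<^sub>0 int)" where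
  "lift_points n v = (\<Sum>x\<in>points G H n. frag_of (pure_word (coeff v x) (rep n x)))"

lemma lift_points_add:
  assumes "n > 0"
  shows "lift_points n (u + v) - lift_points n u - lift_points n v \<in> word_ker n"
  unfolding lift_points_def sum_subtractf[symmetric]
proof (rule word_ker_sum)
  fix x assume "x \<in> points G H n"
  from rep[OF this assms] show "frag_of (pure_word (coeff (u + v) x) (rep n x)) - frag_of (pure_word (coeff u x) (rep n x))
      - frag_of (pure_word (coeff v x) (rep n x)) \<in> word_ker n"
    using frag_pure_add[of "rep n x" "coeff u x" "coeff v x"] by (simp add: lookup_add)
qed

text \<open>The representative chosen by \<open>rep\<close> may be exchanged for any word with the
  same point, by \<open>frag_pure_cong\<close>.\<close>

lemma lift_points_monom:
  assumes n: "n > 0" and x: "x \<in> points G H n" and xs: "set xs \<subseteq> carrier G" "length xs = n" "point_of G H xs = x"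
  shows "lift_points n (monom x c) - frag_of (pure_word c xs) \<in> word_ker n"
proof -
  have "lift_points n (monom x c) = frag_of (pure_word c (rep n x))
      + (\<Sum>y\<in>points G H n - {x}. frag_of (pure_word (coeff (monom x c) y) (rep n y)))"
    unfolding lift_points_def using x finite_points by (subst sum.remove[of _ x]) auto
  \<comment> \<open>The other summands have coefficient zero, but a word with first letter
    \<open>0\<close> is a generator of the free group and not itself zero; it lies in the kernel by
    additivity in that letter.\<close>
  moreover have "(\<Sum>y\<in>points G H n - {x}. frag_of (pure_word (coeff (monom x c) y) (rep n y))) \<in> word_ker n"
  proof (rule word_ker_sum)
    fix y assume "y \<in> points G H n - {x}"
    then show "frag_of (pure_word (coeff (monom x c) y) (rep n y)) \<in> word_ker n"
      using frag_pure_zero[of "rep n y"] rep[of y n] n by (auto simp: lookup_single when_def)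
  qed
  moreover have "frag_of (pure_word c (rep n x)) - frag_of (pure_word c xs) \<in> word_ker n"
    using rep[OF x n] xs n by (intro frag_pure_cong) auto
  ultimately show ?thesis using word_ker_add by (fastforce simp: algebra_simps)
qed

text \<open>Induction on the length: both sides are additive in the first letter modulo the
  relators, which reduces it to a monomial, and the tail may be replaced by the lift of its own
  expansion. This is where the relations are seen to be strong enough for the expansion to be
  injective on the tensor power.\<close>

lemma frag_expand_word:
  fixes w :: "('g \<Rightarrow>\<^sub>0 'k::field) list"
  shows "w \<in> words n \<Longrightarrow> n > 0 \<Longrightarrow> frag_of w - lift_points n (expand_word G H w) \<in> word_ker n"
proof (induction n arbitrary: w)
  case (Suc n)
  obtain a w' where w: "w = a # w'" using Suc.prems by (cases w) (auto simp: words_iff)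
  have a: "supp a \<subseteq> carrier G" and w': "w' \<in> words n" using Suc.prems by (auto simp: w words_iff)
  show ?case
  proof (cases "n = 0")
    case True
    then have [simp]: "w' = []" using w' by (simp add: words_iff)
    have "frag_of [a] - lift_points 1 (to_points a) \<in> word_ker 1" using a
    proof (rule additive_cong[rotated -1])
      show "frag_of [u + v] - frag_of [u] - frag_of [v] \<in> word_ker 1" if "supp u \<subseteq> carrier G" "supp v \<subseteq> carrier G" for u v
        using relator_addI[of "[]" u "[]" 1 v, THEN relators_word_ker] that by (simp add: words_iff)
      show "lift_points 1 (to_points (u + v)) - lift_points 1 (to_points u) - lift_points 1 (to_points v) \<in> word_ker 1" for u v
        by (simp add: to_points_add lift_points_add)
      show "frag_of [monom x c] - lift_points 1 (to_points (monom x c)) \<in> word_ker 1" if "x \<in> carrier G" for x c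
        using lift_points_monom[of 1 "([], x)" "[x]" c, THEN word_ker_sym] that
        by (simp add: points_def)
    qed
    then show ?thesis by (simp add: w True)
  next
    case False
    then have ne: "w' \<noteq> []" using w' by (auto simp: words_iff)
    let ?v = "expand_word G H w'"
    have v: "supp ?v \<subseteq> points G H n" using supp_expand_word[of w'] w' ne by (auto simp: words_iff)
    have IH: "frag_of w' - lift_points n ?v \<in> word_ker n" using Suc.IH w' False by simp
    have "frag_of (a # w') - lift_points (Suc n) (bilinear_ext (extend_point G H) a ?v) \<in> word_ker (Suc n)"
      using a
    proof (rule additive_cong[rotated -1])
      show "frag_of ((u + v) # w') - frag_of (u # w') - frag_of (v # w') \<in> word_ker (Suc n)"
        if "supp u \<subseteq> carrier G" "supp v \<subseteq> carrier G" for u v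
        using relator_addI[of "[]" u w' "Suc n" v, THEN relators_word_ker] that w' by (simp add: words_iff)
      show "lift_points (Suc n) (bilinear_ext (extend_point G H) (x + y) ?v) - lift_points (Suc n) (bilinear_ext (extend_point G H) x ?v)
          - lift_points (Suc n) (bilinear_ext (extend_point G H) y ?v) \<in> word_ker (Suc n)" for x y
        by (simp add: bilinear_ext_add_left lift_points_add)
      fix g and c :: 'k assume g: "g \<in> carrier G"
      \<comment> \<open>\<open>?p\<close> prepends the letter \<open>monom g c\<close>. After the
        tail has been replaced by the lift of \<open>?v\<close>, the comparison is additive in
        \<open>?v\<close>, so a single monomial with its representative word suffices.\<close>
      let ?p = "\<lambda>c'. frag_extend (\<lambda>w. frag_of (monom g c # w)) c'"
      have sg: "supp (monom g c) \<subseteq> carrier G" using g by simp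
      have 1: "frag_of (monom g c # w') - ?p (lift_points n ?v) \<in> word_ker (Suc n)"
        using prefix_word_ker[OF sg IH] by (simp add: frag_extend_diff)
      have 2: "?p (lift_points n ?v) - lift_points (Suc n) (bilinear_ext (extend_point G H) (monom g c) ?v) \<in> word_ker (Suc n)"
        using v
      proof (rule additive_cong[rotated -1])
        show "?p (lift_points n (x + y)) - ?p (lift_points n x) - ?p (lift_points n y) \<in> word_ker (Suc n)" for x y
          using prefix_word_ker[OF sg lift_points_add[of n x y]] False by (simp add: frag_extend_diff)
        show "lift_points (Suc n) (bilinear_ext (extend_point G H) (monom g c) (x + y)) - lift_points (Suc n) (bilinear_ext (extend_point G H) (monom g c) x)
          - lift_points (Suc n) (bilinear_ext (extend_point G H) (monom g c) y) \<in> word_ker (Suc n)" for x y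
          by (simp add: bilinear_ext_add_right lift_points_add)
        fix x and d :: 'k assume x: "x \<in> points G H n"
        then have r: "set (rep n x) \<subseteq> carrier G" "length (rep n x) = n" "rep n x \<noteq> []" "point_of G H (rep n x) = x"
          using rep False by auto
        have "lift_points n (monom x d) - frag_of (pure_word d (rep n x)) \<in> word_ker n"
          using r x False by (intro lift_points_monom) auto
        from prefix_word_ker[OF sg this]
        have A: "?p (lift_points n (monom x d)) - frag_of (monom g c # pure_word d (rep n x)) \<in> word_ker (Suc n)"
          by (simp add: frag_extend_diff)
        have B: "frag_of (monom g c # pure_word d (rep n x)) - frag_of (pure_word (c * d) (g # rep n x)) \<in> word_ker (Suc n)"
          using frag_pure_move[of g "rep n x" c d] g r by simp
        have C: "lift_points (Suc n) (monom (extend_point G H g x) (c * d)) - frag_of (pure_word (c * d) (g # rep n x)) \<in> word_ker (Suc n)"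
          using r g x False by (intro lift_points_monom extend_points) (auto simp: point_of_Cons)
        show "?p (lift_points n (monom x d)) - lift_points (Suc n) (bilinear_ext (extend_point G H) (monom g c) (monom x d)) \<in> word_ker (Suc n)"
          using word_ker_trans[OF word_ker_trans[OF A B] word_ker_sym[OF C]] by simp
      qed
      show "frag_of (monom g c # w') - lift_points (Suc n) (bilinear_ext (extend_point G H) (monom g c) ?v) \<in> word_ker (Suc n)"
        by (rule word_ker_trans[OF 1 2])
    qed
    then show ?thesis using ne by (simp add: w expand_word_Cons)
  qed
qed simp

end


section \<open>Transport of retracts along isomorphisms of bimodules\<close>

definition bimod_equiv :: "'a set \<Rightarrow> 'a set \<Rightarrow> ('a, 'm) bimod \<Rightarrow> ('a, 'n) bimod \<Rightarrow> bool" where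
  "bimod_equiv L R M N \<longleftrightarrow> (\<exists>f\<in>bimod_hom L R M N. \<exists>g\<in>bimod_hom L R N M.
     (\<forall>x\<in>carrier M. g (f x) = x) \<and> (\<forall>y\<in>carrier N. f (g y) = y))"

lemma bimod_equiv_sym: "bimod_equiv L R M N \<Longrightarrow> bimod_equiv L R N M"
  unfolding bimod_equiv_def by blast

lemma bimod_equivI:
  assumes M: "additive_bimod L R M" and f: "f \<in> bimod_hom L R M N" and bij: "bij_betw f (carrier M) (carrier N)"
  shows "bimod_equiv L R M N"
proof -
  interpret M: additive_bimod L R M by fact
  define g where "g = the_inv_into (carrier M) f"
  have inj: "inj_on f (carrier M)" and im: "f ` carrier M = carrier N" using bij by (auto simp: bij_betw_def)
  have gf: "g (f x) = x" if "x \<in> carrier M" for x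
    unfolding g_def using inj that by (rule the_inv_into_f_f)
  have ex: "\<exists>x\<in>carrier M. y = f x" if "y \<in> carrier N" for y using im that by auto
  have "g \<in> bimod_hom L R N M"
  proof (rule bimod_homI)
    fix y assume "y \<in> carrier N"
    from ex[OF this] obtain x where x: "x \<in> carrier M" "y = f x" by blast
    show "g y \<in> carrier M" using x gf by simp
    show "g (lact N a y) = lact M a (g y)" if "a \<in> L" for a
      using bimod_homD(3)[OF f x(1) that, symmetric] x that gf by simp
    show "g (ract N y a) = ract M (g y) a" if "a \<in> R" for a
      using bimod_homD(4)[OF f x(1) that, symmetric] x that gf by simp
    fix y' assume "y' \<in> carrier N"
    from ex[OF this] obtain x' where x': "x' \<in> carrier M" "y' = f x'" by blast
    show "g (y \<otimes>\<^bsub>N\<^esub> y') = g y \<otimes>\<^bsub>M\<^esub> g y'"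
      using bimod_homD(2)[OF f x(1) x'(1), symmetric] x x' gf by simp
  qed
  moreover have "f (g y) = y" if "y \<in> carrier N" for y
    using ex[OF that] gf by auto
  ultimately show ?thesis unfolding bimod_equiv_def using f gf by blast
qed

lemma retract_of_multiple_equiv:
  assumes "additive_bimod L R M" "additive_bimod L R M'"
    and "bimod_equiv L R M M'" "bimod_equiv L R N N'"
    and "retract_of_multiple L R M N"
  shows "retract_of_multiple L R M' N'"
proof -
  interpret M: additive_bimod L R M by fact
  interpret M': additive_bimod L R M' by fact
  obtain u v where u: "u \<in> bimod_hom L R M M'" and v: "v \<in> bimod_hom L R M' M"
    and uv: "\<And>y. y \<in> carrier M' \<Longrightarrow> u (v y) = y"
    using assms(3) unfolding bimod_equiv_def by blast
  obtain s t where s: "s \<in> bimod_hom L R N N'" and t: "t \<in> bimod_hom L R N' N"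
    and ts: "\<And>y. y \<in> carrier N \<Longrightarrow> t (s y) = y"
    using assms(4) unfolding bimod_equiv_def by blast
  obtain q f g where q: "q \<ge> 1"
    and fg: "\<And>i. i < q \<Longrightarrow> f i \<in> bimod_hom L R M N" "\<And>i. i < q \<Longrightarrow> g i \<in> bimod_hom L R N M"
    and id: "\<And>x. x \<in> carrier M \<Longrightarrow> finprod M (\<lambda>i. g i (f i x)) {..<q::nat} = x"
    using assms(5) unfolding retract_of_multiple_def by blast
  have "(\<lambda>x. s (f i (v x))) \<in> bimod_hom L R M' N'" "(\<lambda>y. u (g i (t y))) \<in> bimod_hom L R N' M'" if "i < q" for i
    using bimod_hom_comp[OF bimod_hom_comp[OF v fg(1)] s, OF that]
      bimod_hom_comp[OF bimod_hom_comp[OF t fg(2)] u, OF that] by auto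
  moreover have "finprod M' (\<lambda>i. u (g i (t (s (f i (v x)))))) {..<q} = x" if x: "x \<in> carrier M'" for x
  proof -
    have c: "v x \<in> carrier M" "f i (v x) \<in> carrier N" "g i (f i (v x)) \<in> carrier M" if "i < q" for i
      using bimod_homD(1)[OF v x] bimod_homD(1)[OF fg(1)] bimod_homD(1)[OF fg(2)] that by blast+
    have "finprod M' (\<lambda>i. u (g i (t (s (f i (v x)))))) {..<q} = finprod M' (\<lambda>i. u (g i (f i (v x)))) {..<q}"
      using c by (intro M'.finprod_cong') (auto simp: ts bimod_homD(1)[OF u])
    also have "\<dots> = u (finprod M (\<lambda>i. g i (f i (v x))) {..<q})"
      using u c by (intro finprod_hom[OF M.comm_group_axioms M'.comm_group_axioms, symmetric]) (auto simp: bimod_hom_def)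
    also have "\<dots> = x" using id[OF bimod_homD(1)[OF v x]] uv[OF x] by simp
    finally show ?thesis .
  qed
  ultimately show ?thesis
    unfolding retract_of_multiple_def using q
    by (intro exI[of _ q] conjI exI[of _ "\<lambda>i x. s (f i (v x))"] exI[of _ "\<lambda>i y. u (g i (t y))"]) auto
qed

lemma divides_multiple_equiv:
  assumes "additive_bimod L R M" "additive_bimod L R M'" "additive_bimod L R N"
    and "bimod_equiv L R M M'" "bimod_equiv L R N N'"
  shows "divides_multiple L R M N \<longleftrightarrow> retract_of_multiple L R M' N'"
  using divides_multiple_iff_retract[OF assms(1,3)] retract_of_multiple_equiv[OF assms(1,2,4,5)]
    retract_of_multiple_equiv[OF assms(2,1) bimod_equiv_sym[OF assms(4)] bimod_equiv_sym[OF assms(5)]] by blast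

section \<open>The tensor powers and \<open>k H\<close> as permutation bimodules on points\<close>

context finite_pair
begin

abbreviation points_bimod :: "nat \<Rightarrow> ('g \<Rightarrow>\<^sub>0 'k::field, 'g set list \<times> 'g \<Rightarrow>\<^sub>0 'k) bimod" where
  "points_bimod n \<equiv> perm_bimod (lmul G) (rmul G) (points G H n)"

lemma additive_points_bimod:
  assumes "L \<subseteq> supported (carrier G)" "R \<subseteq> supported (carrier G)"
    and "n > 0 \<or> L \<subseteq> supported H \<and> R \<subseteq> supported H"
  shows "additive_bimod L R (points_bimod n)"
proof (rule additive_perm_bimod)
  fix a g x assume "a \<in> L" "g \<in> supp a" "x \<in> points G H n"
  then show "lmul G g x \<in> points G H n" using assms by (intro lmul_points) auto
next
  fix a g x assume "a \<in> R" "g \<in> supp a" "x \<in> points G H n"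
  then show "rmul G x g \<in> points G H n" using assms by (intro rmul_points) auto
qed

lemma expand_pure_word: "set xs \<subseteq> carrier G \<Longrightarrow> xs \<noteq> [] \<Longrightarrow> expand_word G H (pure_word c xs) = monom (point_of G H xs) c"
proof (induction xs arbitrary: c)
  case (Cons x xs)
  have p1: "pure_word c (x # xs) = monom x c # pure_word 1 xs" by (cases xs) auto
  show ?case
  proof (cases "xs = []")
    case False
    then have "pure_word 1 xs \<noteq> []" by (cases xs) auto
    then have "expand_word G H (pure_word c (x # xs)) = bilinear_ext (extend_point G H) (monom x c) (expand_word G H (pure_word 1 xs))"
      unfolding p1 by (rule expand_word_Cons)
    then show ?thesis using Cons False by (simp add: point_of_Cons)
  qed simp
qed simp

text \<open>The map comes from the universal property of the free abelian group and kills the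
  relators because the expansion is additive and balanced. Nothing else is killed: \<open>c\<close>
  is congruent to \<open>lift_points n (\<Phi> c)\<close>, which lies in the kernel when
  \<open>\<Phi> c = 0\<close>. Every monomial is the expansion of a pure word, hence
  surjectivity.\<close>

lemma expand_hom_exists:
  assumes n: "n > 0"
  shows "\<exists>\<Phi> :: (('g \<Rightarrow>\<^sub>0 'k::field) list \<Rightarrow>\<^sub>0 int) \<Rightarrow> ('g set list \<times> 'g \<Rightarrow>\<^sub>0 'k).
    (\<forall>c d. supp c \<subseteq> words n \<longrightarrow> supp d \<subseteq> words n \<longrightarrow> \<Phi> (c + d) = \<Phi> c + \<Phi> d) \<and>
    (\<forall>c. supp c \<subseteq> words n \<longrightarrow> supp (\<Phi> c) \<subseteq> points G H n) \<and>
    (\<forall>w\<in>words n. \<Phi> (frag_of w) = expand_word G H w) \<and>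
    (\<forall>c. supp c \<subseteq> words n \<longrightarrow> (\<Phi> c = 0 \<longleftrightarrow> c \<in> word_ker n)) \<and>
    (\<forall>v. supp v \<subseteq> points G H n \<longrightarrow> (\<exists>c. supp c \<subseteq> words n \<and> \<Phi> c = v))"
proof -
  let ?V = "points_bimod n :: ('g \<Rightarrow>\<^sub>0 'k, 'g set list \<times> 'g \<Rightarrow>\<^sub>0 'k) bimod"
  let ?F = "free_Abelian_group (words n :: ('g \<Rightarrow>\<^sub>0 'k) list set)"
  \<comment> \<open>With empty sets of scalars only the underlying abelian group is seen, which is
    the setting of the universal property.\<close>
  interpret V: additive_bimod "{}" "{}" ?V by (rule additive_points_bimod) auto
  have ex: "expand_word G H w \<in> carrier ?V" if "w \<in> words n" for w
    using supp_expand_word[of w] that n by (auto simp: words_iff)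
  obtain \<Phi> where \<Phi>: "\<Phi> \<in> hom ?F ?V" and \<Phi>w: "\<And>w. w \<in> words n \<Longrightarrow> \<Phi> (frag_of w) = expand_word G H w"
    using V.free_Abelian_group_universal[of "expand_word G H" "words n"] ex by blast
  have add: "\<Phi> (c + d) = \<Phi> c + \<Phi> d" if "supp c \<subseteq> words n" "supp d \<subseteq> words n" for c d
    using hom_mult[OF \<Phi>, of c d] that by simp
  have supp: "supp (\<Phi> c) \<subseteq> points G H n" if "supp c \<subseteq> words n" for c
    using hom_in_carrier[OF \<Phi>, of c] that by simp
  have diff: "\<Phi> (c - d) = \<Phi> c - \<Phi> d" if "supp c \<subseteq> words n" "supp d \<subseteq> words n" for c d
    using add[of "c - d" d] that supp_frag_diff[OF that] by simp
  have \<Phi>0: "\<Phi> 0 = 0" using diff[of 0 0] by simp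
  have fw: "supp (frag_of w) \<subseteq> words n" if "w \<in> words n" for w :: "('g \<Rightarrow>\<^sub>0 'k) list"
    using that by (simp add: keys_frag_of)
  have gh: "group_hom ?F ?V \<Phi>"
    by (intro group_hom.intro group_hom_axioms.intro) (simp_all add: \<Phi> V.is_group)
  have "relators n \<subseteq> kernel ?F ?V \<Phi>"
  proof
    fix r :: "('g \<Rightarrow>\<^sub>0 'k) list \<Rightarrow>\<^sub>0 int" assume r: "r \<in> relators n"
    then have rc: "r \<in> carrier ?F" using relators_carrier by blast
    from r have "\<Phi> r = 0"
    proof (cases rule: relators_cases)
      case (add xs ys x y)
      have s: "xs @ [x + y] @ ys \<in> words n"
        using add supp_add_subset[of x "carrier G" y] by (auto simp: words_iff)
      show ?thesis
        unfolding add(1) diff[OF supp_frag_diff[OF fw[OF s] fw[OF add(2)]] fw[OF add(3)]]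
          diff[OF fw[OF s] fw[OF add(2)]] \<Phi>w[OF s] \<Phi>w[OF add(2)] \<Phi>w[OF add(3)] expand_word_add
        by simp
    next
      case (bal xs ys x y b)
      have "supp b \<subseteq> carrier G" using bal H.subset by blast
      then have s: "xs @ [bilinear_ext (\<otimes>) x b, y] @ ys \<in> words n" "xs @ [x, bilinear_ext (\<otimes>) b y] @ ys \<in> words n"
        using bal(2) supp_bilinear_ext_mult[of x b] supp_bilinear_ext_mult[of b y] by (auto simp: words_iff)
      have "expand_word G H (xs @ [bilinear_ext (\<otimes>) x b, y] @ ys) = expand_word G H (xs @ [x, bilinear_ext (\<otimes>) b y] @ ys)"
        using bal by (intro expand_word_balanced) (auto simp: words_iff)
      then show ?thesis
        unfolding bal(1) diff[OF fw[OF s(1)] fw[OF s(2)]] \<Phi>w[OF s(1)] \<Phi>w[OF s(2)] by simp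
    qed
    then show "r \<in> kernel ?F ?V \<Phi>" using rc by (simp add: kernel_def)
  qed
  then have 1: "word_ker n \<subseteq> kernel ?F ?V \<Phi>"
    unfolding word_ker_generate
    by (intro group.generate_subgroup_incl) (simp_all add: group_hom.subgroup_kernel[OF gh])
  have lz: "lift_points n (0 :: 'g set list \<times> 'g \<Rightarrow>\<^sub>0 'k) \<in> word_ker n"
    using word_ker_uminus[OF lift_points_add[OF n, of 0 0]] by simp
  have lift: "c - lift_points n (\<Phi> c) \<in> word_ker n" if "supp c \<subseteq> words n" for c
    using that
  proof (induction rule: free_Abelian_group_induct[consumes 1, case_names 1 2 3])
    case 1
    then show ?case using word_ker_uminus[OF lz] by (simp add: \<Phi>0)
  next
    case (2 c d)
    have "(c - lift_points n (\<Phi> c)) - (d - lift_points n (\<Phi> d))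
        + (lift_points n (\<Phi> (c - d) + \<Phi> d) - lift_points n (\<Phi> (c - d)) - lift_points n (\<Phi> d)) \<in> word_ker n"
      by (intro word_ker_add word_ker_diff[OF 2(3,4)] lift_points_add n)
    then show ?case using 2 by (simp add: diff)
  next
    case (3 w)
    then show ?case using frag_expand_word[OF 3 n] by (simp add: \<Phi>w)
  qed
  have ker: "\<Phi> c = 0 \<longleftrightarrow> c \<in> word_ker n" if "supp c \<subseteq> words n" for c
  proof
    assume "\<Phi> c = 0"
    then show "c \<in> word_ker n" using word_ker_add[OF lift[OF that]] lz by fastforce
  next
    assume "c \<in> word_ker n"
    then show "\<Phi> c = 0" using 1 by (auto simp: kernel_def)
  qed
  have surj: "\<exists>c. supp c \<subseteq> words n \<and> \<Phi> c = v" if "supp v \<subseteq> points G H n" for v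
    using that
  proof (induction rule: poly_mapping_supp_induct)
    case zero
    then show ?case by (intro exI[of _ 0]) (simp add: \<Phi>0)
  next
    case (monom x c)
    note r = rep[OF monom n]
    have "pure_word c (rep n x) \<in> words n" using pure_word_words[OF r(1), of c] r(2) by simp
    then show ?case
      using r by (intro exI[of _ "frag_of (pure_word c (rep n x))"]) (simp add: keys_frag_of \<Phi>w expand_pure_word)
  next
    case (add u v)
    then obtain c d where "supp c \<subseteq> words n" "\<Phi> c = u" "supp d \<subseteq> words n" "\<Phi> d = v" by blast
    then show ?case using \<open>\<And>d c. supp c \<subseteq> words n \<Longrightarrow> supp d \<subseteq> words n \<Longrightarrow> \<Phi> (c + d) = \<Phi> c + \<Phi> d\<close>
      by (intro exI[of _ "c + d"]) (simp add: supp_add_subset)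
  qed
  show ?thesis
    by (intro exI[of _ \<Phi>] conjI allI impI ballI) (fact add supp \<Phi>w ker surj)+
qed

text \<open>The cosets of \<open>word_ker n\<close> are the level sets of \<open>\<Phi>\<close>, so
  identities between classes of words, including those for the two actions, are checked on
  expansions.\<close>

lemma tensor_power_equiv:
  fixes L R :: "('g \<Rightarrow>\<^sub>0 'k::field) set"
  assumes n: "n > 0" and L: "L \<subseteq> supported (carrier G)" and R: "R \<subseteq> supported (carrier G)"
  shows "additive_bimod L R (tensor_power (group_algebra G) (supported H) n)"
    and "bimod_equiv L R (tensor_power (group_algebra G) (supported H) n) (points_bimod n)"
proof -
  let ?T = "tensor_power (group_algebra G) (supported H) n :: ('g \<Rightarrow>\<^sub>0 'k, (('g \<Rightarrow>\<^sub>0 'k) list \<Rightarrow>\<^sub>0 int) set) bimod"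
  let ?F = "free_Abelian_group (words n :: ('g \<Rightarrow>\<^sub>0 'k) list set)"
  let ?word_ker = "word_ker n :: (('g \<Rightarrow>\<^sub>0 'k) list \<Rightarrow>\<^sub>0 int) set"
  let ?c = "\<lambda>c. ?word_ker #>\<^bsub>?F\<^esub> c"
  obtain \<Phi> :: "(('g \<Rightarrow>\<^sub>0 'k) list \<Rightarrow>\<^sub>0 int) \<Rightarrow> ('g set list \<times> 'g \<Rightarrow>\<^sub>0 'k)" where \<Phi>:
    "\<forall>c d. supp c \<subseteq> words n \<longrightarrow> supp d \<subseteq> words n \<longrightarrow> \<Phi> (c + d) = \<Phi> c + \<Phi> d"
    "\<forall>c. supp c \<subseteq> words n \<longrightarrow> supp (\<Phi> c) \<subseteq> points G H n"
    "\<forall>w\<in>words n. \<Phi> (frag_of w) = expand_word G H w"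
    "\<forall>c. supp c \<subseteq> words n \<longrightarrow> (\<Phi> c = 0 \<longleftrightarrow> c \<in> word_ker n)"
    "\<forall>v. supp v \<subseteq> points G H n \<longrightarrow> (\<exists>c. supp c \<subseteq> words n \<and> \<Phi> c = v)"
    using expand_hom_exists[OF n] by (elim exE conjE) (rule that)
  note add = \<Phi>(1)[rule_format] and supp = \<Phi>(2)[rule_format] and \<Phi>w = \<Phi>(3)[rule_format]
    and ker = \<Phi>(4)[rule_format] and surj = \<Phi>(5)[rule_format]
  interpret F: comm_group ?F by (rule abelian_free_Abelian_group)
  interpret Kn: normal ?word_ker ?F using word_ker_subgroup by (simp add: F.normal_iff_subgroup)
  have diff: "\<Phi> (c - d) = \<Phi> c - \<Phi> d" if "supp c \<subseteq> words n" "supp d \<subseteq> words n" for c d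
    using add[of "c - d" d] that supp_frag_diff[OF that] by simp
  have mem: "d \<in> ?c c \<longleftrightarrow> supp d \<subseteq> words n \<and> \<Phi> d = \<Phi> c" if "supp c \<subseteq> words n" for c d
  proof -
    have "d \<in> ?c c \<longleftrightarrow> d - c \<in> ?word_ker"
      unfolding r_coset_def by (auto intro: bexI[of _ "d - c"])
    also have "\<dots> \<longleftrightarrow> supp d \<subseteq> words n \<and> \<Phi> d = \<Phi> c"
    proof
      assume *: "d - c \<in> ?word_ker"
      have "supp (d - c + c) \<subseteq> words n" using word_ker_supp[OF *] that by (rule supp_add_subset)
      then show "supp d \<subseteq> words n \<and> \<Phi> d = \<Phi> c"
        using * ker[of "d - c"] that word_ker_supp[OF *] by (simp add: diff)
    next
      assume "supp d \<subseteq> words n \<and> \<Phi> d = \<Phi> c"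
      then show "d - c \<in> ?word_ker" using that ker[of "d - c"] supp_frag_diff[of d "words n" c] by (simp add: diff)
    qed
    finally show ?thesis .
  qed
  have coset: "?c c = {d. supp d \<subseteq> words n \<and> \<Phi> d = \<Phi> c}" if "supp c \<subseteq> words n" for c
    using mem[OF that] by blast
  have coset_eq: "?c c = ?c d \<longleftrightarrow> \<Phi> c = \<Phi> d" if "supp c \<subseteq> words n" "supp d \<subseteq> words n" for c d
    using that by (auto simp: coset)
  have carr: "X \<in> carrier ?T \<longleftrightarrow> (\<exists>c. supp c \<subseteq> words n \<and> X = ?c c)" for X
  proof -
    have "carrier ?T = ?c ` carrier ?F"
      by (simp add: tensor_power_def monoid.defs carrier_FactGroup words_def[symmetric] word_ker_def[symmetric])
    then show ?thesis by (simp only: image_iff Bex_def carrier_free_Abelian_group_iff)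
  qed
  have mult: "?c c \<otimes>\<^bsub>?T\<^esub> ?c d = ?c (c + d)" if "supp c \<subseteq> words n" "supp d \<subseteq> words n" for c d
    using Kn.rcos_sum[of c d] that
    by (simp add: tensor_power_def monoid.defs words_def[symmetric] word_ker_def[symmetric])
  \<comment> \<open>\<open>\<alpha>\<close> is the additive map on expansions that mirrors the
    operation \<open>f\<close> on words. The image of \<open>c\<close> under \<open>\<Phi>\<close>
    determines that of the transformed combination, so all representatives of a class go to a single
    class, and \<open>the_elem\<close> picks it.\<close>
  have map: "tensor_map (group_algebra G) (supported H) n f (?c c) = ?c (frag_extend (\<lambda>w. frag_of (f w)) c)
      \<and> supp (frag_extend (\<lambda>w. frag_of (f w)) c) \<subseteq> words n
      \<and> \<Phi> (frag_extend (\<lambda>w. frag_of (f w)) c) = \<alpha> (\<Phi> c)"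
    if f: "\<And>w. w \<in> words n \<Longrightarrow> f w \<in> words n"
      and \<alpha>: "\<And>u v. \<alpha> (u + v) = \<alpha> u + \<alpha> v"
      and f\<alpha>: "\<And>w. w \<in> words n \<Longrightarrow> expand_word G H (f w) = \<alpha> (expand_word G H w)"
      and c: "supp c \<subseteq> words n" for f \<alpha> c
  proof -
    let ?e = "frag_extend (\<lambda>w. frag_of (f w))"
    have \<alpha>d: "\<alpha> (u - v) = \<alpha> u - \<alpha> v" for u v using \<alpha>[of "u - v" v] by simp
    have se: "supp (?e d) \<subseteq> words n" if "supp d \<subseteq> words n" for d
      using keys_frag_extend[of "\<lambda>w. frag_of (f w)" d] that f by (fastforce simp: keys_frag_of)
    have \<Phi>e: "\<Phi> (?e d) = \<alpha> (\<Phi> d)" if "supp d \<subseteq> words n" for d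
      using that
    proof (induction rule: free_Abelian_group_induct[consumes 1, case_names 1 2 3])
      case 1
      then show ?case using \<alpha>d[of 0 0] diff[of 0 0] by simp
    next
      case (2 x y)
      then show ?case by (simp add: frag_extend_diff diff se \<alpha>d)
    next
      case (3 w)
      then show ?case by (simp add: \<Phi>w f f\<alpha>)
    qed
    have "(\<lambda>d. ?c (?e d)) ` ?c c = (\<lambda>d. ?c (?e c)) ` ?c c"
      using c by (intro image_cong refl) (simp add: mem coset_eq se \<Phi>e)
    also have "\<dots> = {?c (?e c)}"
      using c by (intro image_constant[of c]) (simp add: mem)
    finally have "(\<lambda>d. ?c (?e d)) ` ?c c = {?c (?e c)}" .
    then have "tensor_map (group_algebra G) (supported H) n f (?c c) = ?c (?e c)"
      unfolding tensor_map_def by (simp add: words_def[symmetric] word_ker_def[symmetric])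
    then show ?thesis using se \<Phi>e c by blast
  qed
  have lact: "\<exists>e. lact ?T a (?c c) = ?c e \<and> supp e \<subseteq> words n \<and> \<Phi> e = bilinear_ext (lmul G) a (\<Phi> c)"
    if a: "supp a \<subseteq> carrier G" and c: "supp c \<subseteq> words n" for a c
  proof -
    let ?f = "\<lambda>xs. (a \<otimes>\<^bsub>group_algebra G\<^esub> hd xs) # tl xs"
    have f: "?f w \<in> words n" "expand_word G H (?f w) = bilinear_ext (lmul G) a (expand_word G H w)" if w_in: "w \<in> words n" for w
    proof -
      obtain b w' where w: "w = b # w'" using w_in n by (cases w) (auto simp: words_iff)
      then show "?f w \<in> words n" using that a supp_bilinear_ext_mult[of a b] by (auto simp: words_iff)
      show "expand_word G H (?f w) = bilinear_ext (lmul G) a (expand_word G H w)"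
        using w that a expand_word_mult_hd[of a b w'] by (auto simp: words_iff)
    qed
    have "lact ?T a (?c c) = tensor_map (group_algebra G) (supported H) n ?f (?c c)"
      by (simp add: tensor_power_def monoid.defs)
    then show ?thesis
      by (intro exI) (simp only:, rule map[of ?f "bilinear_ext (lmul G) a", OF f(1) bilinear_ext_add_right f(2) c])
  qed
  have ract: "\<exists>e. ract ?T (?c c) a = ?c e \<and> supp e \<subseteq> words n \<and> \<Phi> e = bilinear_ext (rmul G) (\<Phi> c) a"
    if a: "supp a \<subseteq> carrier G" and c: "supp c \<subseteq> words n" for a c
  proof -
    let ?f = "\<lambda>xs. butlast xs @ [last xs \<otimes>\<^bsub>group_algebra G\<^esub> a]"
    have f: "?f w \<in> words n" "expand_word G H (?f w) = bilinear_ext (rmul G) (expand_word G H w) a" if "w \<in> words n" for w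
    proof -
      have ne: "w \<noteq> []" using that n by (auto simp: words_iff)
      have "supp (last w) \<subseteq> carrier G" using that ne by (simp add: words_iff)
      then show "?f w \<in> words n" using that ne a supp_bilinear_ext_mult[of "last w" a]
        by (auto simp: words_iff dest: in_set_butlastD)
      show "expand_word G H (?f w) = bilinear_ext (rmul G) (expand_word G H w) a"
        using ne that a expand_word_mult_last[of a w] by (simp add: words_iff)
    qed
    have "ract ?T (?c c) a = tensor_map (group_algebra G) (supported H) n ?f (?c c)"
      by (simp add: tensor_power_def monoid.defs)
    then show ?thesis
      by (intro exI) (simp only:, rule map[of ?f "\<lambda>v. bilinear_ext (rmul G) v a", OF f(1) bilinear_ext_add_left f(2) c])
  qed
  have one: "\<one>\<^bsub>?T\<^esub> = ?c 0"
    using F.coset_mult_one[OF subgroup.subset[OF word_ker_subgroup]]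
    by (simp add: tensor_power_def monoid.defs words_def[symmetric] word_ker_def[symmetric])
  have carrI: "?c c \<in> carrier ?T" if "supp c \<subseteq> words n" for c
    using that carr by blast
  have cg: "comm_group ?T"
  proof (rule comm_groupI)
    show "\<one>\<^bsub>?T\<^esub> \<in> carrier ?T" unfolding one by (rule carrI) simp
    fix X assume "X \<in> carrier ?T"
    then obtain c where c: "supp c \<subseteq> words n" "X = ?c c" using carr by blast
    show "\<one>\<^bsub>?T\<^esub> \<otimes>\<^bsub>?T\<^esub> X = X" using c by (simp add: one mult)
    have "?c (- c) \<in> carrier ?T" "?c (- c) \<otimes>\<^bsub>?T\<^esub> X = \<one>\<^bsub>?T\<^esub>"
      using c mult[of "- c" c] carrI[of "- c"] by (simp_all add: one)
    then show "\<exists>Y\<in>carrier ?T. Y \<otimes>\<^bsub>?T\<^esub> X = \<one>\<^bsub>?T\<^esub>" by blast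
    fix Y assume "Y \<in> carrier ?T"
    then obtain d where d: "supp d \<subseteq> words n" "Y = ?c d" using carr by blast
    have s: "supp (c + d) \<subseteq> words n" using c d by (simp add: supp_add_subset)
    show "X \<otimes>\<^bsub>?T\<^esub> Y \<in> carrier ?T" using c d s by (simp add: mult carrI)
    show "X \<otimes>\<^bsub>?T\<^esub> Y = Y \<otimes>\<^bsub>?T\<^esub> X" using c d by (simp add: mult add.commute)
    fix Z assume "Z \<in> carrier ?T"
    then obtain e where e: "supp e \<subseteq> words n" "Z = ?c e" using carr by blast
    have "supp (d + e) \<subseteq> words n" using d e by (simp add: supp_add_subset)
    then show "X \<otimes>\<^bsub>?T\<^esub> Y \<otimes>\<^bsub>?T\<^esub> Z = X \<otimes>\<^bsub>?T\<^esub> (Y \<otimes>\<^bsub>?T\<^esub> Z)"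
      using c d e s by (simp add: mult add.assoc)
  qed
  show T: "additive_bimod L R ?T"
  proof (intro additive_bimod.intro additive_bimod_axioms.intro cg homI)
    fix a X assume a: "a \<in> L" and X: "X \<in> carrier ?T"
    then have sa: "supp a \<subseteq> carrier G" using L by auto
    obtain c where c: "supp c \<subseteq> words n" "X = ?c c" using X carr by blast
    obtain e where e: "lact ?T a X = ?c e" "supp e \<subseteq> words n" "\<Phi> e = bilinear_ext (lmul G) a (\<Phi> c)"
      using lact[OF sa c(1)] c(2) by blast
    show "lact ?T a X \<in> carrier ?T" using e carr by blast
    fix Y assume "Y \<in> carrier ?T"
    then obtain d where d: "supp d \<subseteq> words n" "Y = ?c d" using carr by blast
    obtain e' where e': "lact ?T a Y = ?c e'" "supp e' \<subseteq> words n" "\<Phi> e' = bilinear_ext (lmul G) a (\<Phi> d)"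
      using lact[OF sa d(1)] d(2) by blast
    have s: "supp (c + d) \<subseteq> words n" using c d by (simp add: supp_add_subset)
    obtain e'' where e'': "lact ?T a (?c (c + d)) = ?c e''" "supp e'' \<subseteq> words n" "\<Phi> e'' = bilinear_ext (lmul G) a (\<Phi> (c + d))"
      using lact[OF sa s] by blast
    show "lact ?T a (X \<otimes>\<^bsub>?T\<^esub> Y) = lact ?T a X \<otimes>\<^bsub>?T\<^esub> lact ?T a Y"
      using c d e e' e'' by (simp add: mult coset_eq supp_add_subset add bilinear_ext_add_right)
  next
    fix a X assume a: "a \<in> R" and X: "X \<in> carrier ?T"
    then have sa: "supp a \<subseteq> carrier G" using R by auto
    obtain c where c: "supp c \<subseteq> words n" "X = ?c c" using X carr by blast
    obtain e where e: "ract ?T X a = ?c e" "supp e \<subseteq> words n" "\<Phi> e = bilinear_ext (rmul G) (\<Phi> c) a"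
      using ract[OF sa c(1)] c(2) by blast
    show "ract ?T X a \<in> carrier ?T" using e carr by blast
    fix Y assume "Y \<in> carrier ?T"
    then obtain d where d: "supp d \<subseteq> words n" "Y = ?c d" using carr by blast
    obtain e' where e': "ract ?T Y a = ?c e'" "supp e' \<subseteq> words n" "\<Phi> e' = bilinear_ext (rmul G) (\<Phi> d) a"
      using ract[OF sa d(1)] d(2) by blast
    have s: "supp (c + d) \<subseteq> words n" using c d by (simp add: supp_add_subset)
    obtain e'' where e'': "ract ?T (?c (c + d)) a = ?c e''" "supp e'' \<subseteq> words n" "\<Phi> e'' = bilinear_ext (rmul G) (\<Phi> (c + d)) a"
      using ract[OF sa s] by blast
    show "ract ?T (X \<otimes>\<^bsub>?T\<^esub> Y) a = ract ?T X a \<otimes>\<^bsub>?T\<^esub> ract ?T Y a"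
      using c d e e' e'' by (simp add: mult coset_eq supp_add_subset add bilinear_ext_add_left)
  qed
  \<comment> \<open>\<open>\<Phi>\<close> is constant on each class, so its image is a
    singleton.\<close>
  define \<theta> where "\<theta> X = the_elem (\<Phi> ` X)" for X
  have \<theta>: "\<theta> (?c c) = \<Phi> c" if "supp c \<subseteq> words n" for c
  proof -
    have "\<Phi> ` ?c c = {\<Phi> c}" using that by (auto simp: coset)
    then show ?thesis by (simp add: \<theta>_def)
  qed
  show "bimod_equiv L R ?T (points_bimod n)"
  proof (rule bimod_equivI[OF T, of \<theta>])
    show "\<theta> \<in> bimod_hom L R ?T (points_bimod n)"
    proof (rule bimod_homI)
      fix X assume "X \<in> carrier ?T"
      then obtain c where c: "supp c \<subseteq> words n" "X = ?c c" using carr by blast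
      show "\<theta> X \<in> carrier (points_bimod n)" using c supp by (simp add: \<theta>)
      show "\<theta> (lact ?T a X) = lact (points_bimod n) a (\<theta> X)" if "a \<in> L" for a
      proof -
        have "supp a \<subseteq> carrier G" using that L by auto
        from lact[OF this c(1)] obtain e where "lact ?T a X = ?c e" "supp e \<subseteq> words n" "\<Phi> e = bilinear_ext (lmul G) a (\<Phi> c)"
          using c(2) by blast
        then show ?thesis using c by (simp add: \<theta>)
      qed
      show "\<theta> (ract ?T X a) = ract (points_bimod n) (\<theta> X) a" if "a \<in> R" for a
      proof -
        have "supp a \<subseteq> carrier G" using that R by auto
        from ract[OF this c(1)] obtain e where "ract ?T X a = ?c e" "supp e \<subseteq> words n" "\<Phi> e = bilinear_ext (rmul G) (\<Phi> c) a"
          using c(2) by blast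
        then show ?thesis using c by (simp add: \<theta>)
      qed
      fix Y assume "Y \<in> carrier ?T"
      then obtain d where d: "supp d \<subseteq> words n" "Y = ?c d" using carr by blast
      show "\<theta> (X \<otimes>\<^bsub>?T\<^esub> Y) = \<theta> X \<otimes>\<^bsub>points_bimod n\<^esub> \<theta> Y"
        using c d by (simp add: mult \<theta> supp_add_subset add)
    qed
    show "bij_betw \<theta> (carrier ?T) (carrier (points_bimod n))"
      unfolding bij_betw_def
    proof
      show "inj_on \<theta> (carrier ?T)"
      proof (rule inj_onI)
        fix X Y assume XY: "X \<in> carrier ?T" "Y \<in> carrier ?T" "\<theta> X = \<theta> Y"
        obtain c where c: "supp c \<subseteq> words n" "X = ?c c" using XY(1) carr by blast
        obtain d where d: "supp d \<subseteq> words n" "Y = ?c d" using XY(2) carr by blast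
        show "X = Y" using XY(3) c d by (simp add: \<theta> coset_eq)
      qed
      show "\<theta> ` carrier ?T = carrier (points_bimod n)"
      proof (intro equalityI subsetI)
        fix v assume "v \<in> \<theta> ` carrier ?T"
        then obtain X where "X \<in> carrier ?T" "v = \<theta> X" by blast
        moreover obtain c where "supp c \<subseteq> words n" "X = ?c c"
          using \<open>X \<in> carrier ?T\<close> carr by blast
        ultimately show "v \<in> carrier (points_bimod n)" using supp by (simp add: \<theta>)
      next
        fix v assume "v \<in> carrier (points_bimod n :: ('g \<Rightarrow>\<^sub>0 'k, 'g set list \<times> 'g \<Rightarrow>\<^sub>0 'k) bimod)"
        then obtain c where "supp c \<subseteq> words n" "\<Phi> c = v" using surj by auto
        then show "v \<in> \<theta> ` carrier ?T" by (intro image_eqI[of _ _ "?c c"]) (simp_all add: \<theta> carrI)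
      qed
    qed
  qed
qed

lemma regular_bimod_equiv:
  fixes L R :: "('g \<Rightarrow>\<^sub>0 'k::field) set"
  assumes L: "L \<subseteq> supported H" and R: "R \<subseteq> supported H"
  shows "additive_bimod L R (regular_bimod (group_algebra G) (supported H))"
    and "bimod_equiv L R (regular_bimod (group_algebra G) (supported H)) (points_bimod 0)"
proof -
  let ?T = "regular_bimod (group_algebra G) (supported H) :: ('g \<Rightarrow>\<^sub>0 'k, 'g \<Rightarrow>\<^sub>0 'k) bimod"
  have simps: "v \<in> carrier ?T \<longleftrightarrow> supp v \<subseteq> H" "v \<otimes>\<^bsub>?T\<^esub> w = v + w" "\<one>\<^bsub>?T\<^esub> = (0 :: 'g \<Rightarrow>\<^sub>0 'k)"
    "lact ?T = bilinear_ext (\<otimes>)" "ract ?T = bilinear_ext (\<otimes>)" for v w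
    by (auto simp: regular_bimod_def group_algebra_def bilinear_ext_def fun_eq_iff)
  have sb: "supp (bilinear_ext (\<otimes>) a b) \<subseteq> H" if "supp a \<subseteq> H" "supp b \<subseteq> H" for a b
    using that by (intro supp_bilinear_ext) auto
  have "comm_group ?T"
  proof (rule comm_groupI)
    fix v assume "v \<in> carrier ?T"
    then show "\<exists>w\<in>carrier ?T. w \<otimes>\<^bsub>?T\<^esub> v = \<one>\<^bsub>?T\<^esub>"
      by (intro bexI[of _ "- v"]) (auto simp: in_keys_iff simps)
  qed (auto simp: supp_add_subset add_ac simps)
  then show T: "additive_bimod L R ?T"
  proof (intro additive_bimod.intro additive_bimod_axioms.intro homI)
    fix a v assume "a \<in> L" "v \<in> carrier ?T"
    then show "lact ?T a v \<in> carrier ?T" using L sb[of a v] by (auto simp only: simps)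
  next
    fix a v assume "a \<in> R" "v \<in> carrier ?T"
    then show "ract ?T v a \<in> carrier ?T" using R sb[of v a] by (auto simp only: simps)
  qed (simp_all only: simps bilinear_ext_add_left bilinear_ext_add_right)
  have pts: "points G H 0 = {[]} \<times> H" by (auto simp: points_def)
  show "bimod_equiv L R ?T (points_bimod 0)"
  proof (rule bimod_equivI[OF T, of to_points])
    show "to_points \<in> bimod_hom L R ?T (points_bimod 0)"
    proof (rule bimod_homI)
      fix v assume v: "v \<in> carrier ?T"
      then have vG: "supp v \<subseteq> carrier G" using H.subset by (auto simp: simps)
      show "to_points v \<in> carrier (points_bimod 0)"
        using v supp_to_points[of v H] by (simp add: simps pts)
      show "to_points (lact ?T a v) = lact (points_bimod 0) a (to_points v)" if "a \<in> L" for a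
      proof -
        have "supp a \<subseteq> carrier G" using that L H.subset by blast
        then show ?thesis using vG by (simp add: simps to_points_mult(1))
      qed
      show "to_points (ract ?T v a) = ract (points_bimod 0) (to_points v) a" if "a \<in> R" for a
      proof -
        have "supp a \<subseteq> carrier G" using that R H.subset by blast
        then show ?thesis using vG by (simp add: simps to_points_mult(2))
      qed
    qed (simp add: simps to_points_add)
    define g where "g v = bilinear_ext (\<lambda>x _. snd x) v (monom () 1)" for v :: "'g set list \<times> 'g \<Rightarrow>\<^sub>0 'k"
    have g: "g (to_points v) = v" for v :: "'g \<Rightarrow>\<^sub>0 'k"
    proof -
      have "supp v \<subseteq> UNIV" by simp
      then show ?thesis
        by (induction rule: poly_mapping_supp_induct) (auto simp: g_def to_points_add bilinear_ext_add_left, simp add: to_points_def)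
    qed
    have "supp v \<subseteq> points G H 0 \<Longrightarrow> to_points (g v) = v" for v :: "'g set list \<times> 'g \<Rightarrow>\<^sub>0 'k"
      by (induction rule: poly_mapping_supp_induct) (auto simp: g_def to_points_add bilinear_ext_add_left pts, simp add: to_points_def)
    moreover have "supp (g v) \<subseteq> H" if "supp v \<subseteq> points G H 0" for v :: "'g set list \<times> 'g \<Rightarrow>\<^sub>0 'k"
      unfolding g_def using that by (intro supp_bilinear_ext) (auto simp: pts)
    ultimately show "bij_betw to_points (carrier ?T) (carrier (points_bimod 0))"
      using g supp_to_points[where S = H]
      by (intro bij_betw_byWitness[of _ g] ballI image_subsetI) (simp_all add: simps pts)
  qed
qed

end


section \<open>Invariant matrices\<close>


text \<open>
  The matrices \<open>S i\<close> and \<open>T i\<close> are those of \<open>q\<close> pairs of equivariant maps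
  \<open>k X \<rightarrow> k Y \<rightarrow> k X\<close> whose composites add up to the identity.
\<close>

definition matrix_retract ::
    "'k::field itself \<Rightarrow> 'c set \<Rightarrow> ('c \<Rightarrow> 'x \<Rightarrow> 'x) \<Rightarrow> ('c \<Rightarrow> 'y \<Rightarrow> 'y) \<Rightarrow> 'x set \<Rightarrow> 'y set \<Rightarrow> bool" where
  "matrix_retract _ \<Gamma> \<alpha> \<beta> X Y \<longleftrightarrow> (\<exists>q\<ge>1. \<exists>(S :: nat \<Rightarrow> 'x \<Rightarrow> 'y \<Rightarrow> 'k) (T :: nat \<Rightarrow> 'y \<Rightarrow> 'x \<Rightarrow> 'k).
     (\<forall>i<q. \<forall>c\<in>\<Gamma>. \<forall>x\<in>X. \<forall>y\<in>Y. S i (\<alpha> c x) (\<beta> c y) = S i x y \<and> T i (\<beta> c y) (\<alpha> c x) = T i y x) \<and>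
     (\<forall>x\<in>X. \<forall>x'\<in>X. (\<Sum>i<q. \<Sum>y\<in>Y. S i x y * T i y x') = of_bool (x = x')))"

text \<open>Multiples of \<open>e\<close> carry the scalars of \<open>k\<close>, so bimodule maps
  between such modules are linear; \<open>e\<close> on one side also lets the other side act alone.
  Injectivity on a finite set makes every translation a permutation, along which sums can be
  reindexed.\<close>

locale perm_action =
  fixes l :: "'g \<Rightarrow> 'x \<Rightarrow> 'x" and r :: "'x \<Rightarrow> 'g \<Rightarrow> 'x" and P Q :: "'g set" and e :: 'g and X :: "'x set"
  assumes finite_X: "finite X"
    and l_closed: "p \<in> P \<Longrightarrow> x \<in> X \<Longrightarrow> l p x \<in> X"
    and r_closed: "p \<in> Q \<Longrightarrow> x \<in> X \<Longrightarrow> r x p \<in> X"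
    and l_inj: "p \<in> P \<Longrightarrow> inj_on (l p) X"
    and r_inj: "p \<in> Q \<Longrightarrow> inj_on (\<lambda>x. r x p) X"
    and e_in: "e \<in> P" "e \<in> Q"
    and l_e: "x \<in> X \<Longrightarrow> l e x = x"
    and r_e: "x \<in> X \<Longrightarrow> r x e = x"
begin

lemma l_bij: "p \<in> P \<Longrightarrow> bij_betw (l p) X X"
  using finite_X l_closed l_inj by (simp add: bij_betw_def endo_inj_surj image_subset_iff)

lemma r_bij: "p \<in> Q \<Longrightarrow> bij_betw (\<lambda>x. r x p) X X"
  using finite_X r_closed r_inj by (simp add: bij_betw_def endo_inj_surj image_subset_iff)

end

lemma finprod_perm_bimod:
  assumes "finite I" "\<And>i. i \<in> I \<Longrightarrow> supp (h i) \<subseteq> X"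
  shows "finprod (perm_bimod l r X) h I = (\<Sum>i\<in>I. h i)"
proof -
  interpret additive_bimod "{}" "{}" "perm_bimod l r X" by (rule additive_perm_bimod) auto
  show ?thesis using assms
  proof (induction I)
    case empty
    then show ?case by simp
  next
    case (insert i I)
    have "h \<in> I \<rightarrow> carrier (perm_bimod l r X)" "h i \<in> carrier (perm_bimod l r X)" using insert by auto
    then have "finprod (perm_bimod l r X) h (insert i I) = h i \<otimes>\<^bsub>perm_bimod l r X\<^esub> finprod (perm_bimod l r X) h I"
      using insert.hyps by (intro finprod_insert)
    then show ?case using insert by simp
  qed
qed

lemma supp_sum_subset: "(\<And>i. i \<in> I \<Longrightarrow> supp (h i) \<subseteq> X) \<Longrightarrow> supp (\<Sum>i\<in>I. h i) \<subseteq> X"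
  by (rule order.trans[OF keys_sum]) auto

lemma bimod_hom_sum:
  assumes "f \<in> bimod_hom L R (perm_bimod l r X) (perm_bimod l' r' Y)" "\<And>i. i \<in> I \<Longrightarrow> supp (h i) \<subseteq> X"
  shows "f (\<Sum>i\<in>I. h i) = (\<Sum>i\<in>I. f (h i))"
proof -
  note fD = bimod_homD(2)[OF assms(1), simplified]
  have z: "f 0 = 0" using fD[of 0 0] by simp
  show ?thesis using assms(2)
    by (induction I rule: infinite_finite_induct) (auto simp: z fD supp_sum_subset)
qed

text \<open>Injectivity keeps distinct basis elements distinct, so no two coefficients are added
  together.\<close>

lemma coeff_bilinear_ext_left_inj:
  assumes "inj_on (l p) X" "supp v \<subseteq> X" "x \<in> X"
  shows "coeff (bilinear_ext l (monom p c) v) (l p x) = c * coeff v x"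
  using assms(2)
proof (induction rule: poly_mapping_supp_induct)
  case (monom y d)
  then show ?case using assms(1,3) by (auto simp: lookup_single when_def inj_on_def)
qed (auto simp: bilinear_ext_add_right lookup_add algebra_simps)

lemma coeff_bilinear_ext_right_inj:
  assumes "inj_on (\<lambda>x. r x p) X" "supp v \<subseteq> X" "x \<in> X"
  shows "coeff (bilinear_ext r v (monom p c)) (r x p) = coeff v x * c"
  using assms(2)
proof (induction rule: poly_mapping_supp_induct)
  case (monom y d)
  then show ?case using assms(1,3) by (auto simp: lookup_single when_def inj_on_def)
qed (auto simp: bilinear_ext_add_left lookup_add algebra_simps)

text \<open>Vectors are rows: \<open>S x y\<close> is the coefficient at \<open>y\<close> of the
  image of the basis element \<open>x\<close>. Composites therefore have the product matrix in the
  order of application.\<close>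

definition matrix_apply :: "('x \<Rightarrow> 'y \<Rightarrow> 'k) \<Rightarrow> 'x set \<Rightarrow> 'y set \<Rightarrow> ('x \<Rightarrow>\<^sub>0 'k::field) \<Rightarrow> ('y \<Rightarrow>\<^sub>0 'k)" where
  "matrix_apply S X Y v = (\<Sum>x\<in>X. \<Sum>y\<in>Y. monom y (coeff v x * S x y))"

lemma matrix_apply_add: "matrix_apply S X Y (v + w) = matrix_apply S X Y v + matrix_apply S X Y w"
  by (simp add: matrix_apply_def lookup_add distrib_right single_add sum.distrib)

lemma matrix_apply_zero: "matrix_apply S X Y 0 = 0"
  by (simp add: matrix_apply_def)

lemma matrix_apply_sum: "matrix_apply S X Y (\<Sum>i\<in>I. h i) = (\<Sum>i\<in>I. matrix_apply S X Y (h i))"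
  by (induction I rule: infinite_finite_induct) (auto simp: matrix_apply_add matrix_apply_zero)

lemma matrix_apply_monom:
  assumes "finite X" "x \<in> X"
  shows "matrix_apply S X Y (monom x c) = (\<Sum>y\<in>Y. monom y (c * S x y))"
proof -
  have "matrix_apply S X Y (monom x c)
      = (\<Sum>x'\<in>X. if x' = x then \<Sum>y\<in>Y. monom y (c * S x y) else 0)"
    unfolding matrix_apply_def by (intro sum.cong refl) (auto simp: lookup_single when_def)
  then show ?thesis using assms by simp
qed

lemma supp_matrix_apply: "supp (matrix_apply S X Y v) \<subseteq> Y"
  unfolding matrix_apply_def by (intro supp_sum_subset) auto

lemma matrix_apply_hom:
  assumes "perm_action l r P Q e X" "perm_action l r P Q e Y"
    and S: "\<And>p x y. p \<in> P \<Longrightarrow> x \<in> X \<Longrightarrow> y \<in> Y \<Longrightarrow> S (l p x) (l p y) = S x y"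
      "\<And>p x y. p \<in> Q \<Longrightarrow> x \<in> X \<Longrightarrow> y \<in> Y \<Longrightarrow> S (r x p) (r y p) = S x y"
  shows "matrix_apply S X Y \<in> bimod_hom (supported P) (supported Q) (perm_bimod l r X) (perm_bimod l r Y)"
proof (rule bimod_homI)
  interpret X: perm_action l r P Q e X by fact
  interpret Y: perm_action l r P Q e Y by fact
  fix v :: "'b \<Rightarrow>\<^sub>0 'c" assume "v \<in> carrier (perm_bimod l r X)"
  then have v: "supp v \<subseteq> X" by simp
  show "matrix_apply S X Y v \<in> carrier (perm_bimod l r Y)" by (simp add: supp_matrix_apply)
  show "matrix_apply S X Y (lact (perm_bimod l r X) a v) = lact (perm_bimod l r Y) a (matrix_apply S X Y v)"
    if a: "a \<in> supported P" for a
  proof -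
    have a: "supp a \<subseteq> P" using a by simp
    have "matrix_apply S X Y (bilinear_ext l a v) = bilinear_ext l a (matrix_apply S X Y v)"
      using a
    proof (induction rule: poly_mapping_supp_induct)
      case (monom p c)
      note p = this
      show ?case using v
      proof (induction rule: poly_mapping_supp_induct)
        case (monom x d)
        have "matrix_apply S X Y (bilinear_ext l (monom p c) (monom x d)) = (\<Sum>y\<in>Y. monom y (c * d * S (l p x) y))"
          using p monom by (simp add: matrix_apply_monom X.finite_X X.l_closed)
        \<comment> \<open>Translating the summation index by \<open>l p\<close> brings the entries
          into the form in which \<open>S\<close> is invariant.\<close>
        also have "\<dots> = (\<Sum>y\<in>Y. monom (l p y) (c * d * S (l p x) (l p y)))"
          using Y.l_bij[OF p] by (rule sum.reindex_bij_betw[symmetric])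
        also have "\<dots> = (\<Sum>y\<in>Y. monom (l p y) (c * (d * S x y)))"
          using p monom by (intro sum.cong refl) (simp add: S mult.assoc)
        also have "\<dots> = bilinear_ext l (monom p c) (matrix_apply S X Y (monom x d))"
          using monom by (simp add: matrix_apply_monom X.finite_X bilinear_ext_sum_right)
        finally show ?case .
      qed (simp_all add: matrix_apply_zero matrix_apply_add bilinear_ext_add_right)
    qed (simp_all add: matrix_apply_zero matrix_apply_add bilinear_ext_add_left)
    then show ?thesis by simp
  qed
  show "matrix_apply S X Y (ract (perm_bimod l r X) v a) = ract (perm_bimod l r Y) (matrix_apply S X Y v) a"
    if a: "a \<in> supported Q" for a
  proof -
    have a: "supp a \<subseteq> Q" using a by simp
    have "matrix_apply S X Y (bilinear_ext r v a) = bilinear_ext r (matrix_apply S X Y v) a"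
      using a
    proof (induction rule: poly_mapping_supp_induct)
      case (monom p c)
      note p = this
      show ?case using v
      proof (induction rule: poly_mapping_supp_induct)
        case (monom x d)
        have "matrix_apply S X Y (bilinear_ext r (monom x d) (monom p c)) = (\<Sum>y\<in>Y. monom y (d * c * S (r x p) y))"
          using p monom by (simp add: matrix_apply_monom X.finite_X X.r_closed)
        also have "\<dots> = (\<Sum>y\<in>Y. monom (r y p) (d * c * S (r x p) (r y p)))"
          using Y.r_bij[OF p] by (rule sum.reindex_bij_betw[symmetric])
        also have "\<dots> = (\<Sum>y\<in>Y. monom (r y p) (d * S x y * c))"
          using p monom by (intro sum.cong refl) (simp add: S mult_ac)
        also have "\<dots> = bilinear_ext r (matrix_apply S X Y (monom x d)) (monom p c)"
          using monom by (simp add: matrix_apply_monom X.finite_X bilinear_ext_sum_left)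
        finally show ?case .
      qed (simp_all add: matrix_apply_zero matrix_apply_add bilinear_ext_add_left)
    qed (simp_all add: matrix_apply_zero matrix_apply_add bilinear_ext_add_right)
    then show ?thesis by simp
  qed
qed (simp add: matrix_apply_add)

text \<open>Linearity over \<open>k\<close> is equivariance under the elements
  \<open>monom e c\<close>. Invariance of the matrix is read off by comparing coefficients at a
  translate of \<open>y\<close> in the image of the same translate of \<open>x\<close>.\<close>

lemma hom_matrix:
  assumes "perm_action l r P Q e X" "perm_action l r P Q e Y"
    and f: "f \<in> bimod_hom (supported P) (supported Q) (perm_bimod l r X) (perm_bimod l r Y :: ('g \<Rightarrow>\<^sub>0 'k::field, _) bimod)"
    and x: "x \<in> X"
  shows "f (monom x c) = (\<Sum>y\<in>Y. monom y (c * coeff (f (monom x 1)) y))"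
    and "p \<in> P \<Longrightarrow> y \<in> Y \<Longrightarrow> coeff (f (monom (l p x) 1)) (l p y) = coeff (f (monom x 1)) y"
    and "p \<in> Q \<Longrightarrow> y \<in> Y \<Longrightarrow> coeff (f (monom (r x p) 1)) (r y p) = coeff (f (monom x 1)) y"
proof -
  interpret X: perm_action l r P Q e X by fact
  interpret Y: perm_action l r P Q e Y by fact
  have s: "supp (f (monom x c)) \<subseteq> Y" for c using bimod_homD(1)[OF f, of "monom x c"] x by simp
  have lin: "f (bilinear_ext l (monom p c) (monom x 1)) = bilinear_ext l (monom p c) (f (monom x 1))" if "p \<in> P" for p c
    using bimod_homD(3)[OF f, of "monom x 1" "monom p c"] x that by simp
  have rin: "f (bilinear_ext r (monom x 1) (monom p c)) = bilinear_ext r (f (monom x 1)) (monom p c)" if "p \<in> Q" for p c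
    using bimod_homD(4)[OF f, of "monom x 1" "monom p c"] x that by simp
  have "coeff (f (monom x c)) y = c * coeff (f (monom x 1)) y" if "y \<in> Y" for y
    using lin[OF X.e_in(1), of c] coeff_bilinear_ext_left_inj[where l = l and p = e, OF Y.l_inj[OF Y.e_in(1)] s[of 1] that, of c] x that
    by (simp add: X.l_e Y.l_e)
  then show "f (monom x c) = (\<Sum>y\<in>Y. monom y (c * coeff (f (monom x 1)) y))"
    using poly_mapping_expand[OF Y.finite_X s, of c] by simp
  show "coeff (f (monom (l p x) 1)) (l p y) = coeff (f (monom x 1)) y" if "p \<in> P" "y \<in> Y"
    using lin[OF that(1), of 1] coeff_bilinear_ext_left_inj[where l = l and p = p, OF Y.l_inj[OF that(1)] s[of 1] that(2), of 1] by simp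
  show "coeff (f (monom (r x p) 1)) (r y p) = coeff (f (monom x 1)) y" if "p \<in> Q" "y \<in> Y"
    using rin[OF that(1), of 1] coeff_bilinear_ext_right_inj[where r = r and p = p, OF Y.r_inj[OF that(1)] s[of 1] that(2), of 1] by simp
qed

text \<open>Equivariant maps correspond to invariant matrices, and the composites to the products of
  \<open>S i\<close> and \<open>T i\<close>. The two one-sided invariances are merged into one over
  \<open>P \<times> Q\<close> and recovered from it by pairing with \<open>e\<close>.\<close>

lemma retract_perm_bimod_iff:
  fixes X Y :: "'x set"
  assumes X: "perm_action l r P Q e X" and Y: "perm_action l r P Q e Y"
  defines "\<alpha> \<equiv> \<lambda>c x. l (fst c) (r x (snd c))"
  shows "retract_of_multiple (supported P) (supported Q) (perm_bimod l r X)
      (perm_bimod l r Y :: ('g \<Rightarrow>\<^sub>0 'k::field, 'x \<Rightarrow>\<^sub>0 'k) bimod) \<longleftrightarrow>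
    matrix_retract TYPE('k) (P \<times> Q) \<alpha> \<alpha> X Y"
proof
  interpret X: perm_action l r P Q e X by fact
  interpret Y: perm_action l r P Q e Y by fact
  let ?X = "perm_bimod l r X :: ('g \<Rightarrow>\<^sub>0 'k, 'x \<Rightarrow>\<^sub>0 'k) bimod"
  let ?Y = "perm_bimod l r Y :: ('g \<Rightarrow>\<^sub>0 'k, 'x \<Rightarrow>\<^sub>0 'k) bimod"
  {
    assume "retract_of_multiple (supported P) (supported Q) ?X ?Y"
    then obtain q f g where q: "q \<ge> 1"
      and f: "\<And>i. i < q \<Longrightarrow> f i \<in> bimod_hom (supported P) (supported Q) ?X ?Y"
      and g: "\<And>i. i < q \<Longrightarrow> g i \<in> bimod_hom (supported P) (supported Q) ?Y ?X"
      and id: "\<And>v. v \<in> carrier ?X \<Longrightarrow> finprod ?X (\<lambda>i. g i (f i v)) {..<q::nat} = v"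
      unfolding retract_of_multiple_def by blast
    define S where "S i x y = coeff (f i (monom x 1)) y" for i x y
    define T where "T i y x = coeff (g i (monom y 1)) x" for i x y
    have "S i (\<alpha> c x) (\<alpha> c y) = S i x y \<and> T i (\<alpha> c y) (\<alpha> c x) = T i y x"
      if "i < q" "c \<in> P \<times> Q" "x \<in> X" "y \<in> Y" for i c x y
    proof -
      have c: "fst c \<in> P" "snd c \<in> Q" and m: "r x (snd c) \<in> X" "r y (snd c) \<in> Y"
        using that by (auto intro: X.r_closed Y.r_closed)
      show ?thesis
        unfolding S_def T_def \<alpha>_def
        using hom_matrix(2)[OF X Y f[OF that(1)] m(1) c(1) m(2)] hom_matrix(3)[OF X Y f[OF that(1)] that(3) c(2) that(4)]
          hom_matrix(2)[OF Y X g[OF that(1)] m(2) c(1) m(1)] hom_matrix(3)[OF Y X g[OF that(1)] that(4) c(2) that(3)]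
        by simp
    qed
    moreover have "(\<Sum>i<q. \<Sum>y\<in>Y. S i x y * T i y x') = of_bool (x = x')" if x: "x \<in> X" and x': "x' \<in> X" for x x'
    proof -
      have sg: "supp (g i (f i (monom x 1))) \<subseteq> X" if "i < q" for i
        using bimod_homD(1)[OF g[OF that] bimod_homD(1)[OF f[OF that]], of "monom x 1"] x by simp
      have gf: "coeff (g i (f i (monom x 1))) x' = (\<Sum>y\<in>Y. S i x y * T i y x')" if i: "i < q" for i
      proof -
        have "g i (f i (monom x 1)) = g i (\<Sum>y\<in>Y. monom y (S i x y))"
          using hom_matrix(1)[OF X Y f[OF i] x, of 1] by (simp add: S_def)
        also have "\<dots> = (\<Sum>y\<in>Y. g i (monom y (S i x y)))"
          by (rule bimod_hom_sum[OF g[OF i]]) auto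
        also have "\<dots> = (\<Sum>y\<in>Y. \<Sum>z\<in>X. monom z (S i x y * T i y z))"
          by (intro sum.cong refl) (simp add: hom_matrix(1)[OF Y X g[OF i], of _ "S i x _"] T_def)
        finally have "coeff (g i (f i (monom x 1))) x' = (\<Sum>y\<in>Y. \<Sum>z\<in>X. S i x y * T i y z when z = x')"
          by (simp add: lookup_sum lookup_single)
        then show ?thesis using X.finite_X x' by (simp add: when_def)
      qed
      have "(\<Sum>i<q. \<Sum>y\<in>Y. S i x y * T i y x') = coeff (\<Sum>i<q. g i (f i (monom x 1))) x'"
        by (simp add: lookup_sum gf)
      also have "(\<Sum>i<q. g i (f i (monom x 1))) = monom x 1"
        using id[of "monom x 1"] finprod_perm_bimod[of "{..<q}" "\<lambda>i. g i (f i (monom x 1))" X l r] sg x by simp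
      finally show ?thesis by (simp add: lookup_single when_def)
    qed
    ultimately show "matrix_retract TYPE('k) (P \<times> Q) \<alpha> \<alpha> X Y"
      unfolding matrix_retract_def using q by (intro exI[of _ q] conjI exI[of _ S] exI[of _ T]) auto
  next
    assume "matrix_retract TYPE('k) (P \<times> Q) \<alpha> \<alpha> X Y"
    then obtain q and S :: "nat \<Rightarrow> 'x \<Rightarrow> 'x \<Rightarrow> 'k" and T where q: "q \<ge> 1"
      and inv: "\<And>i c x y. i < q \<Longrightarrow> c \<in> P \<times> Q \<Longrightarrow> x \<in> X \<Longrightarrow> y \<in> Y \<Longrightarrow>
        S i (\<alpha> c x) (\<alpha> c y) = S i x y \<and> T i (\<alpha> c y) (\<alpha> c x) = T i y x"
      and id: "\<And>x x'. x \<in> X \<Longrightarrow> x' \<in> X \<Longrightarrow> (\<Sum>i<q. \<Sum>y\<in>Y. S i x y * T i y x') = of_bool (x = x')"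
      unfolding matrix_retract_def by blast
    have invl: "S i (l p x) (l p y) = S i x y" "T i (l p y) (l p x) = T i y x"
      if "i < q" "p \<in> P" "x \<in> X" "y \<in> Y" for i p x y
      using inv[of i "(p, e)" x y] that by (simp_all add: \<alpha>_def X.r_e Y.r_e X.e_in)
    have invr: "S i (r x p) (r y p) = S i x y" "T i (r y p) (r x p) = T i y x"
      if "i < q" "p \<in> Q" "x \<in> X" "y \<in> Y" for i p x y
      using inv[of i "(e, p)" x y] that by (simp_all add: \<alpha>_def X.l_e Y.l_e X.e_in X.r_closed Y.r_closed)
    have f: "matrix_apply (S i) X Y \<in> bimod_hom (supported P) (supported Q) ?X ?Y"
      and g: "matrix_apply (T i) Y X \<in> bimod_hom (supported P) (supported Q) ?Y ?X" if "i < q" for i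
      using that by (auto intro!: matrix_apply_hom[OF X Y] matrix_apply_hom[OF Y X] invl invr)
    have "(\<Sum>i<q. matrix_apply (T i) Y X (matrix_apply (S i) X Y v)) = v" if "supp v \<subseteq> X" for v
      using that
    proof (induction rule: poly_mapping_supp_induct)
      case (monom x c)
      have "(\<Sum>i<q. matrix_apply (T i) Y X (matrix_apply (S i) X Y (monom x c)))
          = (\<Sum>i<q. \<Sum>y\<in>Y. \<Sum>z\<in>X. monom z (c * S i x y * T i y z))"
        using monom by (simp add: matrix_apply_monom X.finite_X Y.finite_X matrix_apply_sum)
      also have "\<dots> = (\<Sum>i<q. \<Sum>z\<in>X. \<Sum>y\<in>Y. monom z (c * S i x y * T i y z))"
        by (intro sum.cong refl sum.swap)
      also have "\<dots> = (\<Sum>z\<in>X. \<Sum>i<q. \<Sum>y\<in>Y. monom z (c * S i x y * T i y z))"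
        by (rule sum.swap)
      also have "\<dots> = (\<Sum>z\<in>X. monom z (c * (\<Sum>i<q. \<Sum>y\<in>Y. S i x y * T i y z)))"
        by (intro sum.cong refl poly_mapping_eqI)
          (auto simp: lookup_sum lookup_single when_def sum_distrib_left mult.assoc)
      also have "\<dots> = (\<Sum>z\<in>X. if z = x then monom x c else 0)"
        using monom by (intro sum.cong refl) (simp add: id)
      also have "\<dots> = monom x c" using monom X.finite_X by simp
      finally show ?case .
    qed (simp_all add: matrix_apply_zero matrix_apply_add sum.distrib)
    then have "finprod ?X (\<lambda>i. matrix_apply (T i) Y X (matrix_apply (S i) X Y v)) {..<q} = v" if "v \<in> carrier ?X" for v
      using that finprod_perm_bimod[of "{..<q}" "\<lambda>i. matrix_apply (T i) Y X (matrix_apply (S i) X Y v)" X l r]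
      by (simp add: supp_matrix_apply)
    then show "retract_of_multiple (supported P) (supported Q) ?X ?Y"
      unfolding retract_of_multiple_def using q f g
      by (intro exI[of _ q] conjI exI[of _ "\<lambda>i. matrix_apply (S i) X Y"] exI[of _ "\<lambda>i. matrix_apply (T i) Y X"]) auto
  }
qed

section \<open>Quotients and products of systems of invariant matrices\<close>

lemma bij_betw_fibre:
  assumes f: "bij_betw f Y Y" and s: "\<And>y. y \<in> Y \<Longrightarrow> s (f y) = b \<longleftrightarrow> s y = a"
  shows "bij_betw f {y \<in> Y. s y = a} {y \<in> Y. s y = b}"
proof (rule bij_betw_subset[OF f])
  show "f ` {y \<in> Y. s y = a} = {y \<in> Y. s y = b}"
  proof (intro equalityI subsetI)
    fix y assume "y \<in> {y \<in> Y. s y = b}"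
    moreover from this obtain z where "z \<in> Y" "y = f z" using f by (auto simp: bij_betw_def)
    ultimately show "y \<in> f ` {y \<in> Y. s y = a}" using s by auto
  qed (use f s in \<open>auto simp: bij_betw_def\<close>)
qed auto

text \<open>
  The matrices on the quotients are obtained by summing entries over fibres. As the group is
  transitive on the fibres of \<open>p\<close> and preserves those of \<open>s\<close>, the sum does not depend on the row
  chosen.
\<close>

lemma matrix_retract_quotient:
  fixes X :: "'x set" and Y :: "'y set"
  assumes fin: "finite X" "finite Y"
    and p: "p ` X = X'" and s: "s ` Y = Y'"
    and equi: "\<And>c'. c' \<in> \<Gamma>' \<Longrightarrow> \<exists>c\<in>\<Gamma>. (\<forall>x\<in>X. p (\<alpha> c x) = \<alpha>' c' (p x)) \<and> (\<forall>y\<in>Y. s (\<beta> c y) = \<beta>' c' (s y))"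
    and bij: "\<And>c. c \<in> \<Gamma> \<Longrightarrow> bij_betw (\<alpha> c) X X \<and> bij_betw (\<beta> c) Y Y"
    and fib_p: "\<And>x x'. x \<in> X \<Longrightarrow> x' \<in> X \<Longrightarrow> p x = p x' \<Longrightarrow> \<exists>c\<in>\<Gamma>. x' = \<alpha> c x \<and> (\<forall>y\<in>Y. s (\<beta> c y) = s y)"
    and fib_s: "\<And>y y'. y \<in> Y \<Longrightarrow> y' \<in> Y \<Longrightarrow> s y = s y' \<Longrightarrow> \<exists>c\<in>\<Gamma>. y' = \<beta> c y \<and> (\<forall>x\<in>X. p (\<alpha> c x) = p x)"
    and ret: "matrix_retract TYPE('k::field) \<Gamma> \<alpha> \<beta> X Y"
  shows "matrix_retract TYPE('k) \<Gamma>' \<alpha>' \<beta>' X' Y'"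
proof -
  obtain q and S :: "nat \<Rightarrow> 'x \<Rightarrow> 'y \<Rightarrow> 'k" and T where q: "q \<ge> 1"
    and inv: "\<And>i c x y. i < q \<Longrightarrow> c \<in> \<Gamma> \<Longrightarrow> x \<in> X \<Longrightarrow> y \<in> Y \<Longrightarrow>
      S i (\<alpha> c x) (\<beta> c y) = S i x y \<and> T i (\<beta> c y) (\<alpha> c x) = T i y x"
    and id: "\<And>x x'. x \<in> X \<Longrightarrow> x' \<in> X \<Longrightarrow> (\<Sum>i<q. \<Sum>y\<in>Y. S i x y * T i y x') = of_bool (x = x')"
    using ret unfolding matrix_retract_def by blast
  define rx where "rx = inv_into X p"
  define ry where "ry = inv_into Y s"
  define S' where "S' i x' y' = (\<Sum>y | y \<in> Y \<and> s y = y'. S i (rx x') y)" for i x' y'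
  define T' where "T' i y' x' = (\<Sum>x | x \<in> X \<and> p x = x'. T i (ry y') x)" for i x' y'
  have rx: "rx x' \<in> X" "p (rx x') = x'" if "x' \<in> X'" for x'
    using that p by (auto simp: rx_def inv_into_into f_inv_into_f)
  have ry: "ry y' \<in> Y" "s (ry y') = y'" if "y' \<in> Y'" for y'
    using that s by (auto simp: ry_def inv_into_into f_inv_into_f)
  have Sc: "(\<Sum>y | y \<in> Y \<and> s y = y1. S i x1 y) = (\<Sum>y | y \<in> Y \<and> s y = y2. S i x2 y)"
    if "i < q" "c \<in> \<Gamma>" "x1 \<in> X" "x2 = \<alpha> c x1" "\<And>y. y \<in> Y \<Longrightarrow> s (\<beta> c y) = y2 \<longleftrightarrow> s y = y1" for i c x1 x2 y1 y2
  proof -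
    have "bij_betw (\<beta> c) {y \<in> Y. s y = y1} {y \<in> Y. s y = y2}"
      using bij[OF that(2)] that(5) by (intro bij_betw_fibre) auto
    from sum.reindex_bij_betw[OF this, of "S i x2"]
    have "(\<Sum>y | y \<in> Y \<and> s y = y2. S i x2 y) = (\<Sum>y | y \<in> Y \<and> s y = y1. S i x2 (\<beta> c y))" by simp
    also have "\<dots> = (\<Sum>y | y \<in> Y \<and> s y = y1. S i x1 y)"
      using inv that by (intro sum.cong refl) simp
    finally show ?thesis by simp
  qed
  have Tc: "(\<Sum>x | x \<in> X \<and> p x = x1. T i y1 x) = (\<Sum>x | x \<in> X \<and> p x = x2. T i y2 x)"
    if "i < q" "c \<in> \<Gamma>" "y1 \<in> Y" "y2 = \<beta> c y1" "\<And>x. x \<in> X \<Longrightarrow> p (\<alpha> c x) = x2 \<longleftrightarrow> p x = x1" for i c x1 x2 y1 y2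
  proof -
    have "bij_betw (\<alpha> c) {x \<in> X. p x = x1} {x \<in> X. p x = x2}"
      using bij[OF that(2)] that(5) by (intro bij_betw_fibre) auto
    from sum.reindex_bij_betw[OF this, of "T i y2"]
    have "(\<Sum>x | x \<in> X \<and> p x = x2. T i y2 x) = (\<Sum>x | x \<in> X \<and> p x = x1. T i y2 (\<alpha> c x))" by simp
    also have "\<dots> = (\<Sum>x | x \<in> X \<and> p x = x1. T i y1 x)"
      using inv that by (intro sum.cong refl) simp
    finally show ?thesis by simp
  qed
  have S': "S' i (p x) y' = (\<Sum>y | y \<in> Y \<and> s y = y'. S i x y)" if i: "i < q" and x: "x \<in> X" for i x y'
  proof -
    have "rx (p x) \<in> X" "p (rx (p x)) = p x" using rx[of "p x"] x p by auto
    then obtain c where "c \<in> \<Gamma>" "x = \<alpha> c (rx (p x))" "\<forall>y\<in>Y. s (\<beta> c y) = s y"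
      using fib_p[of "rx (p x)" x] x by auto
    then show ?thesis unfolding S'_def
      using i \<open>rx (p x) \<in> X\<close> by (intro Sc[of _ c]) auto
  qed
  have T': "T' i (s y) x' = (\<Sum>x | x \<in> X \<and> p x = x'. T i y x)" if i: "i < q" and y: "y \<in> Y" for i x' y
  proof -
    have "ry (s y) \<in> Y" "s (ry (s y)) = s y" using ry[of "s y"] y s by auto
    then obtain c where "c \<in> \<Gamma>" "y = \<beta> c (ry (s y))" "\<forall>x\<in>X. p (\<alpha> c x) = p x"
      using fib_s[of "ry (s y)" y] y by auto
    then show ?thesis unfolding T'_def
      using i \<open>ry (s y) \<in> Y\<close> by (intro Tc[of _ c]) auto
  qed
  have inv': "S' i (\<alpha>' c' x') (\<beta>' c' y') = S' i x' y' \<and> T' i (\<beta>' c' y') (\<alpha>' c' x') = T' i y' x'"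
    if i: "i < q" and c': "c' \<in> \<Gamma>'" and x': "x' \<in> X'" and y': "y' \<in> Y'" for i c' x' y'
  proof -
    obtain c where c: "c \<in> \<Gamma>" "\<And>x. x \<in> X \<Longrightarrow> p (\<alpha> c x) = \<alpha>' c' (p x)" "\<And>y. y \<in> Y \<Longrightarrow> s (\<beta> c y) = \<beta>' c' (s y)"
      using equi[OF c'] by blast
    have m: "\<alpha> c x \<in> X" if "x \<in> X" for x using bij[OF c(1)] that by (auto simp: bij_betw_def)
    have n: "\<beta> c y \<in> Y" if "y \<in> Y" for y using bij[OF c(1)] that by (auto simp: bij_betw_def)
    obtain x where x: "x \<in> X" "x' = p x" using x' p by auto
    obtain y where y: "y \<in> Y" "y' = s y" using y' s by auto
    have finX': "finite X'" "finite Y'" using fin p s by auto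
    \<comment> \<open>A surjection of a finite set onto itself is injective. Injectivity ensures
      that \<open>\<alpha> c\<close> maps exactly the fibre over \<open>x'\<close> onto the fibre
      over \<open>\<alpha>' c' x'\<close>.\<close>
    have "\<alpha>' c' ` X' = X'"
    proof -
      have "\<alpha>' c' ` X' = p ` \<alpha> c ` X" using p c(2) by (force simp: image_image)
      then show ?thesis using bij[OF c(1)] p by (simp add: bij_betw_def)
    qed
    then have injX: "inj_on (\<alpha>' c') X'" using finX' by (simp add: eq_card_imp_inj_on)
    have "\<beta>' c' ` Y' = Y'"
    proof -
      have "\<beta>' c' ` Y' = s ` \<beta> c ` Y" using s c(3) by (force simp: image_image)
      then show ?thesis using bij[OF c(1)] s by (simp add: bij_betw_def)
    qed
    then have injY: "inj_on (\<beta>' c') Y'" using finX' by (simp add: eq_card_imp_inj_on)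
    have "S' i (p (\<alpha> c x)) (\<beta>' c' y') = S' i (p x) y'"
      unfolding S'[OF i m[OF x(1)]] S'[OF i x(1)]
      by (rule Sc[OF i c(1) x(1) refl, symmetric]) (use injY y' s in \<open>auto simp: c inj_on_def\<close>)
    moreover have "T' i (s (\<beta> c y)) (\<alpha>' c' x') = T' i (s y) x'"
      unfolding T'[OF i n[OF y(1)]] T'[OF i y(1)]
      by (rule Tc[OF i c(1) y(1) refl, symmetric]) (use injX x' p in \<open>auto simp: c inj_on_def\<close>)
    ultimately show ?thesis using x y c by simp
  qed
  have id': "(\<Sum>i<q. \<Sum>y'\<in>Y'. S' i x1 y' * T' i y' x2) = of_bool (x1 = x2)" if x1: "x1 \<in> X'" and x2: "x2 \<in> X'" for x1 x2
  proof -
    obtain x where x: "x \<in> X" "x1 = p x" using x1 p by auto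
    have "(\<Sum>y'\<in>Y'. S' i x1 y' * T' i y' x2) = (\<Sum>z | z \<in> X \<and> p z = x2. \<Sum>y\<in>Y. S i x y * T i y z)" if i: "i < q" for i
    proof -
      \<comment> \<open>In each term the row of \<open>T'\<close> over \<open>y'\<close> is
        represented by the current element \<open>y\<close> of the fibre. The sum over
        \<open>Y'\<close> thereby becomes a sum over all of \<open>Y\<close>, to which the original
        identity applies.\<close>
      have "(\<Sum>y'\<in>Y'. S' i x1 y' * T' i y' x2) = (\<Sum>y'\<in>Y'. \<Sum>y | y \<in> Y \<and> s y = y'. S i x y * T' i (s y) x2)"
        using i x by (intro sum.cong refl) (simp add: S' sum_distrib_right)
      also have "\<dots> = (\<Sum>y\<in>Y. S i x y * T' i (s y) x2)"
        using fin s by (intro sum.group) auto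
      also have "\<dots> = (\<Sum>y\<in>Y. \<Sum>z | z \<in> X \<and> p z = x2. S i x y * T i y z)"
        using i by (intro sum.cong refl) (simp add: T' sum_distrib_left)
      also have "\<dots> = (\<Sum>z | z \<in> X \<and> p z = x2. \<Sum>y\<in>Y. S i x y * T i y z)" by (rule sum.swap)
      finally show ?thesis .
    qed
    then have "(\<Sum>i<q. \<Sum>y'\<in>Y'. S' i x1 y' * T' i y' x2)
        = (\<Sum>i<q. \<Sum>z | z \<in> X \<and> p z = x2. \<Sum>y\<in>Y. S i x y * T i y z)"
      by (intro sum.cong refl) simp
    also have "\<dots> = (\<Sum>z | z \<in> X \<and> p z = x2. \<Sum>i<q. \<Sum>y\<in>Y. S i x y * T i y z)"
      by (rule sum.swap)
    \<comment> \<open>Only \<open>z = x\<close> contributes, and it lies in the fibre over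
      \<open>x2\<close> exactly when \<open>x1 = x2\<close>.\<close>
    also have "\<dots> = (\<Sum>z | z \<in> X \<and> p z = x2. if z = x then 1 else 0)"
      using id x by (intro sum.cong refl) auto
    also have "\<dots> = of_bool (x1 = x2)"
      using fin x by (simp add: sum.delta)
    finally show ?thesis .
  qed
  show ?thesis
    unfolding matrix_retract_def using q inv' id'
    by (intro exI[of _ q] conjI exI[of _ S'] exI[of _ T']) auto
qed

text \<open>The new matrices are the old ones tensored with the identity matrix on \<open>Z\<close>.
  This identity stays invariant as soon as equality of the \<open>Z\<close>-coordinates
  \<open>u x\<close> and \<open>v y\<close> is preserved, whatever the action does to these
  coordinates.\<close>

lemma matrix_retract_product:
  fixes X :: "'x set" and Y :: "'y set"
  assumes fin: "finite Y'"
    and p: "bij_betw (\<lambda>x. (p x, u x)) X' (X \<times> Z)" and s: "bij_betw (\<lambda>y. (s y, v y)) Y' (Y \<times> Z)"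
    and equi: "\<And>c'. c' \<in> \<Gamma>' \<Longrightarrow> \<exists>c\<in>\<Gamma>. (\<forall>x\<in>X'. p (\<alpha>' c' x) = \<alpha> c (p x)) \<and> (\<forall>y\<in>Y'. s (\<beta>' c' y) = \<beta> c (s y))"
    and uv: "\<And>c' x y. c' \<in> \<Gamma>' \<Longrightarrow> x \<in> X' \<Longrightarrow> y \<in> Y' \<Longrightarrow> u (\<alpha>' c' x) = v (\<beta>' c' y) \<longleftrightarrow> u x = v y"
    and ret: "matrix_retract TYPE('k::field) \<Gamma> \<alpha> \<beta> X Y"
  shows "matrix_retract TYPE('k) \<Gamma>' \<alpha>' \<beta>' X' Y'"
proof -
  obtain q and S :: "nat \<Rightarrow> 'x \<Rightarrow> 'y \<Rightarrow> 'k" and T where q: "q \<ge> 1"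
    and inv: "\<And>i c x y. i < q \<Longrightarrow> c \<in> \<Gamma> \<Longrightarrow> x \<in> X \<Longrightarrow> y \<in> Y \<Longrightarrow>
      S i (\<alpha> c x) (\<beta> c y) = S i x y \<and> T i (\<beta> c y) (\<alpha> c x) = T i y x"
    and id: "\<And>x x'. x \<in> X \<Longrightarrow> x' \<in> X \<Longrightarrow> (\<Sum>i<q. \<Sum>y\<in>Y. S i x y * T i y x') = of_bool (x = x')"
    using ret unfolding matrix_retract_def by blast
  have pX: "p x \<in> X" "u x \<in> Z" if "x \<in> X'" for x using p that by (auto simp: bij_betw_def)
  have sY: "s y \<in> Y" "v y \<in> Z" if "y \<in> Y'" for y using s that by (auto simp: bij_betw_def)
  define S' where "S' i x y = (if u x = v y then S i (p x) (s y) else 0)" for i x y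
  define T' where "T' i y x = (if u x = v y then T i (s y) (p x) else 0)" for i x y
  have inv': "S' i (\<alpha>' c' x) (\<beta>' c' y) = S' i x y \<and> T' i (\<beta>' c' y) (\<alpha>' c' x) = T' i y x"
    if i: "i < q" and c': "c' \<in> \<Gamma>'" and x: "x \<in> X'" and y: "y \<in> Y'" for i c' x y
  proof -
    obtain c where c: "c \<in> \<Gamma>" "\<And>x. x \<in> X' \<Longrightarrow> p (\<alpha>' c' x) = \<alpha> c (p x)" "\<And>y. y \<in> Y' \<Longrightarrow> s (\<beta>' c' y) = \<beta> c (s y)"
      using equi[OF c'] by blast
    show ?thesis
      using inv[OF i c(1) pX(1)[OF x] sY(1)[OF y]] uv[OF c' x y] x y
      by (simp add: S'_def T'_def c)
  qed
  have id': "(\<Sum>i<q. \<Sum>y\<in>Y'. S' i x y * T' i y x') = of_bool (x = x')" if x: "x \<in> X'" "x' \<in> X'" for x x'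
  proof -
    have "(\<Sum>y\<in>Y'. S' i x y * T' i y x') = (if u x = u x' then \<Sum>y\<in>Y. S i (p x) y * T i y (p x') else 0)" for i
    proof -
      let ?h = "\<lambda>a. if u x = snd a \<and> u x' = snd a then S i (p x) (fst a) * T i (fst a) (p x') else 0"
      have fYZ: "finite (Y \<times> Z)" using s fin bij_betw_finite by blast
      have "(\<Sum>y\<in>Y'. S' i x y * T' i y x') = (\<Sum>y\<in>Y'. ?h (s y, v y))"
        by (intro sum.cong refl) (auto simp: S'_def T'_def)
      also have "\<dots> = (\<Sum>a\<in>Y \<times> Z. ?h a)" by (rule sum.reindex_bij_betw[OF s])
      also have "\<dots> = (if u x = u x' then \<Sum>y\<in>Y. S i (p x) y * T i y (p x') else 0)"
      proof (cases "u x = u x'")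
        case True
        have "(\<Sum>a\<in>Y \<times> Z. ?h a) = (\<Sum>a\<in>Y \<times> {u x}. ?h a)"
          using fYZ pX(2)[OF x(1)] by (intro sum.mono_neutral_right) auto
        also have "Y \<times> {u x} = (\<lambda>y. (y, u x)) ` Y" by auto
        also have "(\<Sum>a\<in>(\<lambda>y. (y, u x)) ` Y. ?h a) = (\<Sum>y\<in>Y. S i (p x) y * T i y (p x'))"
          using True by (simp add: sum.reindex inj_on_def)
        finally show ?thesis using True by simp
      next
        case False
        then show ?thesis by (auto intro!: sum.neutral)
      qed
      finally show ?thesis .
    qed
    then have "(\<Sum>i<q. \<Sum>y\<in>Y'. S' i x y * T' i y x') = (if u x = u x' then of_bool (p x = p x') else 0)"
      using id[OF pX(1)[OF x(1)] pX(1)[OF x(2)]] by simp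
    also have "\<dots> = of_bool (x = x')"
      using p x by (auto simp: bij_betw_def inj_on_def)
    finally show ?thesis .
  qed
  show ?thesis
    unfolding matrix_retract_def using q inv' id'
    by (intro exI[of _ q] conjI exI[of _ S'] exI[of _ T']) auto
qed


section \<open>Depth in terms of tuples of cosets\<close>


definition biact :: "('g, 'z) monoid_scheme \<Rightarrow> 'g \<times> 'g \<Rightarrow> 'g set list \<times> 'g \<Rightarrow> 'g set list \<times> 'g" where
  "biact G c x = lmul G (fst c) (rmul G x (snd c))"

definition point_retract ::
    "'k::field itself \<Rightarrow> ('g, 'z) monoid_scheme \<Rightarrow> 'g set \<Rightarrow> 'g set \<Rightarrow> 'g set \<Rightarrow> nat \<Rightarrow> nat \<Rightarrow> bool" where
  "point_retract k G H P Q m n \<longleftrightarrow>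
     matrix_retract k (P \<times> Q) (biact G) (biact G) (points G H m) (points G H n)"

definition coset_tuples :: "('g, 'z) monoid_scheme \<Rightarrow> 'g set \<Rightarrow> nat \<Rightarrow> 'g set list set" where
  "coset_tuples G H n = {cs. set cs \<subseteq> left_cosets G H \<and> length cs = n}"

definition coset_retract ::
    "'k::field itself \<Rightarrow> ('g, 'z) monoid_scheme \<Rightarrow> 'g set \<Rightarrow> nat \<Rightarrow> nat \<Rightarrow> bool" where
  "coset_retract k G H m n \<longleftrightarrow>
     matrix_retract k H (\<lambda>g. map (\<lambda>c. g <#\<^bsub>G\<^esub> c)) (\<lambda>g. map (\<lambda>c. g <#\<^bsub>G\<^esub> c))
       (coset_tuples G H m) (coset_tuples G H n)"

context finite_pair
begin

text \<open>The alternative in the hypothesis on \<open>n\<close> reflects that the zeroth power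
  \<open>k H\<close> is only an \<open>H\<close>-\<open>H\<close>-bimodule.\<close>

lemma perm_action_points:
  assumes P: "subgroup P G" and Q: "subgroup Q G" and n: "n > 0 \<or> P = H \<and> Q = H"
  shows "perm_action (lmul G) (rmul G) P Q \<one> (points G H n)"
proof -
  have PG: "p \<in> carrier G" if "p \<in> P" for p using subgroup.mem_carrier[OF P that] .
  have QG: "p \<in> carrier G" if "p \<in> Q" for p using subgroup.mem_carrier[OF Q that] .
  show ?thesis
  proof
    show "inj_on (lmul G p) (points G H n)" if "p \<in> P" for p
      by (rule inj_on_inverseI[of _ "lmul G (inv p)"]) (simp add: lmul_lmul[of _ n] lmul_one[of _ n] PG that)
    show "inj_on (\<lambda>x. rmul G x p) (points G H n)" if "p \<in> Q" for p
      by (rule inj_on_inverseI[of _ "\<lambda>x. rmul G x (inv p)"])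
        (simp add: rmul_rmul[of _ n] rmul_one[of _ n] QG that)
  qed (use n PG QG subgroup.one_closed[OF P] subgroup.one_closed[OF Q] in
      \<open>auto simp: finite_points lmul_one rmul_one intro!: lmul_points rmul_points\<close>)
qed

lemma biact_bij:
  assumes P: "subgroup P G" and Q: "subgroup Q G" and n: "n > 0 \<or> P = H \<and> Q = H"
    and c: "c \<in> P \<times> Q"
  shows "bij_betw (biact G c) (points G H n) (points G H n)"
proof -
  interpret perm_action "lmul G" "rmul G" P Q \<one> "points G H n"
    by (rule perm_action_points) fact+
  have "bij_betw (lmul G (fst c) \<circ> (\<lambda>x. rmul G x (snd c))) (points G H n) (points G H n)"
    by (rule bij_betw_trans[OF r_bij l_bij]) (use c in auto)
  then show ?thesis by (simp add: biact_def[abs_def] comp_def)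
qed

lemma supported_subgroup: "subgroup P G \<Longrightarrow> supported P \<subseteq> supported (carrier G)"
  using subgroup.subset by auto

lemma divides_tensor_power_iff:
  assumes P: "subgroup P G" and Q: "subgroup Q G" and "m > 0" "n > 0"
  shows "divides_multiple (supported P) (supported Q)
      (tensor_power (group_algebra G) (supported H) m)
      (tensor_power (group_algebra G) (supported H) n :: ('g \<Rightarrow>\<^sub>0 'k::field, _) bimod) \<longleftrightarrow>
    point_retract TYPE('k) G H P Q m n"
proof -
  note s = supported_subgroup[OF P, where ?'a = 'k] supported_subgroup[OF Q, where ?'a = 'k]
  note T = tensor_power_equiv[OF _ s]
  show ?thesis
    using divides_multiple_equiv[OF T(1)[of m] additive_points_bimod[OF s, of m] T(1)[of n] T(2)[of m] T(2)[of n]]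
      retract_perm_bimod_iff[OF perm_action_points[OF P Q, of m] perm_action_points[OF P Q, of n], where ?'k = 'k]
      assms
    by (simp add: point_retract_def biact_def[abs_def])
qed

lemma divides_regular_iff:
  shows "divides_multiple (supported H) (supported H)
      (tensor_power (group_algebra G) (supported H) 1 :: ('g \<Rightarrow>\<^sub>0 'k::field, _) bimod)
      (regular_bimod (group_algebra G) (supported H)) \<longleftrightarrow>
    point_retract TYPE('k) G H H H 1 0"
  and "divides_multiple (supported H) (supported H)
      (regular_bimod (group_algebra G) (supported H))
      (tensor_power (group_algebra G) (supported H) 1 :: ('g \<Rightarrow>\<^sub>0 'k::field, _) bimod) \<longleftrightarrow>
    point_retract TYPE('k) G H H H 0 1"
proof -
  have s: "supported H \<subseteq> (supported (carrier G) :: ('g \<Rightarrow>\<^sub>0 'k) set)" by (rule supported_subgroup[OF sub])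
  note ap = additive_points_bimod[OF s s]
  note te = tensor_power_equiv[OF _ s s, of 1]
  note re = regular_bimod_equiv[OF order.refl order.refl, where ?'k = 'k]
  note pa = perm_action_points[OF sub sub]
  show "divides_multiple (supported H) (supported H)
      (tensor_power (group_algebra G) (supported H) 1 :: ('g \<Rightarrow>\<^sub>0 'k::field, _) bimod)
      (regular_bimod (group_algebra G) (supported H)) \<longleftrightarrow>
    point_retract TYPE('k) G H H H 1 0"
    using divides_multiple_equiv[OF te(1) ap[of 1] re(1) te(2) re(2)]
      retract_perm_bimod_iff[OF pa[of 1] pa[of 0], where ?'k = 'k]
    by (simp add: point_retract_def biact_def[abs_def])
  show "divides_multiple (supported H) (supported H)
      (regular_bimod (group_algebra G) (supported H))
      (tensor_power (group_algebra G) (supported H) 1 :: ('g \<Rightarrow>\<^sub>0 'k::field, _) bimod) \<longleftrightarrow>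
    point_retract TYPE('k) G H H H 0 1"
    using divides_multiple_equiv[OF re(1) ap[of 0] te(1) re(2) te(2)]
      retract_perm_bimod_iff[OF pa[of 0] pa[of 1], where ?'k = 'k]
    by (simp add: point_retract_def biact_def[abs_def])
qed

lemma carrier_supported: "carrier (group_algebra G) = supported (carrier G)"
  by auto

text \<open>The dictionary between depth and invariant matrices on points; the later arguments about
  depth no longer touch the tensor powers.\<close>

lemma has_depth_iff:
  "has_depth (supported H) (group_algebra G :: ('g \<Rightarrow>\<^sub>0 'k::field) ring) d \<longleftrightarrow>
    (\<exists>n. d = 2 * n + 1 \<and> point_retract TYPE('k) G H H H (n + 1) n \<and> point_retract TYPE('k) G H H H n (n + 1)) \<or>
    (\<exists>n\<ge>1. d = 2 * n \<and>
      (point_retract TYPE('k) G H H (carrier G) (n + 1) n \<and> point_retract TYPE('k) G H H (carrier G) n (n + 1) \<or>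
       point_retract TYPE('k) G H (carrier G) H (n + 1) n \<and> point_retract TYPE('k) G H (carrier G) H n (n + 1)))"
proof -
  have "depth_odd (group_algebra G :: ('g \<Rightarrow>\<^sub>0 'k) ring) (supported H) n \<longleftrightarrow>
      point_retract TYPE('k) G H H H (n + 1) n \<and> point_retract TYPE('k) G H H H n (n + 1)" for n
    using divides_regular_iff[where ?'k = 'k] divides_tensor_power_iff[OF sub sub, of "n + 1" n, where ?'k = 'k]
      divides_tensor_power_iff[OF sub sub, of n "n + 1", where ?'k = 'k]
    by (cases n) (simp_all add: depth_odd_def similar_bimod_def)
  moreover have "left_depth_even (group_algebra G :: ('g \<Rightarrow>\<^sub>0 'k) ring) (supported H) n \<longleftrightarrow>
      point_retract TYPE('k) G H H (carrier G) (n + 1) n \<and> point_retract TYPE('k) G H H (carrier G) n (n + 1)"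
    if "n \<ge> 1" for n
    using divides_tensor_power_iff[OF sub subgroup_self, of "n + 1" n, where ?'k = 'k] that
      divides_tensor_power_iff[OF sub subgroup_self, of n "n + 1", where ?'k = 'k]
    by (simp add: left_depth_even_def similar_bimod_def carrier_supported)
  moreover have "right_depth_even (group_algebra G :: ('g \<Rightarrow>\<^sub>0 'k) ring) (supported H) n \<longleftrightarrow>
      point_retract TYPE('k) G H (carrier G) H (n + 1) n \<and> point_retract TYPE('k) G H (carrier G) H n (n + 1)"
    if "n \<ge> 1" for n
    using divides_tensor_power_iff[OF subgroup_self sub, of "n + 1" n, where ?'k = 'k] that
      divides_tensor_power_iff[OF subgroup_self sub, of n "n + 1", where ?'k = 'k]
    by (simp add: right_depth_even_def similar_bimod_def carrier_supported)
  ultimately show ?thesis unfolding has_depth_def by blast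
qed

text \<open>
  The word \<open>[x\<^sub>1, \<dots>, x\<^sub>n]\<close> goes to \<open>[x\<^sub>n\<^sup>-\<^sup>1, \<dots>, x\<^sub>1\<^sup>-\<^sup>1]\<close>, except that the list of
  cosets is left in its old order. This exchanges left and right depth.
\<close>

definition flip :: "'g set list \<times> 'g \<Rightarrow> 'g set list \<times> 'g" where
  "flip x = (map (\<lambda>c. inv (snd x) <# c) (fst x), inv (snd x))"

lemma flip_points: "x \<in> points G H n \<Longrightarrow> n > 0 \<Longrightarrow> flip x \<in> points G H n"
  by (auto simp: points_def flip_def coset_closed subset_iff)

lemma coset_assoc: "c \<in> left_cosets G H \<Longrightarrow> g \<in> carrier G \<Longrightarrow> h \<in> carrier G \<Longrightarrow> g <# (h <# c) = (g \<otimes> h) <# c"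
  using coset_sub by (simp add: lcos_m_assoc)

lemma coset_one: "c \<in> left_cosets G H \<Longrightarrow> \<one> <# c = c"
  using coset_sub by (simp add: lcos_mult_one)

lemma flip_flip: "x \<in> points G H n \<Longrightarrow> flip (flip x) = x"
  using points_carrier[of x n]
  by (auto simp: flip_def prod_eq_iff coset_assoc coset_one subset_iff intro!: map_idI)

lemma flip_biact:
  assumes "x \<in> points G H n" "g \<in> carrier G" "h \<in> carrier G"
  shows "flip (biact G (g, h) x) = biact G (inv h, inv g) (flip x)"
proof -
  have x: "snd x \<in> carrier G" "set (fst x) \<subseteq> left_cosets G H"
    using points_carrier[OF assms(1)] by auto
  have "inv (g \<otimes> (snd x \<otimes> h)) <# (g <# c) = inv h <# (inv (snd x) <# c)" if "c \<in> left_cosets G H" for c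
    using that x assms by (simp add: coset_assoc inv_mult_group m_assoc)
  then show ?thesis
    using x assms by (auto simp: biact_def flip_def lmul_def rmul_def inv_mult_group m_assoc)
qed

text \<open>\<open>flip\<close> is a bijection that intertwines the two actions up to inverting and
  swapping the group elements. It is thus a quotient map with one-point fibres, and the pair
  \<open>(\<one>, \<one>)\<close> meets the transitivity conditions.\<close>

lemma point_retract_flip:
  assumes "point_retract TYPE('k::field) G H (carrier G) H m n" "m > 0" "n > 0"
  shows "point_retract TYPE('k) G H H (carrier G) m n"
  unfolding point_retract_def
proof (rule matrix_retract_quotient[OF finite_points[of m] finite_points[of n]])
  have im: "flip ` points G H k = points G H k" if "k > 0" for k
    using flip_points[of _ k] flip_flip[of _ k] that by force
  show "flip ` points G H m = points G H m" "flip ` points G H n = points G H n"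
    using assms im by auto
  show "\<exists>c\<in>carrier G \<times> H. (\<forall>x\<in>points G H m. flip (biact G c x) = biact G c' (flip x)) \<and>
      (\<forall>y\<in>points G H n. flip (biact G c y) = biact G c' (flip y))" if c': "c' \<in> H \<times> carrier G" for c'
  proof (intro bexI[of _ "(inv (snd c'), inv (fst c'))"] conjI ballI)
    show "flip (biact G (inv (snd c'), inv (fst c')) x) = biact G c' (flip x)" if "x \<in> points G H k" for x k
      using c' flip_biact[OF that, of "inv (snd c')" "inv (fst c')"] by auto
    then show "flip (biact G (inv (snd c'), inv (fst c')) x) = biact G c' (flip x)" if "x \<in> points G H n" for x
      using that .
  qed (use c' in auto)
  show "bij_betw (biact G c) (points G H m) (points G H m) \<and> bij_betw (biact G c) (points G H n) (points G H n)"
    if "c \<in> carrier G \<times> H" for c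
    using assms that by (intro conjI biact_bij[OF subgroup_self sub]) auto
  have one: "(\<one>, \<one>) \<in> carrier G \<times> H" by simp
  have b1: "biact G (\<one>, \<one>) x = x" if "x \<in> points G H k" for x k
    using that by (simp add: biact_def lmul_one[of _ k] rmul_one[of _ k])
  have inj: "x = x'" if "x \<in> points G H k" "x' \<in> points G H k" "flip x = flip x'" for x x' k
  proof -
    have "flip (flip x) = flip (flip x')" by (simp only: that(3))
    then show ?thesis by (simp only: flip_flip[OF that(1)] flip_flip[OF that(2)])
  qed
  show "\<exists>c\<in>carrier G \<times> H. x' = biact G c x \<and> (\<forall>y\<in>points G H n. flip (biact G c y) = flip y)"
    if "x \<in> points G H m" "x' \<in> points G H m" "flip x = flip x'" for x x'
    using inj[OF that] b1 that one by (intro bexI[of _ "(\<one>, \<one>)"]) auto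
  show "\<exists>c\<in>carrier G \<times> H. y' = biact G c y \<and> (\<forall>x\<in>points G H m. flip (biact G c x) = flip x)"
    if "y \<in> points G H n" "y' \<in> points G H n" "flip y = flip y'" for y y'
    using inj[OF that] b1 that one by (intro bexI[of _ "(\<one>, \<one>)"]) auto
  show "matrix_retract TYPE('k) (carrier G \<times> H) (biact G) (biact G) (points G H m) (points G H n)"
    using assms(1) by (simp add: point_retract_def)
qed

text \<open>\<open>p\<close> is the quotient map for the right action of \<open>Q\<close>: it
  identifies the orbits with \<open>k\<close>-tuples of cosets, as left
  \<open>H\<close>-sets.\<close>

definition right_orbit_map :: "'g set \<Rightarrow> nat \<Rightarrow> nat \<Rightarrow> ('g set list \<times> 'g \<Rightarrow> 'g set list) \<Rightarrow> bool" where
  "right_orbit_map Q n k p \<longleftrightarrow>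
     p ` points G H n = coset_tuples G H k \<and>
     (\<forall>x\<in>points G H n. \<forall>h\<in>H. p (lmul G h x) = map (\<lambda>c. h <# c) (p x)) \<and>
     (\<forall>x\<in>points G H n. \<forall>g\<in>Q. p (rmul G x g) = p x) \<and>
     (\<forall>x\<in>points G H n. \<forall>x'\<in>points G H n. p x = p x' \<longrightarrow> (\<exists>g\<in>Q. x' = rmul G x g))"

text \<open>On modules this is tensoring from the right with the trivial \<open>Q\<close>-module.
  The fibres are single \<open>Q\<close>-orbits, and the pairs \<open>(\<one>, g)\<close> move along
  them while leaving both quotient maps unchanged.\<close>

lemma point_retract_orbits:
  assumes Q: "subgroup Q G" and mn: "m > 0 \<and> n > 0 \<or> Q = H"
    and p: "right_orbit_map Q m k p" and s: "right_orbit_map Q n l s"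
    and ret: "point_retract TYPE('k::field) G H H Q m n"
  shows "coset_retract TYPE('k) G H k l"
  unfolding coset_retract_def
proof (rule matrix_retract_quotient[OF finite_points[of m] finite_points[of n]])
  note pD = p[unfolded right_orbit_map_def] and sD = s[unfolded right_orbit_map_def]
  have b: "biact G (h, \<one>) x = lmul G h x" if "x \<in> points G H i" for x h i
    using that by (simp add: biact_def rmul_one[of _ i])
  have b': "biact G (\<one>, g) x = rmul G x g" if "x \<in> points G H i" "i > 0 \<or> Q = H" "g \<in> Q" for x g i
  proof -
    have "rmul G x g \<in> points G H i"
      using that subgroup.mem_carrier[OF Q] by (intro rmul_points) auto
    then show ?thesis by (simp add: biact_def lmul_one)
  qed
  have one: "\<one> \<in> Q" using subgroup.one_closed[OF Q] .
  show "p ` points G H m = coset_tuples G H k" "s ` points G H n = coset_tuples G H l"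
    using pD sD by auto
  show "\<exists>c\<in>H \<times> Q. (\<forall>x\<in>points G H m. p (biact G c x) = map ((<#) h) (p x)) \<and>
      (\<forall>y\<in>points G H n. s (biact G c y) = map ((<#) h) (s y))" if "h \<in> H" for h
    using that one pD sD b by (intro bexI[of _ "(h, \<one>)"]) auto
  show "bij_betw (biact G c) (points G H m) (points G H m) \<and> bij_betw (biact G c) (points G H n) (points G H n)"
    if "c \<in> H \<times> Q" for c
    using mn that by (intro conjI biact_bij[OF sub Q]) auto
  show "\<exists>c\<in>H \<times> Q. x' = biact G c x \<and> (\<forall>y\<in>points G H n. s (biact G c y) = s y)"
    if x: "x \<in> points G H m" "x' \<in> points G H m" "p x = p x'" for x x'
  proof -
    obtain g where "g \<in> Q" "x' = rmul G x g" using pD x by blast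
    moreover from \<open>g \<in> Q\<close> have "biact G (\<one>, g) x = rmul G x g"
      "\<forall>y\<in>points G H n. s (biact G (\<one>, g) y) = s y"
      using b'[of _ m g] b'[of _ n g] mn x(1) sD by (blast, metis)
    ultimately show ?thesis by (intro bexI[of _ "(\<one>, g)"]) simp_all
  qed
  show "\<exists>c\<in>H \<times> Q. y' = biact G c y \<and> (\<forall>x\<in>points G H m. p (biact G c x) = p x)"
    if y: "y \<in> points G H n" "y' \<in> points G H n" "s y = s y'" for y y'
  proof -
    obtain g where "g \<in> Q" "y' = rmul G y g" using sD y by blast
    moreover from \<open>g \<in> Q\<close> have "biact G (\<one>, g) y = rmul G y g"
      "\<forall>x\<in>points G H m. p (biact G (\<one>, g) x) = p x"
      using b'[of _ m g] b'[of _ n g] mn y(1) pD by (blast, metis)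
    ultimately show ?thesis by (intro bexI[of _ "(\<one>, g)"]) simp_all
  qed
  show "matrix_retract TYPE('k) (H \<times> Q) (biact G) (biact G) (points G H m) (points G H n)"
    using ret by (simp add: point_retract_def)
qed

text \<open>\<open>G\<close> acts simply transitively on the last component, so the quotient forgets
  it: \<open>n\<close> tensor factors leave \<open>n - 1\<close> cosets.\<close>

lemma right_orbit_map_fst:
  assumes "n > 0"
  shows "right_orbit_map (carrier G) n (n - 1) fst"
  unfolding right_orbit_map_def
proof (intro conjI ballI impI)
  show "fst ` points G H n = coset_tuples G H (n - 1)"
    using assms by (auto simp: points_def coset_tuples_def)
  show "\<exists>g\<in>carrier G. x' = rmul G x g" if "x \<in> points G H n" "x' \<in> points G H n" "fst x = fst x'" for x x'
    using points_carrier[OF that(1)] points_carrier[OF that(2)] that(3)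
    by (intro bexI[of _ "inv (snd x) \<otimes> snd x'"]) (auto simp: rmul_def prod_eq_iff simp flip: m_assoc)
qed (auto simp: lmul_def rmul_def)

lemma coset_eq_iff: "x \<in> carrier G \<Longrightarrow> y \<in> carrier G \<Longrightarrow> x <# H = y <# H \<longleftrightarrow> inv x \<otimes> y \<in> H"
proof
  assume c: "x \<in> carrier G" "y \<in> carrier G"
  {
    assume "x <# H = y <# H"
    then have "y \<in> x <# H" using c(2) H.one_closed by (force simp: l_coset_def)
    then obtain k where "k \<in> H" "y = x \<otimes> k" by (auto simp: l_coset_def)
    then show "inv x \<otimes> y \<in> H" using c by (simp flip: m_assoc)
  next
    assume "inv x \<otimes> y \<in> H"
    then have "(inv x \<otimes> y) <# H = H" using c by (simp add: coset_join3 sub)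
    then have "x <# H = x <# ((inv x \<otimes> y) <# H)" by simp
    also have "\<dots> = y <# H"
      using c H.subset by (simp add: lcos_m_assoc flip: m_assoc)
    finally show "x <# H = y <# H" .
  }
qed

text \<open>Right \<open>H\<close>-orbits of the last component are cosets, so it joins the tuple as
  an \<open>n\<close>-th coset. For \<open>n = 0\<close> the last component runs through
  \<open>H\<close>, a single orbit, and only the empty tuple remains.\<close>

lemma right_orbit_map_append:
  "right_orbit_map H n n (\<lambda>x. if n = 0 then fst x else fst x @ [snd x <# H])"
proof (cases "n = 0")
  case True
  have "\<exists>g\<in>H. x' = rmul G x g" if "x \<in> points G H 0" "x' \<in> points G H 0" "fst x = fst x'" for x x'
    using that points_carrier[OF that(1)] points_carrier[OF that(2)]
    by (intro bexI[of _ "inv (snd x) \<otimes> snd x'"])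
      (auto simp: rmul_def prod_eq_iff points_def simp flip: m_assoc)
  moreover have "fst ` points G H 0 = coset_tuples G H 0"
  proof -
    have "H \<noteq> {}" using H.one_closed by blast
    then show ?thesis by (simp add: points_def coset_tuples_def fst_image_times)
  qed
  ultimately show ?thesis
    using True by (auto simp: right_orbit_map_def lmul_def rmul_def)
next
  case False
  show ?thesis
    unfolding right_orbit_map_def
  proof (intro conjI ballI impI)
    let ?p = "\<lambda>x. if n = 0 then fst x else fst x @ [snd x <# H]"
    show "?p ` points G H n = coset_tuples G H n"
    proof (intro equalityI subsetI)
      fix cs assume "cs \<in> ?p ` points G H n"
      then show "cs \<in> coset_tuples G H n"
        using False by (auto simp: points_def coset_tuples_def left_cosets_def)
    next
      fix cs assume cs: "cs \<in> coset_tuples G H n"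
      then have ne: "cs \<noteq> []" using False by (auto simp: coset_tuples_def)
      then have "last cs \<in> left_cosets G H" using cs last_in_set[OF ne] by (auto simp: coset_tuples_def)
      then obtain y where y: "y \<in> carrier G" "last cs = y <# H" by (auto simp: left_cosets_def)
      have "(butlast cs, y) \<in> points G H n"
        using cs y False by (auto simp: points_def coset_tuples_def dest: in_set_butlastD)
      moreover have "cs = ?p (butlast cs, y)" using ne y False by (simp flip: y(2))
      ultimately show "cs \<in> ?p ` points G H n" by blast
    qed
    fix x assume x: "x \<in> points G H n"
    show "?p (lmul G h x) = map (\<lambda>c. h <# c) (?p x)" if "h \<in> H" for h
      using False that points_carrier[OF x] H.subset by (simp add: lmul_def lcos_m_assoc)
    show "?p (rmul G x g) = ?p x" if "g \<in> H" for g
    proof -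
      have "inv (snd x \<otimes> g) \<otimes> snd x \<in> H"
        using points_carrier[OF x] that by (simp add: inv_mult_group m_assoc)
      then show ?thesis
        using False that points_carrier[OF x] by (simp add: rmul_def coset_eq_iff)
    qed
    show "\<exists>g\<in>H. x' = rmul G x g" if x': "x' \<in> points G H n" and eq: "?p x = ?p x'" for x'
      using eq False points_carrier[OF x] points_carrier[OF x']
      by (intro bexI[of _ "inv (snd x) \<otimes> snd x'"])
        (auto simp: rmul_def prod_eq_iff coset_eq_iff simp flip: m_assoc)
  qed
qed

lemma coset_retract_odd:
  "point_retract TYPE('k::field) G H H H m n \<Longrightarrow> coset_retract TYPE('k) G H m n"
  by (rule point_retract_orbits[OF sub _ right_orbit_map_append right_orbit_map_append]) auto

lemma coset_retract_even:
  "m > 0 \<Longrightarrow> n > 0 \<Longrightarrow> point_retract TYPE('k::field) G H H (carrier G) m n \<Longrightarrow>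
    coset_retract TYPE('k) G H (m - 1) (n - 1)"
  by (rule point_retract_orbits[OF subgroup_self _ right_orbit_map_fst right_orbit_map_fst]) auto

end

section \<open>Comparison with a quotient group whose kernel lies in \<open>H\<close>\<close>

locale pair_quotient = G: finite_pair G H + Q: finite_pair G' H'
  for G :: "('g, 'z) monoid_scheme" and H and G' :: "('h, 'y) monoid_scheme" and H' +
  fixes \<pi> :: "'g \<Rightarrow> 'h"
  assumes hom: "\<pi> \<in> hom G G'" and surj: "\<pi> ` carrier G = carrier G'" and img: "\<pi> ` H = H'"
    and ker: "x \<in> carrier G \<Longrightarrow> \<pi> x = \<one>\<^bsub>G'\<^esub> \<Longrightarrow> x \<in> H"
begin

sublocale \<pi>: group_hom G G' \<pi>
  by unfold_locales (rule hom)

text \<open>Elements with the same image differ by a kernel element, and the kernel lies in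
  \<open>H\<close>; hence \<open>H\<close> is the full preimage of \<open>H'\<close>.\<close>

lemma mem_H_iff: "x \<in> carrier G \<Longrightarrow> \<pi> x \<in> H' \<longleftrightarrow> x \<in> H"
proof
  assume x: "x \<in> carrier G" and "\<pi> x \<in> H'"
  then obtain h where h: "h \<in> H" "\<pi> x = \<pi> h" using img by auto
  then have "\<pi> (x \<otimes>\<^bsub>G\<^esub> inv\<^bsub>G\<^esub> h) = \<one>\<^bsub>G'\<^esub>" using x by simp
  then have "x \<otimes>\<^bsub>G\<^esub> inv\<^bsub>G\<^esub> h \<in> H" using x h by (intro ker) auto
  then have "x \<otimes>\<^bsub>G\<^esub> inv\<^bsub>G\<^esub> h \<otimes>\<^bsub>G\<^esub> h \<in> H" using h(1) by (rule G.H.m_closed)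
  then show "x \<in> H" using x h by (simp add: G.m_assoc)
qed (use img in auto)

lemma image_lcoset: "c \<subseteq> carrier G \<Longrightarrow> g \<in> carrier G \<Longrightarrow> \<pi> ` (g <#\<^bsub>G\<^esub> c) = \<pi> g <#\<^bsub>G'\<^esub> \<pi> ` c"
  by (force simp: l_coset_def)

lemma image_coset: "g \<in> carrier G \<Longrightarrow> \<pi> ` (g <#\<^bsub>G\<^esub> H) = \<pi> g <#\<^bsub>G'\<^esub> H'"
  by (simp add: image_lcoset G.H.subset img)

text \<open>Equality of cosets is the condition \<open>x^-1 y \<in> H\<close>, which
  \<open>\<pi>\<close> preserves and reflects because \<open>H\<close> is the full preimage of
  \<open>H'\<close>.\<close>

lemma coset_bij: "bij_betw (image \<pi>) (left_cosets G H) (left_cosets G' H')"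
  unfolding bij_betw_def
proof
  show "inj_on (image \<pi>) (left_cosets G H)"
  proof (rule inj_onI)
    fix c d assume "c \<in> left_cosets G H" "d \<in> left_cosets G H" and eq: "\<pi> ` c = \<pi> ` d"
    then obtain x y where x: "x \<in> carrier G" "c = x <#\<^bsub>G\<^esub> H" and y: "y \<in> carrier G" "d = y <#\<^bsub>G\<^esub> H"
      by (auto simp: left_cosets_def)
    have "inv\<^bsub>G'\<^esub> \<pi> x \<otimes>\<^bsub>G'\<^esub> \<pi> y \<in> H'"
      using eq x y by (simp add: image_coset Q.coset_eq_iff)
    then have "inv\<^bsub>G\<^esub> x \<otimes>\<^bsub>G\<^esub> y \<in> H"
      using x y mem_H_iff[of "inv\<^bsub>G\<^esub> x \<otimes>\<^bsub>G\<^esub> y"] by simp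
    then show "c = d" using x y by (simp add: G.coset_eq_iff)
  qed
  have "image \<pi> ` left_cosets G H = (\<lambda>g. \<pi> g <#\<^bsub>G'\<^esub> H') ` carrier G"
    unfolding left_cosets_def image_image by (intro image_cong refl image_coset)
  also have "\<dots> = left_cosets G' H'"
    unfolding left_cosets_def surj[symmetric] image_image by (rule refl)
  finally show "image \<pi> ` left_cosets G H = left_cosets G' H'" .
qed

lemma tuples_bij: "bij_betw (map (image \<pi>)) {cs. set cs \<subseteq> left_cosets G H \<and> length cs = n}
    {cs. set cs \<subseteq> left_cosets G' H' \<and> length cs = n}"
proof -
  let ?g = "the_inv_into (left_cosets G H) (image \<pi>)"
  have gf: "?g (\<pi> ` c) = c" if "c \<in> left_cosets G H" for c
    using coset_bij that by (simp add: bij_betw_def the_inv_into_f_f)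
  have fg: "\<pi> ` ?g c = c" if "c \<in> left_cosets G' H'" for c
    using coset_bij that by (simp add: bij_betw_def f_the_inv_into_f)
  have f: "\<pi> ` c \<in> left_cosets G' H'" if "c \<in> left_cosets G H" for c
    using coset_bij that by (auto simp: bij_betw_def)
  have g: "?g c \<in> left_cosets G H" if "c \<in> left_cosets G' H'" for c
    using bij_betw_the_inv_into[OF coset_bij] that by (auto simp: bij_betw_def)
  show ?thesis
    by (rule bij_betw_byWitness[where f' = "map ?g"])
      (auto simp: gf fg f g subset_iff intro!: map_idI)
qed

text \<open>Tuples of cosets correspond one to one, so two points with the same image differ by a
  kernel element multiplying the last component from the right. It lies in \<open>H\<close>, hence
  in \<open>Q\<close>, and becomes trivial under \<open>\<pi>\<close>; this gives the transitivity
  on fibres.\<close>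

lemma point_retract_quotient:
  assumes P: "subgroup P G" and Q: "subgroup Q G" and mn: "m > 0 \<and> n > 0 \<or> P = H \<and> Q = H"
    and HQ: "H \<subseteq> Q"
    and ret: "point_retract TYPE('k::field) G H P Q m n"
  shows "point_retract TYPE('k) G' H' (\<pi> ` P) (\<pi> ` Q) m n"
  unfolding point_retract_def
proof (rule matrix_retract_quotient[OF G.finite_points[of m] G.finite_points[of n]])
  define p where "p x = (map (image \<pi>) (fst x), \<pi> (snd x))" for x :: "'g set list \<times> 'g"
  have im: "p ` points G H k = points G' H' k" for k
  proof -
    have "p ` points G H k = map (image \<pi>) ` {cs. set cs \<subseteq> left_cosets G H \<and> length cs = k - 1}
        \<times> \<pi> ` (if k = 0 then H else carrier G)"
      unfolding points_def p_def by (force simp: image_iff)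
    then show ?thesis
      using tuples_bij[of "k - 1"] by (simp add: points_def bij_betw_def surj img)
  qed
  then show "p ` points G H m = points G' H' m" "p ` points G H n = points G' H' n" by auto
  have PG: "g \<in> carrier G" if "g \<in> P" for g using subgroup.mem_carrier[OF P that] .
  have QG: "g \<in> carrier G" if "g \<in> Q" for g using subgroup.mem_carrier[OF Q that] .
  have bi: "p (biact G c x) = biact G' (\<pi> (fst c), \<pi> (snd c)) (p x)"
    if "x \<in> points G H k" "c \<in> P \<times> Q" for x c k
  proof -
    have x: "snd x \<in> carrier G" "set (fst x) \<subseteq> left_cosets G H" using G.points_carrier[OF that(1)] by auto
    have "\<pi> ` (g <#\<^bsub>G\<^esub> d) = \<pi> g <#\<^bsub>G'\<^esub> \<pi> ` d" if "g \<in> P" "d \<in> set (fst x)" for g d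
      using that x PG G.coset_sub[of d] by (intro image_lcoset) auto
    then show ?thesis
      using that(2) PG QG x by (simp add: p_def biact_def lmul_def rmul_def mem_Times_iff)
  qed
  show "\<exists>c\<in>P \<times> Q. (\<forall>x\<in>points G H m. p (biact G c x) = biact G' c' (p x)) \<and>
      (\<forall>y\<in>points G H n. p (biact G c y) = biact G' c' (p y))" if c': "c' \<in> \<pi> ` P \<times> \<pi> ` Q" for c'
  proof -
    obtain g h where "g \<in> P" "h \<in> Q" "c' = (\<pi> g, \<pi> h)" using c' by auto
    then show ?thesis by (intro bexI[of _ "(g, h)"]) (auto simp: bi)
  qed
  show "bij_betw (biact G c) (points G H m) (points G H m) \<and> bij_betw (biact G c) (points G H n) (points G H n)"
    if "c \<in> P \<times> Q" for c
    using mn that by (intro conjI G.biact_bij[OF P Q]) auto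
  have one: "\<one>\<^bsub>G\<^esub> \<in> P" using subgroup.one_closed[OF P] .
  have fib: "\<exists>c\<in>P \<times> Q. x' = biact G c x \<and> (\<forall>y\<in>points G H l. p (biact G c y) = p y)"
    if x: "x \<in> points G H k" "x' \<in> points G H k" "p x = p x'" for x x' k l
  proof -
    let ?g = "inv\<^bsub>G\<^esub> (snd x) \<otimes>\<^bsub>G\<^esub> snd x'"
    have s: "snd x \<in> carrier G" "snd x' \<in> carrier G" using G.points_carrier x by auto
    have g1: "\<pi> ?g = \<one>\<^bsub>G'\<^esub>" using x(3) s by (simp add: p_def)
    then have g: "?g \<in> Q" using s HQ ker[of ?g] by auto
    have "fst x = fst x'"
      using x tuples_bij[of "k - 1"] by (auto simp: p_def points_def bij_betw_def inj_on_def)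
    then have "x' = rmul G x ?g" using s by (simp add: rmul_def prod_eq_iff flip: G.m_assoc)
    moreover have "lmul G \<one>\<^bsub>G\<^esub> x' = x'" using x(2) by (rule G.lmul_one)
    ultimately have "x' = biact G (\<one>\<^bsub>G\<^esub>, ?g) x" by (simp add: biact_def)
    moreover have "p (biact G (\<one>\<^bsub>G\<^esub>, ?g) y) = p y" if y: "y \<in> points G H l" for y
    proof -
      have py: "p y \<in> points G' H' l" using im y by blast
      have "p (biact G (\<one>\<^bsub>G\<^esub>, ?g) y) = biact G' (\<pi> \<one>\<^bsub>G\<^esub>, \<pi> ?g) (p y)"
        using bi[OF y, of "(\<one>\<^bsub>G\<^esub>, ?g)"] one g by simp
      then show ?thesis
        by (simp only: g1 \<pi>.hom_one biact_def fst_conv snd_conv Q.rmul_one[OF py] Q.lmul_one[OF py])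
    qed
    ultimately show ?thesis using one g by (intro bexI[of _ "(\<one>\<^bsub>G\<^esub>, ?g)"]) auto
  qed
  show "\<exists>c\<in>P \<times> Q. x' = biact G c x \<and> (\<forall>y\<in>points G H n. p (biact G c y) = p y)"
    if "x \<in> points G H m" "x' \<in> points G H m" "p x = p x'" for x x'
    using fib[OF that] .
  show "\<exists>c\<in>P \<times> Q. y' = biact G c y \<and> (\<forall>x\<in>points G H m. p (biact G c x) = p x)"
    if "y \<in> points G H n" "y' \<in> points G H n" "p y = p y'" for y y'
    using fib[OF that] .
  show "matrix_retract TYPE('k) (P \<times> Q) (biact G) (biact G) (points G H m) (points G H n)"
    using ret by (simp add: point_retract_def)
qed

lemma has_depth_quotient:
  assumes "has_depth (supported H) (group_algebra G :: ('g \<Rightarrow>\<^sub>0 'k::field) ring) d"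
  shows "has_depth (supported H') (group_algebra G' :: ('h \<Rightarrow>\<^sub>0 'k) ring) d"
proof -
  note odd = point_retract_quotient[OF G.sub G.sub, where ?'k = 'k, unfolded img]
  note left = point_retract_quotient[OF G.sub G.subgroup_self, where ?'k = 'k, unfolded img surj]
  note right = point_retract_quotient[OF G.subgroup_self G.sub, where ?'k = 'k, unfolded img surj]
  show ?thesis
    using assms unfolding G.has_depth_iff Q.has_depth_iff
    by (elim disjE exE conjE) (auto intro!: odd left right simp: G.H.subset)
qed

text \<open>The last component plays the role of the factor \<open>Z\<close>: it is moved in the
  same way in both sets of points, so equality of last components is invariant. On the tuples of
  cosets \<open>H\<close> acts through \<open>\<pi>\<close>, and the right action of
  \<open>G\<close> does not touch them.\<close>

lemma point_retract_lift:
  assumes "coset_retract TYPE('k::field) G' H' m n"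
  shows "point_retract TYPE('k) G H H (carrier G) (m + 1) (n + 1)"
  unfolding point_retract_def
proof (rule matrix_retract_product[OF G.finite_points])
  define p where "p x = map (image \<pi>) (fst x)" for x :: "'g set list \<times> 'g"
  have "bij_betw (\<lambda>x. (p x, snd x)) (points G H (k + 1)) (coset_tuples G' H' k \<times> carrier G)" for k
  proof -
    have "bij_betw (map_prod (map (image \<pi>)) id) ({cs. set cs \<subseteq> left_cosets G H \<and> length cs = k} \<times> carrier G)
      ({cs. set cs \<subseteq> left_cosets G' H' \<and> length cs = k} \<times> carrier G)"
      by (rule bij_betw_map_prod[OF tuples_bij]) simp
    then show ?thesis by (simp add: points_def coset_tuples_def p_def map_prod_def case_prod_unfold)
  qed
  then show "bij_betw (\<lambda>x. (p x, snd x)) (points G H (m + 1)) (coset_tuples G' H' m \<times> carrier G)"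
    "bij_betw (\<lambda>x. (p x, snd x)) (points G H (n + 1)) (coset_tuples G' H' n \<times> carrier G)" by auto
  have bi: "p (biact G (h, g) x) = map (\<lambda>c. \<pi> h <#\<^bsub>G'\<^esub> c) (p x)"
    if "x \<in> points G H k" "h \<in> H" for x h g k
  proof -
    have x: "set (fst x) \<subseteq> left_cosets G H" using G.points_carrier[OF that(1)] by auto
    have "\<pi> ` (h <#\<^bsub>G\<^esub> d) = \<pi> h <#\<^bsub>G'\<^esub> \<pi> ` d" if "d \<in> set (fst x)" for d
      using that x \<open>h \<in> H\<close> G.coset_sub[of d] by (intro image_lcoset) auto
    then show ?thesis by (auto simp: p_def biact_def lmul_def rmul_def)
  qed
  show "\<exists>c\<in>H'. (\<forall>x\<in>points G H (m + 1). p (biact G c' x) = map ((<#\<^bsub>G'\<^esub>) c) (p x)) \<and>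
      (\<forall>y\<in>points G H (n + 1). p (biact G c' y) = map ((<#\<^bsub>G'\<^esub>) c) (p y))"
    if "c' \<in> H \<times> carrier G" for c'
    using that img by (intro bexI[of _ "\<pi> (fst c')"]) (auto simp: bi)
  show "snd (biact G c' x) = snd (biact G c' y) \<longleftrightarrow> snd x = snd y"
    if "c' \<in> H \<times> carrier G" "x \<in> points G H (m + 1)" "y \<in> points G H (n + 1)" for c' x y
    using that G.points_carrier[OF that(2)] G.points_carrier[OF that(3)]
    by (auto simp: biact_def lmul_def rmul_def)
  show "matrix_retract TYPE('k) H' (\<lambda>g. map ((<#\<^bsub>G'\<^esub>) g)) (\<lambda>g. map ((<#\<^bsub>G'\<^esub>) g))
      (coset_tuples G' H' m) (coset_tuples G' H' n)"
    using assms by (simp add: coset_retract_def)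
qed

text \<open>Depth \<open>2n + 1\<close> gives similar left \<open>H'\<close>-modules on
  \<open>n + 1\<close> and \<open>n\<close> cosets; putting back the factor \<open>G\<close> yields
  the powers \<open>n + 2\<close> and \<open>n + 1\<close>, that is, left depth
  \<open>2n + 2\<close>. Depth \<open>2n\<close> leaves \<open>n\<close> and \<open>n - 1\<close>
  cosets, which come back as the powers \<open>n + 1\<close> and \<open>n\<close> without
  loss.\<close>

lemma has_depth_lift:
  assumes "has_depth (supported H') (group_algebra G' :: ('h \<Rightarrow>\<^sub>0 'k::field) ring) d"
  shows "has_depth (supported H) (group_algebra G :: ('g \<Rightarrow>\<^sub>0 'k) ring) d \<or>
    has_depth (supported H) (group_algebra G :: ('g \<Rightarrow>\<^sub>0 'k) ring) (d + 1)"
proof -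
  let ?R = "point_retract TYPE('k) G' H'"
  \<comment> \<open>Right depth has been turned into left depth by \<open>flip\<close>, so the even
    depths form a single case.\<close>
  consider (odd) n where "d = 2 * n + 1" "?R H' H' (n + 1) n" "?R H' H' n (n + 1)"
    | (even) n where "n \<ge> 1" "d = 2 * n" "?R H' (carrier G') (n + 1) n" "?R H' (carrier G') n (n + 1)"
    using assms Q.point_retract_flip unfolding Q.has_depth_iff by fastforce
  then show ?thesis
  proof cases
    case odd
    have "point_retract TYPE('k) G H H (carrier G) (n + 1 + 1) (n + 1)"
      "point_retract TYPE('k) G H H (carrier G) (n + 1) (n + 1 + 1)"
      using odd by (auto intro!: point_retract_lift Q.coset_retract_odd simp del: One_nat_def)
    then have "has_depth (supported H) (group_algebra G :: ('g \<Rightarrow>\<^sub>0 'k) ring) (2 * (n + 1))"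
      unfolding G.has_depth_iff by (intro disjI2 exI[of _ "n + 1"]) simp
    then show ?thesis using odd by simp
  next
    case even
    have "coset_retract TYPE('k) G' H' n (n - 1)" "coset_retract TYPE('k) G' H' (n - 1) n"
      using Q.coset_retract_even[of "n + 1" n] Q.coset_retract_even[of n "n + 1"] even by auto
    from this[THEN point_retract_lift] have "has_depth (supported H) (group_algebra G :: ('g \<Rightarrow>\<^sub>0 'k) ring) (2 * n)"
      using even(1) unfolding G.has_depth_iff by (intro disjI2 exI[of _ n]) simp
    then show ?thesis using even by simp
  qed
qed

end

text \<open>For nonempty \<open>A\<close> the infimum is attained by an element of \<open>A\<close>;
  for empty \<open>A\<close> the right side is \<open>\<infinity>\<close>.\<close>

lemma Inf_enat_le_add_one:
  assumes "\<And>m. m \<in> A \<Longrightarrow> m \<in> B \<or> m + 1 \<in> B"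
  shows "Inf (enat ` B) \<le> Inf (enat ` A) + 1"
proof (cases "A = {}")
  case True
  then show ?thesis by (simp add: Inf_enat_def)
next
  case False
  then have "Inf (enat ` A) \<in> enat ` A"
    unfolding Inf_enat_def by (auto intro: LeastI)
  then obtain m where m: "m \<in> A" "Inf (enat ` A) = enat m" by auto
  then consider "m \<in> B" | "m + 1 \<in> B" using assms by blast
  then show ?thesis
  proof cases
    case 1
    then have "Inf (enat ` B) \<le> enat m" by (intro Inf_lower) auto
    also have "\<dots> \<le> enat m + 1" by simp
    finally show ?thesis using m by simp
  next
    case 2
    then have "Inf (enat ` B) \<le> enat (m + 1)" by (intro Inf_lower) auto
    then show ?thesis using m by (simp add: one_enat_def)
  qed
qed

theorem proposition3p5:
  fixes G :: "('g, 'z) monoid_scheme" and H N :: "'g set"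
  assumes "group G" and "finite (carrier G)"
    and "subgroup H G" and "N \<lhd> G" and "N \<subseteq> H"
  shows "d0 TYPE('k::field_char_0) (carrier (G\<lparr>carrier := H\<rparr> Mod N)) (G Mod N)
           \<le> d0 TYPE('k) H G
       \<and> d0 TYPE('k) H G
           \<le> d0 TYPE('k) (carrier (G\<lparr>carrier := H\<rparr> Mod N)) (G Mod N) + 1"
proof -
  interpret G: group G by fact
  interpret N: normal N G by fact
  let ?\<pi> = "\<lambda>g. N #>\<^bsub>G\<^esub> g" and ?H = "carrier (G\<lparr>carrier := H\<rparr> Mod N)"
  have H: "?H = ?\<pi> ` H" by (simp add: carrier_FactGroup)
  have hom: "?\<pi> \<in> hom G (G Mod N)" by (rule N.r_coset_hom_Mod)
  interpret Q: group "G Mod N" by (rule N.factorgroup_is_group)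
  interpret \<pi>: group_hom G "G Mod N" ?\<pi> by unfold_locales (rule hom)
  interpret pair_quotient G H "G Mod N" ?H ?\<pi>
  proof (intro pair_quotient.intro finite_pair.intro finite_pair_axioms.intro pair_quotient_axioms.intro)
    show "group G" "group (G Mod N)" by (rule G.is_group, rule Q.is_group)
    show "subgroup H G" "finite (carrier G)" by fact+
    show "subgroup ?H (G Mod N)" unfolding H by (rule \<pi>.subgroup_img_is_subgroup) fact
    show "finite (carrier (G Mod N))" using \<open>finite (carrier G)\<close> by (simp add: carrier_FactGroup)
    show "?\<pi> \<in> hom G (G Mod N)" by (rule hom)
    show "?\<pi> ` carrier G = carrier (G Mod N)" by (simp add: carrier_FactGroup)
    show "?\<pi> ` H = ?H" by (simp add: H)
    \<comment> \<open>A trivial class means \<open>x \<in> N\<close>, so the kernel of the quotient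
      map lies in \<open>H\<close>.\<close>
    show "x \<in> H" if "x \<in> carrier G" "N #>\<^bsub>G\<^esub> x = \<one>\<^bsub>G Mod N\<^esub>" for x
      using G.coset_join1[OF _ that(1) N.is_subgroup] that(2) \<open>N \<subseteq> H\<close> by auto
  qed
  \<comment> \<open>The carrier of the smaller group algebra is the set of elements supported in the
    subgroup, the form in which the depth statements above are phrased.\<close>
  have d0: "d0 TYPE('k) K M = Inf (enat ` {m. 1 \<le> m \<and> has_depth (supported K) (group_algebra M :: ('m \<Rightarrow>\<^sub>0 'k) ring) m})"
    for K and M :: "('m, 'w) monoid_scheme"
    by (simp add: d0_def min_depth_def group_algebra_def)
  show ?thesis
    unfolding d0
  proof
    \<comment> \<open>Every depth of the given pair is a depth of the quotient pair, so the infimum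
      for the quotient runs over a larger set.\<close>
    show "Inf (enat ` {m. 1 \<le> m \<and> has_depth (supported ?H) (group_algebra (G Mod N) :: ('g set \<Rightarrow>\<^sub>0 'k) ring) m})
        \<le> Inf (enat ` {m. 1 \<le> m \<and> has_depth (supported H) (group_algebra G :: ('g \<Rightarrow>\<^sub>0 'k) ring) m})"
      by (rule Inf_superset_mono) (auto intro: has_depth_quotient)
    show "Inf (enat ` {m. 1 \<le> m \<and> has_depth (supported H) (group_algebra G :: ('g \<Rightarrow>\<^sub>0 'k) ring) m})
        \<le> Inf (enat ` {m. 1 \<le> m \<and> has_depth (supported ?H) (group_algebra (G Mod N) :: ('g set \<Rightarrow>\<^sub>0 'k) ring) m}) + 1"
      by (rule Inf_enat_le_add_one) (use has_depth_lift in auto)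
  qed
qed

end
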